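(* With $\widehat H$, $\xi_n$, $I$, $\rho_n$, $\rho_\infty$ as below, \[ \mathbb P\Big(\rho_n\to\rho_\infty\text{ uniformly on compact subsets of } I\ \text{ and }\ \lim_{n\to\infty}\inf_{u\in(0,1)\setminus I}\rho_n(u)=\infty\Big)=1, \] where the infimum over the empty set is $+\infty$.
   Context: For $H\in(0,1)$ let $f_H(\lambda)=C_H|e^{i\lambda}-1|^2\sum_{k\in\mathbb Z}|\lambda-2\pi k|^{-(2H+1)}$, $\lambda\in[-\pi,\pi)$, with $C_H>0$ the normalizing constant making $f_H$ the spectral density of fractional Gaussian noise. For integrable $g$, $\hat g(m)=\frac1{2\pi}\int_{-\pi}^{\pi}e^{-imt}g(t)dt$, $T_n(g)=(\hat g(j-k))_{j,k=1}^n$. Fix $\widehat H\in(0,1)$, let $\xi_n\sim N(0,T_n(f_{\widehat H}))$ on a common probability space, $I=(\widehat H-\frac12,1)\cap(0,1)$, $\rho_n(u)=n^{-1}\langle\xi_n,T_n(f_u)^{-1}\xi_n\rangle$ for $u\in(0,1)$, and $\rho_\infty(u)=\frac1{2\pi}\int_{-\pi}^{\pi}f_{\widehat H}(t)/f_u(t)\,dt$ for $u\in I$. *)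

theory Defs
  imports "HOL-Probability.Probability" "Jordan_Normal_Form.Gauss_Jordan_Elimination"
begin

definition fgn_shape :: "real \<Rightarrow> real \<Rightarrow> real" where
  "fgn_shape H l = (cmod (exp (\<i> * complex_of_real l) - 1))\<^sup>2 *
      (\<Sum>\<^sub>\<infinity>k::int. \<bar>l - 2 * pi * real_of_int k\<bar> powr (-(2 * H + 1)))"

text \<open>Normalizing constant: fractional Gaussian noise (increments of standard fBm)
  has unit variance, i.e. the zeroth Fourier coefficient of f_H equals 1.\<close>
definition C_fgn :: "real \<Rightarrow> real" where
  "C_fgn H = 1 / ((1 / (2 * pi)) * (LINT t:{-pi..pi}|lborel. fgn_shape H t))"

definition f_fgn :: "real \<Rightarrow> real \<Rightarrow> real" where
  "f_fgn H l = C_fgn H * fgn_shape H l"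

definition fourier_coeff :: "(real \<Rightarrow> real) \<Rightarrow> int \<Rightarrow> complex" where
  "fourier_coeff g m = complex_of_real (1 / (2 * pi)) *
      (LINT t:{-pi..pi}|lborel. exp (- \<i> * of_int m * complex_of_real t) * complex_of_real (g t))"

definition toeplitz :: "nat \<Rightarrow> (real \<Rightarrow> real) \<Rightarrow> complex mat" where
  "toeplitz n g = mat n n (\<lambda>(j, k). fourier_coeff g (int j - int k))"

definition gaussian_vector ::
  "'a measure \<Rightarrow> nat \<Rightarrow> ('a \<Rightarrow> nat \<Rightarrow> real) \<Rightarrow> (nat \<Rightarrow> nat \<Rightarrow> real) \<Rightarrow> bool" where
  "gaussian_vector M n X S \<longleftrightarrow>
     (\<forall>i<n. (\<lambda>\<omega>. X \<omega> i) \<in> borel_measurable M) \<and>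
     (\<forall>a :: nat \<Rightarrow> real.
        let v = (\<Sum>i<n. \<Sum>j<n. a i * S i j * a j) in
        if v = 0 then (AE \<omega> in M. (\<Sum>i<n. a i * X \<omega> i) = 0)
        else distributed M lborel (\<lambda>\<omega>. \<Sum>i<n. a i * X \<omega> i) (normal_density 0 (sqrt v)))"

text \<open>rho_n(u) = n^{-1} <x, T_n(f_u)^{-1} x>. T_n(f_u) is Hermitian (f_u real) and
  invertible, so the quadratic form is real; we take its real part.\<close>
definition rho_n :: "nat \<Rightarrow> (nat \<Rightarrow> real) \<Rightarrow> real \<Rightarrow> real" where
  "rho_n n x u = (1 / real n) * Re (\<Sum>j<n. \<Sum>k<n.
      complex_of_real (x j) * (the (mat_inverse (toeplitz n (f_fgn u)))) $$ (j, k) *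
      complex_of_real (x k))"

definition rho_inf :: "real \<Rightarrow> real \<Rightarrow> real" where
  "rho_inf Hh u = (1 / (2 * pi)) * (LINT t:{-pi..pi}|lborel. f_fgn Hh t / f_fgn u t)"

end

theory Submission
  imports Defs "Jordan_Normal_Form.Determinant" "HOL-Real_Asymp.Real_Asymp"
begin

text \<open>Write \<open>f\<close> for the true density, \<open>g = f\<^sub>u\<close>, \<open>F\<^sub>n\<close> for the Fejer kernel and
  \<open>e\<^sub>\<lambda> = (exp (i j \<lambda>))\<^sub>j\<close>. The mean of \<open>\<rho>\<^sub>n(u)\<close> is
  \<open>n\<inverse> tr (T\<^sub>n(g)\<inverse> T\<^sub>n(f)) = (1/2\<pi>) \<integral> f(\<lambda>) n\<inverse> \<langle>e\<^sub>\<lambda>, T\<^sub>n(g)\<inverse> e\<^sub>\<lambda>\<rangle> d\<lambda>\<close>, and the variational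
  characterization of the inverse together with \<open>T\<^sub>n(g)\<inverse> \<le> T\<^sub>n(1/g)\<close> gives
  \<open>1 / (F\<^sub>n * g)(\<lambda>) \<le> n\<inverse> \<langle>e\<^sub>\<lambda>, T\<^sub>n(g)\<inverse> e\<^sub>\<lambda>\<rangle> \<le> (F\<^sub>n * (1/g))(\<lambda>)\<close>.
  Both bounds tend to \<open>1/g\<close> away from 0, and the upper one is dominated by a power of \<open>\<lambda>\<close> that is
  integrable against \<open>f\<close> when \<open>u \<in> I\<close>; hence the means converge to \<open>\<rho>\<^sub>\<infinity>(u)\<close>.

  The joint law of the \<open>\<xi>\<^sub>n\<close> is arbitrary, so almost sure convergence needs summable tails. For a
  quadratic form with matrix \<open>B\<close> in a Gaussian vector with covariance \<open>S\<close> the Laplace transform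
  is bounded through \<open>tr (B S)\<close> and the operator norms of \<open>B\<close> and \<open>S\<close>; here the product of the
  norms is \<open>O(n\<^sup>\<gamma>)\<close> with \<open>\<gamma> < 1\<close>, which makes the tails \<open>exp (- c n\<^sup>1\<^sup>-\<^sup>\<gamma>)\<close>.

  Uniformity is a Polya type argument: \<open>f\<^sub>u \<le> K f\<^sub>v\<close> for \<open>u \<le> v\<close>, with \<open>K\<close> close to 1 up to normalization,
  so that a rescaling of \<open>\<rho>\<^sub>n\<close> is monotone in \<open>u\<close>. Off \<open>I\<close>, all \<open>f\<^sub>u\<close> are bounded by a
  multiple of the critical density with \<open>v = H - 1/2\<close>, and the general theorem is applied to
  \<open>f\<^sub>v + 1/k\<close>, for which the limit tends to infinity with \<open>k\<close>.\<close>

section \<open>Gaussian integrals of quadratic forms\<close>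

text \<open>The threshold H - 1/2 enters only through exponents at the origin. There f_u behaves
  like |t|^(1 - 2u), so the norm of T_n(f) is about n^b with b = max(0, 2H - 1), that of
  T_n(f_u)^{-1} about n^a with a = max(0, 1 - 2u), up to a small power. For H and u in (0,1), a + b
  < 1 says exactly u > H - 1/2. It is used twice: it makes f/f_u integrable, and it keeps the
  product of the two norms below n. At u = H - 1/2 > 0 the sum is 1 and the ratio behaves like
  1/|t|; adding 1/k to the critical density lowers a to 0, and the logarithmic divergence returns as
  k grows.

  A Gaussian vector is given by the laws of its linear functionals, possibly with singular
  covariance, so there is no joint density to integrate against. The exponent is therefore
  linearized, and the remaining integral is taken coordinate by coordinate; traces appear through
  diagonal entries of inverses, not through eigenvalues.

  Almost sure statements are collected only at countably many points (rational u, integer k); the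
  passage to all u is deterministic.\<close>

definition bil :: "nat \<Rightarrow> (nat \<Rightarrow> nat \<Rightarrow> real) \<Rightarrow> (nat \<Rightarrow> real) \<Rightarrow> (nat \<Rightarrow> real) \<Rightarrow> real" where
  "bil n A x y = (\<Sum>i<n. \<Sum>j<n. x i * A i j * y j)"

definition sqn :: "nat \<Rightarrow> (nat \<Rightarrow> real) \<Rightarrow> real" where
  "sqn n x = (\<Sum>i<n. (x i)\<^sup>2)"

definition sym_mat :: "nat \<Rightarrow> (nat \<Rightarrow> nat \<Rightarrow> real) \<Rightarrow> bool" where
  "sym_mat n A \<longleftrightarrow> (\<forall>i<n. \<forall>j<n. A i j = A j i)"

lemma sqn_nonneg: "0 \<le> sqn n x"
  by (simp add: sqn_def sum_nonneg)

lemma bil_sym: "sym_mat n A \<Longrightarrow> bil n A x y = bil n A y x"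
  unfolding bil_def
  by (subst sum.swap) (auto simp: sym_mat_def mult_ac intro!: sum.cong)

lemma bil_add_left: "bil n A (\<lambda>i. x i + x' i) y = bil n A x y + bil n A x' y"
  and bil_add_right: "bil n A x (\<lambda>i. y i + y' i) = bil n A x y + bil n A x y'"
  and bil_scale_left: "bil n A (\<lambda>i. c * x i) y = c * bil n A x y"
  and bil_scale_right: "bil n A x (\<lambda>i. c * y i) = c * bil n A x y"
  by (simp_all add: bil_def algebra_simps sum.distrib sum_distrib_left)

lemma bil_cong: "(\<And>i. i < n \<Longrightarrow> x i = x' i) \<Longrightarrow> (\<And>i. i < n \<Longrightarrow> y i = y' i) \<Longrightarrow> bil n A x y = bil n A x' y'"
  unfolding bil_def by (intro sum.cong) auto

lemma bil_quad_add:
  assumes "sym_mat n A"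
  shows "bil n A (\<lambda>i. x i + c * y i) (\<lambda>i. x i + c * y i)
    = bil n A x x + 2 * c * bil n A x y + c\<^sup>2 * bil n A y y"
  by (simp add: bil_add_left bil_add_right bil_scale_left bil_scale_right
      bil_sym[OF assms, of y x] power2_eq_square algebra_simps)

lemma bil_unit_left:
  assumes "k < n"
  shows "bil n A (\<lambda>i. if i = k then 1 else 0) y = (\<Sum>j<n. A k j * y j)"
proof -
  have "bil n A (\<lambda>i. if i = k then 1 else 0) y = (\<Sum>i<n. if i = k then \<Sum>j<n. A k j * y j else 0)"
    unfolding bil_def by (intro sum.cong) auto
  then show ?thesis using assms by simp
qed

lemma bil_unit: "k < n \<Longrightarrow> bil n A (\<lambda>i. if i = k then 1 else 0) (\<lambda>i. if i = k then 1 else 0) = A k k"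
  by (subst bil_unit_left) (auto simp: if_distrib cong: if_cong)

lemma bil_Suc:
  assumes "sym_mat (Suc n) A"
  shows "bil (Suc n) A y y = bil n A y y + 2 * y n * (\<Sum>j<n. A n j * y j) + A n n * (y n)\<^sup>2"
proof -
  have "(\<Sum>i<n. y i * A i n * y n) = y n * (\<Sum>j<n. A n j * y j)"
    unfolding sum_distrib_left using assms by (auto simp: sym_mat_def intro!: sum.cong)
  moreover have "(\<Sum>j<n. y n * A n j * y j) = y n * (\<Sum>j<n. A n j * y j)"
    by (simp add: sum_distrib_left mult_ac)
  ultimately show ?thesis
    by (simp add: bil_def sum.distrib power2_eq_square algebra_simps)
qed

lemma bil_rank_one:
  "bil n (\<lambda>i j. A i j + c * b i * b j) y y = bil n A y y + c * (\<Sum>j<n. b j * y j)\<^sup>2"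
proof -
  have "c * (\<Sum>j<n. b j * y j)\<^sup>2 = (\<Sum>i<n. \<Sum>j<n. c * ((b i * y i) * (b j * y j)))"
    by (simp only: power2_eq_square sum_product) (simp only: sum_distrib_left)
  then show ?thesis
    by (simp add: bil_def sum.distrib[symmetric] algebra_simps)
qed

text \<open>Positivity at x - c y and at x + c y. The free weight \<open>c\<close> replaces the
  square roots of the usual Cauchy-Schwarz inequality and is tuned at each use.\<close>

lemma bil_nonneg_CS:
  assumes "sym_mat n A" "\<And>y. 0 \<le> bil n A y y"
  shows "2 * c * bil n A x y \<le> bil n A x x + c\<^sup>2 * bil n A y y"
    and "- (2 * c * bil n A x y) \<le> bil n A x x + c\<^sup>2 * bil n A y y"
  using assms(2)[of "\<lambda>i. x i + (-c) * y i"] assms(2)[of "\<lambda>i. x i + c * y i"]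
  unfolding bil_quad_add[OF assms(1)] by simp_all

section \<open>Standard Gaussian product measure and exponentials of quadratic forms\<close>

abbreviation stdG :: "real measure" where
  "stdG \<equiv> density lborel (\<lambda>t. ennreal (std_normal_density t))"

abbreviation stdGn :: "nat \<Rightarrow> (nat \<Rightarrow> real) measure" where
  "stdGn n \<equiv> PiM {..<n} (\<lambda>_. stdG)"

lemma prob_space_stdG: "prob_space stdG"
  by (rule prob_space_normal_density) simp

lemma prob_space_stdGn: "prob_space (stdGn n)"
  by (intro prob_space_PiM prob_space_stdG)

interpretation stdG: product_sigma_finite "\<lambda>_::nat. stdG"
  by (intro product_sigma_finite.intro prob_space_imp_sigma_finite prob_space_stdG)

lemma complete_square_min: "(d::real) \<noteq> 0 \<Longrightarrow> 2 * (- b / d) * b + d * (- b / d)\<^sup>2 = - b\<^sup>2 / d"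
  by (simp add: power2_eq_square field_simps)

text \<open>Completing the square turns the integrand into a constant times the normal density with
  mean -b/(1+a) and variance 1/(1+a).\<close>

lemma nn_integral_stdG_quadratic:
  assumes "0 < 1 + a"
  shows "(\<integral>\<^sup>+t. ennreal (exp (- (a * t\<^sup>2) / 2 - b * t)) \<partial>stdG)
    = ennreal (exp (b\<^sup>2 / (2 * (1 + a))) / sqrt (1 + a))"
proof -
  define s where "s = 1 / sqrt (1 + a)"
  have s: "0 < s" "s\<^sup>2 = 1 / (1 + a)" using assms by (auto simp: s_def power_divide)
  define K where "K = exp (b\<^sup>2 / (2 * (1 + a))) / sqrt (1 + a)"
  have K: "0 \<le> K" using assms by (simp add: K_def)
  have *: "std_normal_density t * exp (- (a * t\<^sup>2) / 2 - b * t)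
      = K * normal_density (- b / (1 + a)) s t" for t
  proof -
    obtain d where d: "a = d - 1" "0 < d" using assms that[of "1 + a"] by simp
    have "- t\<^sup>2 / 2 + (- (a * t\<^sup>2) / 2 - b * t) = - (d * t\<^sup>2 / 2) - b * t"
      unfolding d(1) by (simp add: algebra_simps) (simp add: field_simps)
    also have "\<dots> = b\<^sup>2 / (2 * d) - d * (t + b / d)\<^sup>2 / 2"
      using d(2) by (simp add: power2_eq_square field_simps)
    also have "\<dots> = b\<^sup>2 / (2 * (1 + a)) + - (t - (- b / (1 + a)))\<^sup>2 / (2 * s\<^sup>2)"
      unfolding s(2) d(1) by simp
    finally have e: "exp (- t\<^sup>2 / 2) * exp (- (a * t\<^sup>2) / 2 - b * t)
       = exp (b\<^sup>2 / (2 * (1 + a))) * exp (- (t - (- b / (1 + a)))\<^sup>2 / (2 * s\<^sup>2))"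
      unfolding exp_add[symmetric] by simp
    have q: "sqrt (2 * pi * s\<^sup>2) = sqrt (2 * pi) / sqrt (1 + a)"
      unfolding s(2) by (simp add: real_sqrt_mult real_sqrt_divide)
    have "std_normal_density t * exp (- (a * t\<^sup>2) / 2 - b * t)
      = (exp (- t\<^sup>2 / 2) * exp (- (a * t\<^sup>2) / 2 - b * t)) / sqrt (2 * pi)"
      by (simp add: normal_density_def)
    also have "\<dots> = K * normal_density (- b / (1 + a)) s t"
      unfolding e normal_density_def q K_def using assms by simp
    finally show ?thesis .
  qed
  have "(\<integral>\<^sup>+t. ennreal (exp (- (a * t\<^sup>2) / 2 - b * t)) \<partial>stdG)
     = (\<integral>\<^sup>+t. ennreal (std_normal_density t) * ennreal (exp (- (a * t\<^sup>2) / 2 - b * t)) \<partial>lborel)"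
    by (rule nn_integral_density) auto
  also have "\<dots> = (\<integral>\<^sup>+t. ennreal K * ennreal (normal_density (- b / (1 + a)) s t) \<partial>lborel)"
    unfolding ennreal_mult'[OF normal_density_nonneg, symmetric] ennreal_mult'[OF K, symmetric] * ..
  also have "\<dots> = ennreal K"
    using s(1) by (subst nn_integral_cmult) (auto simp: nn_integral_eq_integral)
  finally show ?thesis by (simp add: K_def)
qed

lemma bil_measurable [measurable]:
  "(\<lambda>x. bil n A x x) \<in> borel_measurable (stdGn n)"
  unfolding bil_def by measurable

text \<open>The numbers \<open>G i\<close> bound the diagonal of \<open>(1 + A)\<inverse>\<close>; in variational form this bound
  survives the passage to Schur complements, which is what integrating out the last coordinate does.\<close>

lemma gaussian_integral_le:
  assumes "sym_mat n A"
    and "\<And>i y. i < n \<Longrightarrow> 2 * y i - sqn n y - bil n A y y \<le> G i"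
  shows "(\<integral>\<^sup>+x. ennreal (exp (- bil n A x x / 2)) \<partial>stdGn n) \<le> ennreal (\<Prod>i<n. sqrt (G i))"
  using assms
proof (induction n arbitrary: A)
  case 0
  then show ?case
    using prob_space.emeasure_space_1[OF prob_space_stdGn[of 0]]
    by (simp add: bil_def)
next
  case (Suc n)
  define a where "a = A n n"
  define b where "b y = (\<Sum>j<n. A n j * y j)" for y
  have exp2: "sqn (Suc n) y + bil (Suc n) A y y
     = sqn n y + bil n A y y + 2 * y n * b y + (1 + a) * (y n)\<^sup>2" for y
    unfolding bil_Suc[OF Suc.prems(1)] by (simp add: a_def b_def sqn_def algebra_simps)
  \<comment> \<open>Test vectors supported on the last coordinate.\<close>
  have one: "2 * t - (1 + a) * t\<^sup>2 \<le> G n" for t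
  proof -
    have "sqn n (\<lambda>i. if i = n then t else 0) = 0" "bil n A (\<lambda>i. if i = n then t else 0) (\<lambda>i. if i = n then t else 0) = 0"
      "b (\<lambda>i. if i = n then t else 0) = 0"
      by (auto simp: sqn_def bil_def b_def intro!: sum.neutral)
    with Suc.prems(2)[of n "\<lambda>i. if i = n then t else 0"] exp2[of "\<lambda>i. if i = n then t else 0"]
    show ?thesis by simp
  qed
  \<comment> \<open>Otherwise \<open>one\<close> fails at t = G n / 2 + 1, where its left side is at
    least G n + 2.\<close>
  have a_pos: "0 < 1 + a"
  proof (rule ccontr)
    assume "\<not> 0 < 1 + a"
    then have "(1 + a) * (G n / 2 + 1)\<^sup>2 \<le> 0" by (intro mult_nonpos_nonneg) auto
    with one[of "G n / 2 + 1"] show False by simp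
  qed
  have Gn: "1 / (1 + a) \<le> G n"
  proof -
    have "2 * (1 / (1 + a)) - (1 + a) * (1 / (1 + a))\<^sup>2 = 1 / (1 + a)"
      using a_pos by (simp add: power2_eq_square)
    then show ?thesis using one[of "1 / (1 + a)"] by simp
  qed
  \<comment> \<open>1 + \<open>A'\<close> is the Schur complement of the corner entry 1 + a in 1 +
    A.\<close>
  define A' where "A' = (\<lambda>i j. A i j + (- 1 / (1 + a)) * A n i * A n j)"
  have A': "bil n A' y y = bil n A y y - (b y)\<^sup>2 / (1 + a)" for y
    unfolding A'_def bil_rank_one b_def by simp
  have sym': "sym_mat n A'" "sym_mat n A"
    using Suc.prems(1) by (auto simp: sym_mat_def A'_def)
  have "2 * y i - sqn n y - bil n A' y y \<le> G i" if "i < n" for i y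
  proof -
    \<comment> \<open>The last coordinate minimizes the quadratic form for given y. The minimum is
      the form of the Schur complement, so the hypothesis in dimension n + 1 becomes the one in
      dimension n with the same \<open>G\<close>.\<close>
    define z where "z = y(n := - b y / (1 + a))"
    have z: "sqn n z = sqn n y" "bil n A z z = bil n A y y" "b z = b y" "z n = - b y / (1 + a)" "z i = y i"
      using that unfolding z_def sqn_def b_def by (auto intro!: sum.cong bil_cong)
    have "2 * z n * b z + (1 + a) * (z n)\<^sup>2 = - (b y)\<^sup>2 / (1 + a)"
      unfolding z using a_pos by (intro complete_square_min) simp
    then show ?thesis
      using Suc.prems(2)[of i z] exp2[of z] that by (simp add: z A')
  qed
  note IH = Suc.IH[OF sym'(1) this]
  have inner: "(\<integral>\<^sup>+t. ennreal (exp (- bil (Suc n) A (x(n := t)) (x(n := t)) / 2)) \<partial>stdG)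
      = ennreal (1 / sqrt (1 + a)) * ennreal (exp (- bil n A' x x / 2))" for x
  proof -
    have e: "bil (Suc n) A (x(n := t)) (x(n := t)) = bil n A x x + 2 * t * b x + a * t\<^sup>2" for t
    proof -
      have "bil n A (x(n := t)) (x(n := t)) = bil n A x x" by (rule bil_cong) auto
      moreover have "(\<Sum>j<n. A n j * (x(n := t)) j) = b x" unfolding b_def by (intro sum.cong) auto
      ultimately show ?thesis unfolding bil_Suc[OF Suc.prems(1)] by (simp add: a_def)
    qed
    have "(\<integral>\<^sup>+t. ennreal (exp (- bil (Suc n) A (x(n := t)) (x(n := t)) / 2)) \<partial>stdG)
      = (\<integral>\<^sup>+t. ennreal (exp (- bil n A x x / 2)) * ennreal (exp (- (a * t\<^sup>2) / 2 - b x * t)) \<partial>stdG)"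
      by (intro nn_integral_cong) (simp add: e ennreal_mult'[symmetric] exp_add[symmetric] field_simps)
    also have "\<dots> = ennreal (exp (- bil n A x x / 2)) * ennreal (exp ((b x)\<^sup>2 / (2 * (1 + a))) / sqrt (1 + a))"
      unfolding nn_integral_stdG_quadratic[OF a_pos, symmetric] by (rule nn_integral_cmult) measurable
    also have "\<dots> = ennreal (1 / sqrt (1 + a)) * ennreal (exp (- bil n A' x x / 2))"
    proof -
      have "exp (- bil n A' x x / 2) = exp (- bil n A x x / 2) * exp ((b x)\<^sup>2 / (2 * (1 + a)))"
        unfolding exp_add[symmetric] A' by (simp add: field_simps)
      then show ?thesis using a_pos by (simp add: ennreal_mult'[symmetric])
    qed
    finally show ?thesis .
  qed
  have "(\<integral>\<^sup>+x. ennreal (exp (- bil (Suc n) A x x / 2)) \<partial>stdGn (Suc n))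
     = (\<integral>\<^sup>+x. (\<integral>\<^sup>+t. ennreal (exp (- bil (Suc n) A (x(n := t)) (x(n := t)) / 2)) \<partial>stdG) \<partial>stdGn n)"
  proof -
    have "(\<lambda>x. ennreal (exp (- bil (Suc n) A x x / 2))) \<in> borel_measurable (PiM (insert n {..<n}) (\<lambda>_. stdG))"
      unfolding lessThan_Suc[symmetric] by measurable
    then show ?thesis unfolding lessThan_Suc
      by (subst stdG.product_nn_integral_insert) auto
  qed
  also have "\<dots> = ennreal (1 / sqrt (1 + a)) * (\<integral>\<^sup>+x. ennreal (exp (- bil n A' x x / 2)) \<partial>stdGn n)"
    unfolding inner by (subst nn_integral_cmult) auto
  also have "\<dots> \<le> ennreal (sqrt (G n)) * ennreal (\<Prod>i<n. sqrt (G i))"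
    using real_sqrt_le_mono[OF Gn] by (intro mult_mono IH ennreal_leI) (simp_all add: real_sqrt_divide)
  also have "\<dots> = ennreal (\<Prod>i<Suc n. sqrt (G i))"
  proof -
    have "0 \<le> sqrt (G n)" using order_trans[OF _ Gn, of 0] a_pos by simp
    then show ?thesis by (simp add: ennreal_mult'[symmetric] mult.commute)
  qed
  finally show ?case .
qed

text \<open>A Cholesky factorization: the last coordinate is split off by completing the square, and
  the remainder is again positive semidefinite.\<close>

lemma psd_factor:
  assumes "sym_mat n B" "\<And>y. 0 \<le> bil n B y y"
  shows "\<exists>l::nat \<Rightarrow> nat \<Rightarrow> real. \<forall>x. bil n B x x = (\<Sum>j<n. (\<Sum>i<n. l j i * x i)\<^sup>2)"
  using assms
proof (induction n arbitrary: B)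
  case 0
  then show ?case by (simp add: bil_def)
next
  case (Suc n)
  define b where "b y = (\<Sum>j<n. B n j * y j)" for y
  note E = bil_Suc[OF Suc.prems(1), folded b_def]
  have sym: "sym_mat n B" using Suc.prems(1) by (auto simp: sym_mat_def)
  have upd: "bil n B (y(n := t)) (y(n := t)) = bil n B y y" "b (y(n := t)) = b y" for y t
    unfolding b_def by (auto intro!: bil_cong sum.cong)
  have pos: "0 \<le> bil n B y y + 2 * t * b y + B n n * t\<^sup>2" for y t
    using Suc.prems(2)[of "y(n := t)"] unfolding E upd by simp
  have nn: "0 \<le> B n n" using bil_unit[of n "Suc n" B] Suc.prems(2) by (metis lessI)
  \<comment> \<open>Since \<open>inverse 0 = 0\<close>, one formula also covers a vanishing pivot;
    there positivity forces the linear form \<open>b\<close> to vanish, as it could otherwise be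
    used to make the quadratic form negative.\<close>
  define c where "c = inverse (B n n)"
  define B' where "B' = (\<lambda>i j. B i j + (- c) * B n i * B n j)"
  have B': "bil n B' y y = bil n B y y - c * (b y)\<^sup>2" for y
    unfolding B'_def bil_rank_one b_def by simp
  have "sym_mat n B'" using sym by (auto simp: sym_mat_def B'_def)
  moreover have "0 \<le> bil n B' y y" for y
  proof (cases "B n n = 0")
    case True
    then show ?thesis using pos[of y 0] by (simp add: B' c_def)
  next
    case False
    then have "bil n B y y + 2 * (- c * b y) * b y + B n n * (- c * b y)\<^sup>2 = bil n B' y y"
      by (simp add: B' c_def field_simps power2_eq_square)
    then show ?thesis using pos[of y "- c * b y"] by simp
  qed
  ultimately obtain l where l: "\<And>x. bil n B' x x = (\<Sum>j<n. (\<Sum>i<n. l j i * x i)\<^sup>2)"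
    using Suc.IH[of B'] by blast
  define l' where "l' j i = (if j < n then (if i < n then l j i else 0) else sqrt c * B n i)" for j i
  have "bil (Suc n) B x x = (\<Sum>j<Suc n. (\<Sum>i<Suc n. l' j i * x i)\<^sup>2)" for x
  proof -
    have 1: "(\<Sum>j<n. (\<Sum>i<Suc n. l' j i * x i)\<^sup>2) = bil n B' x x"
      unfolding l by (intro sum.cong) (auto simp: l'_def)
    have 2: "(\<Sum>i<Suc n. l' n i * x i) = sqrt c * (b x + B n n * x n)"
      by (simp add: l'_def b_def sum_distrib_left algebra_simps)
    have "bil (Suc n) B x x = bil n B' x x + c * (b x + B n n * x n)\<^sup>2"
    proof (cases "B n n = 0")
      case False
      then show ?thesis unfolding E B' c_def by (simp add: field_simps power2_eq_square)
    next
      case True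
      have "b x = 0"
      proof (rule ccontr)
        assume "b x \<noteq> 0"
        then show False using pos[of x "- (bil n B x x + 1) / (2 * b x)"] True by (simp add: field_simps)
      qed
      then show ?thesis unfolding E B' using True by simp
    qed
    moreover have "0 \<le> c" using nn by (simp add: c_def)
    ultimately show ?thesis using 1 2 by (simp add: power_mult_distrib)
  qed
  then show ?case by blast
qed

section \<open>Laplace transforms of Gaussian quadratic forms\<close>

lemma Re_iexp: "Re (iexp x) = cos x"
  by (simp add: cis_conv_exp[symmetric])

lemma integral_stdG_iexp: "(CLINT t|stdG. iexp (c * t)) = complex_of_real (exp (- c\<^sup>2 / 2))"
  using char_std_normal_distribution by (simp add: char_def fun_eq_iff)

lemma integral_stdGn_cos: "(\<integral>h. cos (\<Sum>j<n. h j * v j) \<partial>stdGn n) = exp (- (\<Sum>j<n. (v j)\<^sup>2) / 2)"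
proof -
  interpret P: prob_space "stdGn n" by (rule prob_space_stdGn)
  have int: "integrable stdG (\<lambda>t. iexp (c * t))" for c
    by (intro finite_measure.integrable_const_bound[OF prob_space.finite_measure[OF prob_space_stdG], of _ 1]) auto
  have "(CLINT h|stdGn n. (\<Prod>j<n. iexp (v j * h j))) = (\<Prod>j<n. CLINT t|stdG. iexp (v j * t))"
    using int by (intro stdG.product_integral_prod) auto
  also have "\<dots> = complex_of_real (exp (- (\<Sum>j<n. (v j)\<^sup>2) / 2))"
    unfolding integral_stdG_iexp by (simp add: exp_sum[symmetric] sum_negf[symmetric] sum_divide_distrib of_real_prod[symmetric] del: of_real_prod)
  also have "(\<lambda>h. \<Prod>j<n. iexp (v j * h j)) = (\<lambda>h. iexp (\<Sum>j<n. h j * v j))"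
    by (simp add: exp_sum[symmetric] sum_distrib_left mult_ac)
  finally have *: "(CLINT h|stdGn n. iexp (\<Sum>j<n. h j * v j)) = complex_of_real (exp (- (\<Sum>j<n. (v j)\<^sup>2) / 2))" .
  have "integrable (stdGn n) (\<lambda>h. iexp (\<Sum>j<n. h j * v j))"
    by (intro P.integrable_const_bound[of _ 1]) auto
  from integral_Re[OF this] show ?thesis
    unfolding * Re_iexp Re_complex_of_real by simp
qed

lemma nn_integral_stdGn_exp:
  "(\<integral>\<^sup>+h. ennreal (exp (\<Sum>j<n. h j * v j)) \<partial>stdGn n) = ennreal (exp ((\<Sum>j<n. (v j)\<^sup>2) / 2))"
proof -
  have "(\<integral>\<^sup>+h. ennreal (exp (\<Sum>j<n. h j * v j)) \<partial>stdGn n) = (\<integral>\<^sup>+h. (\<Prod>j<n. ennreal (exp (h j * v j))) \<partial>stdGn n)"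
    by (simp add: exp_sum prod_ennreal)
  also have "\<dots> = (\<Prod>j<n. \<integral>\<^sup>+t. ennreal (exp (t * v j)) \<partial>stdG)"
    by (rule stdG.product_nn_integral_prod) auto
  also have "\<dots> = (\<Prod>j<n. ennreal (exp ((v j)\<^sup>2 / 2)))"
    using nn_integral_stdG_quadratic[of 0 "- v _"] by (simp add: mult_ac)
  also have "\<dots> = ennreal (exp ((\<Sum>j<n. (v j)\<^sup>2) / 2))"
    by (simp add: prod_ennreal exp_sum[symmetric] sum_divide_distrib)
  finally show ?thesis .
qed

section \<open>Gaussian vectors through their linear functionals\<close>

lemma gaussian_vector_measurable:
  "gaussian_vector M n X S \<Longrightarrow> i < n \<Longrightarrow> (\<lambda>\<omega>. X \<omega> i) \<in> borel_measurable M"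
  by (simp add: gaussian_vector_def)

lemma gaussian_vector_linear:
  assumes "gaussian_vector M n X S"
  shows "bil n S a a = 0 \<Longrightarrow> AE \<omega> in M. (\<Sum>i<n. a i * X \<omega> i) = 0"
    and "bil n S a a \<noteq> 0 \<Longrightarrow>
      distributed M lborel (\<lambda>\<omega>. \<Sum>i<n. a i * X \<omega> i) (normal_density 0 (sqrt (bil n S a a)))"
  using assms unfolding gaussian_vector_def bil_def Let_def by (metis (no_types, lifting))+

lemma gaussian_vector_exp:
  assumes "prob_space M" "gaussian_vector M n X S" "0 \<le> bil n S a a"
  shows "(\<integral>\<^sup>+\<omega>. ennreal (exp (\<Sum>i<n. a i * X \<omega> i)) \<partial>M) = ennreal (exp (bil n S a a / 2))"
proof (cases "bil n S a a = 0")
  case True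
  then have "(\<integral>\<^sup>+\<omega>. ennreal (exp (\<Sum>i<n. a i * X \<omega> i)) \<partial>M) = (\<integral>\<^sup>+\<omega>. 1 \<partial>M)"
    using gaussian_vector_linear(1)[OF assms(2) True] by (intro nn_integral_cong_AE) auto
  then show ?thesis using True prob_space.emeasure_space_1[OF assms(1)] by simp
next
  case False
  define v where "v = bil n S a a"
  have v: "0 < v" using False assms(3) by (simp add: v_def)
  have *: "normal_density 0 (sqrt v) t * exp t = exp (v / 2) * normal_density v (sqrt v) t" for t
  proof -
    have "- t\<^sup>2 / (2 * v) + t = v / 2 + - (t - v)\<^sup>2 / (2 * v)"
      using v by (simp add: field_simps power2_eq_square)
    then show ?thesis using v by (simp add: normal_density_def exp_add[symmetric])
  qed
  have "(\<integral>\<^sup>+\<omega>. ennreal (exp (\<Sum>i<n. a i * X \<omega> i)) \<partial>M)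
     = (\<integral>\<^sup>+t. ennreal (normal_density 0 (sqrt v) t) * ennreal (exp t) \<partial>lborel)"
    by (subst distributed_nn_integral[OF gaussian_vector_linear(2)[OF assms(2) False], folded v_def]) auto
  also have "\<dots> = (\<integral>\<^sup>+t. ennreal (exp (v / 2)) * ennreal (normal_density v (sqrt v) t) \<partial>lborel)"
    unfolding ennreal_mult'[OF normal_density_nonneg, symmetric] ennreal_mult'[OF exp_ge_zero, symmetric] * ..
  also have "\<dots> = ennreal (exp (v / 2))"
    using v by (subst nn_integral_cmult) (auto simp: nn_integral_eq_integral)
  finally show ?thesis by (simp add: v_def)
qed

lemma gaussian_vector_cos:
  assumes "prob_space M" "gaussian_vector M n X S" "0 \<le> bil n S a a"
  shows "(\<integral>\<omega>. cos (\<Sum>i<n. a i * X \<omega> i) \<partial>M) = exp (- bil n S a a / 2)"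
proof (cases "bil n S a a = 0")
  case True
  have [measurable]: "i < n \<Longrightarrow> (\<lambda>\<omega>. X \<omega> i) \<in> borel_measurable M" for i
    by (rule gaussian_vector_measurable[OF assms(2)])
  have "(\<integral>\<omega>. cos (\<Sum>i<n. a i * X \<omega> i) \<partial>M) = (\<integral>\<omega>. 1 \<partial>M)"
    using gaussian_vector_linear(1)[OF assms(2) True] by (intro integral_cong_AE) auto
  then show ?thesis using True prob_space.prob_space[OF assms(1)] by simp
next
  case False
  define s where "s = sqrt (bil n S a a)"
  have s: "0 < s" "s\<^sup>2 = bil n S a a" using False assms(3) by (auto simp: s_def)
  have "distributed M lborel (\<lambda>\<omega>. ((\<Sum>i<n. a i * X \<omega> i) - 0) / s) std_normal_density"
    using gaussian_vector_linear(2)[OF assms(2) False] s(1)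
    by (subst prob_space.normal_standard_normal_convert[OF assms(1) s(1), symmetric]) (simp add: s_def)
  then have "(\<integral>\<omega>. cos (s * (((\<Sum>i<n. a i * X \<omega> i) - 0) / s)) \<partial>M) = (\<integral>t. std_normal_density t * cos (s * t) \<partial>lborel)"
    by (subst distributed_integral[symmetric, where f = std_normal_density and N = lborel]) auto
  also have "\<dots> = (\<integral>t. cos (s * t) \<partial>stdG)"
    by (subst integral_density) auto
  also have "\<dots> = exp (- s\<^sup>2 / 2)"
  proof -
    have "integrable stdG (\<lambda>t. iexp (s * t))"
      by (intro finite_measure.integrable_const_bound[OF prob_space.finite_measure[OF prob_space_stdG], of _ 1]) auto
    from integral_Re[OF this] show ?thesis
      unfolding integral_stdG_iexp by (simp add: Re_exp)
  qed
  finally show ?thesis using s by simp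
qed

lemma sum_exchange:
  fixes h x :: "nat \<Rightarrow> real" and m :: nat
  shows "(\<Sum>j<m. h j * (\<Sum>i<n. l j i * x i)) = (\<Sum>i<n. (\<Sum>j<m. h j * l j i) * x i)"
  by (induction m) (simp_all add: distrib_right sum.distrib sum_distrib_left mult.assoc)

lemma bil_gram:
  fixes m :: nat
  shows "bil n (\<lambda>i k. \<Sum>j<m. l j i * l j k) x x = (\<Sum>j<m. (\<Sum>i<n. l j i * x i)\<^sup>2)"
proof (induction m)
  case (Suc m)
  then show ?case
    using bil_rank_one[of n "\<lambda>i k. \<Sum>j<m. l j i * l j k" 1 "l m" x] by simp
qed (simp add: bil_def)

lemma trace_gram:
  fixes m :: nat
  shows
  "(\<Sum>i<n. \<Sum>k<n. (\<Sum>j<m. l j i * l j k) * S i k) = (\<Sum>j<m. bil n S (l j) (l j))"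
  by (induction m) (simp_all add: distrib_left sum.distrib bil_def mult_ac)

lemma bil_sum:
  fixes m :: nat
  shows
  "bil n S (\<lambda>i. \<Sum>j<m. h j * l j i) (\<lambda>i. \<Sum>j<m. h j * l j i) = bil m (\<lambda>j k. bil n S (l j) (l k)) h h"
proof -
  have "bil n S (\<lambda>i. \<Sum>j<m. h j * l j i) y = (\<Sum>j<m. h j * bil n S (l j) y)" for y
    by (induction m) (simp_all add: bil_add_left bil_scale_left, simp add: bil_def)
  moreover have "bil n S x (\<lambda>i. \<Sum>j<m. h j * l j i) = (\<Sum>j<m. h j * bil n S x (l j))" for x
    by (induction m) (simp_all add: bil_add_right bil_scale_right, simp add: bil_def)
  ultimately show ?thesis by (simp add: bil_def[of m] sum_distrib_left mult_ac)
qed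

text \<open>Hubbard-Stratonovich: an auxiliary Gaussian vector \<open>h\<close> linearizes the exponent, so that
  only linear functionals of \<open>X\<close> (whose laws the definition of a Gaussian vector prescribes) appear.\<close>

lemma gaussian_vector_exp_squares:
  assumes "prob_space M" "gaussian_vector M n X S" "\<And>y. 0 \<le> bil n S y y"
  shows "(\<integral>\<^sup>+\<omega>. ennreal (exp ((\<Sum>j<m. (\<Sum>i<n. l j i * X \<omega> i)\<^sup>2) / 2)) \<partial>M)
    = (\<integral>\<^sup>+h. ennreal (exp (bil m (\<lambda>j k. bil n S (l j) (l k)) h h / 2)) \<partial>stdGn m)"
proof -
  interpret M: prob_space M by fact
  interpret P: prob_space "stdGn m" by (rule prob_space_stdGn)
  interpret MP: pair_sigma_finite "stdGn m" M by standard
  have [measurable]: "i < n \<Longrightarrow> (\<lambda>\<omega>. X \<omega> i) \<in> borel_measurable M" for i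
    by (rule gaussian_vector_measurable[OF assms(2)])
  have "(\<integral>\<^sup>+\<omega>. ennreal (exp ((\<Sum>j<m. (\<Sum>i<n. l j i * X \<omega> i)\<^sup>2) / 2)) \<partial>M)
     = (\<integral>\<^sup>+\<omega>. (\<integral>\<^sup>+h. ennreal (exp (\<Sum>j<m. h j * (\<Sum>i<n. l j i * X \<omega> i))) \<partial>stdGn m) \<partial>M)"
    by (simp add: nn_integral_stdGn_exp)
  also have "\<dots> = (\<integral>\<^sup>+h. (\<integral>\<^sup>+\<omega>. ennreal (exp (\<Sum>j<m. h j * (\<Sum>i<n. l j i * X \<omega> i))) \<partial>M) \<partial>stdGn m)"
    by (rule MP.Fubini') measurable
  also have "\<dots> = (\<integral>\<^sup>+h. ennreal (exp (bil m (\<lambda>j k. bil n S (l j) (l k)) h h / 2)) \<partial>stdGn m)"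
    unfolding sum_exchange gaussian_vector_exp[OF assms] bil_sum ..
  finally show ?thesis .
qed

text \<open>The Fourier counterpart of the preceding lemma: the negative exponent is linearized by
  cosines of the auxiliary vector. These are bounded by 1, so Fubini applies on the product of the
  two probability spaces.\<close>

lemma gaussian_vector_exp_neg_squares:
  assumes "prob_space M" "gaussian_vector M n X S" "\<And>y. 0 \<le> bil n S y y"
  shows "(\<integral>\<^sup>+\<omega>. ennreal (exp (- (\<Sum>j<m. (\<Sum>i<n. l j i * X \<omega> i)\<^sup>2) / 2)) \<partial>M)
    = (\<integral>\<^sup>+h. ennreal (exp (- bil m (\<lambda>j k. bil n S (l j) (l k)) h h / 2)) \<partial>stdGn m)"
proof -
  interpret M: prob_space M by fact
  interpret P: prob_space "stdGn m" by (rule prob_space_stdGn)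
  interpret MP: pair_prob_space "stdGn m" M by standard
  have [measurable]: "i < n \<Longrightarrow> (\<lambda>\<omega>. X \<omega> i) \<in> borel_measurable M" for i
    by (rule gaussian_vector_measurable[OF assms(2)])
  have "(\<integral>\<omega>. exp (- (\<Sum>j<m. (\<Sum>i<n. l j i * X \<omega> i)\<^sup>2) / 2) \<partial>M)
     = (\<integral>\<omega>. (\<integral>h. cos (\<Sum>j<m. h j * (\<Sum>i<n. l j i * X \<omega> i)) \<partial>stdGn m) \<partial>M)"
    by (simp add: integral_stdGn_cos)
  also have "\<dots> = (\<integral>h. (\<integral>\<omega>. cos (\<Sum>j<m. h j * (\<Sum>i<n. l j i * X \<omega> i)) \<partial>M) \<partial>stdGn m)"
    by (rule MP.Fubini_integral) (intro MP.integrable_const_bound[of _ 1], auto)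
  also have "\<dots> = (\<integral>h. exp (- bil m (\<lambda>j k. bil n S (l j) (l k)) h h / 2) \<partial>stdGn m)"
    unfolding sum_exchange gaussian_vector_cos[OF assms] bil_sum ..
  finally have *: "(\<integral>\<omega>. exp (- (\<Sum>j<m. (\<Sum>i<n. l j i * X \<omega> i)\<^sup>2) / 2) \<partial>M)
    = (\<integral>h. exp (- bil m (\<lambda>j k. bil n S (l j) (l k)) h h / 2) \<partial>stdGn m)" .
  have i1: "integrable M (\<lambda>\<omega>. exp (- (\<Sum>j<m. (\<Sum>i<n. l j i * X \<omega> i)\<^sup>2) / 2))"
    by (intro M.integrable_const_bound[of _ 1]) (auto intro!: sum_nonneg)
  have i2: "integrable (stdGn m) (\<lambda>h. exp (- bil m (\<lambda>j k. bil n S (l j) (l k)) h h / 2))"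
  proof (intro P.integrable_const_bound[of _ 1])
    have "0 \<le> bil m (\<lambda>j k. bil n S (l j) (l k)) h h" for h
      using assms(3) by (simp add: bil_sum[symmetric])
    then show "AE h in stdGn m. norm (exp (- bil m (\<lambda>j k. bil n S (l j) (l k)) h h / 2)) \<le> 1"
      by simp
  qed measurable
  show ?thesis
    using nn_integral_eq_integral[OF i1] nn_integral_eq_integral[OF i2] * by (simp only: exp_ge_zero AE_I2)
qed

text \<open>Polarization at sums of two unit vectors.\<close>

lemma sym_mat_eqI:
  assumes "sym_mat n A" "sym_mat n B" "\<And>y. bil n A y y = bil n B y y" "i < n" "j < n"
  shows "A i j = B i j"
proof -
  let ?e = "\<lambda>k i. if i = k then 1 else 0 :: real"
  have "bil n A (?e i) (?e j) = bil n B (?e i) (?e j)"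
    using bil_quad_add[OF assms(1), of "?e i" 1 "?e j"] bil_quad_add[OF assms(2), of "?e i" 1 "?e j"] assms(3) by simp
  then show ?thesis using assms(4,5) by (simp add: bil_unit_left if_distrib cong: if_cong)
qed

lemma sqn_minus_unit:
  assumes "i < n"
  shows "sqn n (\<lambda>j. y j + (-1) * (if j = i then 1 else 0)) = sqn n y + (1 - 2 * y i)"
proof -
  have "sqn n (\<lambda>j. y j + (-1) * (if j = i then 1 else 0)) = (\<Sum>j<n. (y j)\<^sup>2 + (if j = i then 1 - 2 * y i else 0))"
    unfolding sqn_def by (intro sum.cong) (auto simp: power2_eq_square algebra_simps)
  then show ?thesis using assms by (simp add: sum.distrib sqn_def)
qed

text \<open>\<open>s\<close> and \<open>b\<close> bound the operator norms of the covariance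
  \<open>S\<close> and of \<open>B\<close>, expressed through quadratic forms.\<close>

locale gaussian_quadratic_form =
  fixes M :: "'a measure" and n :: nat and X :: "'a \<Rightarrow> nat \<Rightarrow> real"
    and S B :: "nat \<Rightarrow> nat \<Rightarrow> real" and b s :: real
  assumes prob: "prob_space M"
    and gauss: "gaussian_vector M n X S"
    and symS: "sym_mat n S" and posS: "\<And>y. 0 \<le> bil n S y y" and leS: "\<And>y. bil n S y y \<le> s * sqn n y"
    and symB: "sym_mat n B" and posB: "\<And>y. 0 \<le> bil n B y y" and leB: "\<And>y. bil n B y y \<le> b * sqn n y"
    and b_pos: "0 < b" and s_pos: "0 < s"
begin

definition tr :: real where "tr = (\<Sum>i<n. \<Sum>j<n. B i j * S i j)"

lemma meas_X: "i < n \<Longrightarrow> (\<lambda>\<omega>. X \<omega> i) \<in> borel_measurable M"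
  by (rule gaussian_vector_measurable[OF gauss])

lemma meas_Q: "(\<lambda>\<omega>. bil n B (X \<omega>) (X \<omega>)) \<in> borel_measurable M"
  unfolding bil_def using meas_X by auto

text \<open>Write 2 th B = L^T L with rows \<open>l j\<close>. Then N = L S L^T has the nonzero
  eigenvalues of 2 th B S, hence the same trace, but is symmetric; it is the covariance of the
  linear functionals that appear after linearizing the exponent.\<close>

lemma factorization:
  assumes th: "0 < th"
  obtains l N where "\<And>x. th * bil n B x x = (\<Sum>j<n. (\<Sum>i<n. l j i * x i)\<^sup>2) / 2"
    and "N = (\<lambda>j k. bil n S (l j) (l k))" "sym_mat n N" "\<And>y. 0 \<le> bil n N y y"
    and "\<And>y. bil n N y y \<le> 2 * th * (b * s) * sqn n y" "(\<Sum>i<n. N i i) = 2 * th * tr"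
proof -
  obtain l0 where l0: "\<And>x. bil n B x x = (\<Sum>j<n. (\<Sum>i<n. l0 j i * x i)\<^sup>2)"
    using psd_factor[OF symB posB] by blast
  define l where "l j i = sqrt (2 * th) * l0 j i" for j i :: nat
  define N where "N = (\<lambda>j k. bil n S (l j) (l k))"
  have sq: "(\<Sum>j<n. (\<Sum>i<n. l j i * x i)\<^sup>2) = 2 * th * bil n B x x" for x
    using th unfolding l0 l_def
    by (simp add: mult.assoc sum_distrib_left[symmetric] power_mult_distrib)
  have N: "bil n N y y = bil n S (\<lambda>i. \<Sum>j<n. y j * l j i) (\<lambda>i. \<Sum>j<n. y j * l j i)" for y
    unfolding N_def bil_sum ..
  have le: "bil n N y y \<le> 2 * th * (b * s) * sqn n y" for y
  proof -
    define a where "a i = (\<Sum>j<n. y j * l j i)" for i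
    define c where "c = 2 * th * b"
    have c: "0 < c" using th b_pos by (simp add: c_def)
    \<comment> \<open>The norm bound passes from L to L^T: with a = L^T y, |a|^2 = <y, L a> is at
      most (c |y|^2 + |L a|^2 / c) / 2, and |L a|^2 is at most c |a|^2, so half of |a|^2 is absorbed
      on the left.\<close>
    have "sqn n a = (\<Sum>j<n. y j * (\<Sum>i<n. l j i * a i))"
      unfolding sum_exchange a_def[symmetric] sqn_def power2_eq_square ..
    then have "2 * sqn n a = (\<Sum>j<n. 2 * (y j * (\<Sum>i<n. l j i * a i)))"
      by (simp only: sum_distrib_left)
    also have "\<dots> \<le> (\<Sum>j<n. c * (y j)\<^sup>2 + (\<Sum>i<n. l j i * a i)\<^sup>2 / c)"
    proof (intro sum_mono)
      fix j
      let ?w = "\<Sum>i<n. l j i * a i"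
      have "0 \<le> (c * y j - ?w)\<^sup>2 / c" using c by simp
      then show "2 * (y j * ?w) \<le> c * (y j)\<^sup>2 + ?w\<^sup>2 / c"
        using c by (simp add: power2_eq_square field_simps)
    qed
    also have "\<dots> = c * sqn n y + 2 * th * bil n B a a / c"
      by (simp add: sum.distrib sum_distrib_left[symmetric] sum_divide_distrib[symmetric] sq sqn_def)
    also have "\<dots> \<le> c * sqn n y + 2 * th * (b * sqn n a) / c"
      using leB[of a] th c by (intro add_left_mono divide_right_mono mult_left_mono) auto
    also have "\<dots> = c * sqn n y + sqn n a" using c th b_pos by (simp add: c_def)
    finally have "sqn n a \<le> c * sqn n y" by simp
    then have "s * sqn n a \<le> s * (c * sqn n y)" using s_pos by (intro mult_left_mono) auto
    moreover have "bil n N y y \<le> s * sqn n a" unfolding N a_def[symmetric] by (rule leS)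
    ultimately show ?thesis by (simp add: c_def mult_ac)
  qed
  have "(\<Sum>i<n. N i i) = 2 * th * tr"
  proof -
    \<comment> \<open>The Gram matrix L^T L; it has the same quadratic form as 2 th B, hence the
      same entries.\<close>
    define B2 where "B2 = (\<lambda>i k. \<Sum>j<n. l j i * l j k)"
    have B2: "bil n B2 x x = (\<Sum>j<n. (\<Sum>i<n. l j i * x i)\<^sup>2)" for x
      unfolding B2_def by (rule bil_gram)
    have "B2 i k = 2 * th * B i k" if "i < n" "k < n" for i k
    proof (rule sym_mat_eqI[OF _ _ _ that])
      show "sym_mat n B2" "sym_mat n (\<lambda>i k. 2 * th * B i k)"
        using symB by (auto simp: sym_mat_def B2_def mult_ac)
      show "bil n B2 y y = bil n (\<lambda>i k. 2 * th * B i k) y y" for y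
        unfolding B2 sq by (simp add: bil_def sum_distrib_left mult_ac)
    qed
    then have "2 * th * tr = (\<Sum>i<n. \<Sum>k<n. B2 i k * S i k)"
      unfolding tr_def by (simp add: sum_distrib_left mult_ac)
    also have "\<dots> = (\<Sum>j<n. N j j)"
      unfolding B2_def N_def by (rule trace_gram)
    finally show ?thesis ..
  qed
  moreover have "sym_mat n N" using bil_sym[OF symS] by (auto simp: sym_mat_def N_def)
  ultimately show ?thesis
    using that[of l N] le sq posS N N_def by simp
qed

text \<open>The Gaussian integral with A = -N: since N is at most q < 1, (1 - N)^{-1} = 1 + N (1 -
  N)^{-1} is at most 1 + N / (1 - q), whose diagonal is \<open>G\<close>. Then 1 + x is bounded by
  exp x, so that the product collapses to an exponential of the trace.\<close>

lemma exp_upper: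
  assumes "0 < th" "2 * th * (b * s) < 1"
  shows "(\<integral>\<^sup>+\<omega>. ennreal (exp (th * bil n B (X \<omega>) (X \<omega>))) \<partial>M)
    \<le> ennreal (exp (th * tr / (1 - 2 * th * (b * s))))"
proof -
  obtain l N where l: "\<And>x. th * bil n B x x = (\<Sum>j<n. (\<Sum>i<n. l j i * x i)\<^sup>2) / 2"
    and N: "N = (\<lambda>j k. bil n S (l j) (l k))" "sym_mat n N" "\<And>y. 0 \<le> bil n N y y"
    "\<And>y. bil n N y y \<le> 2 * th * (b * s) * sqn n y" "(\<Sum>i<n. N i i) = 2 * th * tr"
    using factorization[OF assms(1)] by blast
  define q where "q = 2 * th * (b * s)"
  have q: "0 < q" "q < 1" using assms b_pos s_pos by (auto simp: q_def)
  \<comment> \<open>Cauchy-Schwarz weight for the cross term: (1 + 1/k) N = N / q is still at most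
    1, and what remains is (1 + k) N i i = N i i / (1 - q).\<close>
  define k where "k = q / (1 - q)"
  have k: "0 < k" "1 + k = 1 / (1 - q)" "1 + 1 / k = 1 / q" using q by (auto simp: k_def field_simps)
  define G where "G i = 1 + N i i / (1 - q)" for i
  have bound: "2 * y i - sqn n y - bil n (\<lambda>i j. - N i j) y y \<le> G i" if i: "i < n" for i y
  proof -
    let ?e = "\<lambda>j. if j = i then 1 else 0 :: real"
    define z where "z j = y j + (-1) * ?e j" for j
    have y: "y = (\<lambda>j. z j + 1 * ?e j)" by (auto simp: z_def)
    have sy: "2 * y i - sqn n y = 1 - sqn n z" using sqn_minus_unit[OF i, of y] unfolding z_def[abs_def] by simp
    have "bil n N y y = bil n N z z + 2 * bil n N z ?e + N i i"
      by (subst (1 2) y, subst bil_quad_add[OF N(2)]) (simp add: bil_unit[OF i])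
    moreover have "2 * bil n N z ?e \<le> bil n N z z / k + k * N i i"
    proof -
      have "2 * k * bil n N z ?e \<le> bil n N z z + k\<^sup>2 * N i i"
        using bil_nonneg_CS(1)[OF N(2,3), of k z ?e] by (simp add: bil_unit[OF i])
      then show ?thesis using k(1) by (simp add: field_simps power2_eq_square)
    qed
    moreover have "bil n N z z + bil n N z z / k \<le> sqn n z"
    proof -
      have "bil n N z z + bil n N z z / k = bil n N z z * (1 + 1 / k)" by (simp add: algebra_simps)
      also have "\<dots> = bil n N z z / q" unfolding k(3) by simp
      also have "\<dots> \<le> sqn n z" using N(4)[of z, folded q_def] q(1) by (simp add: pos_divide_le_eq mult.commute)
      finally show ?thesis .
    qed
    moreover have "N i i + k * N i i = N i i / (1 - q)"
      using k(2) by (metis distrib_right mult_1 times_divide_eq_left)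
    moreover have "bil n (\<lambda>i j. - N i j) y y = - bil n N y y" by (simp add: bil_def sum_negf)
    ultimately show ?thesis using sy by (simp add: G_def)
  qed
  have Gpos: "0 \<le> G i" if "i < n" for i
    using bound[OF that, of "\<lambda>_. 0"] by (simp add: sqn_def bil_def)
  have "(\<integral>\<^sup>+\<omega>. ennreal (exp (th * bil n B (X \<omega>) (X \<omega>))) \<partial>M)
    = (\<integral>\<^sup>+h. ennreal (exp (- bil n (\<lambda>i j. - N i j) h h / 2)) \<partial>stdGn n)"
    unfolding l gaussian_vector_exp_squares[OF prob gauss posS] N(1) by (simp add: bil_def sum_negf)
  also have "\<dots> \<le> ennreal (\<Prod>i<n. sqrt (G i))"
    using N(2) bound by (intro gaussian_integral_le) (auto simp: sym_mat_def)
  also have "\<dots> \<le> ennreal (\<Prod>i<n. exp (N i i / (2 * (1 - q))))"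
  proof (intro ennreal_leI prod_mono conjI)
    fix i assume "i \<in> {..<n}"
    show "sqrt (G i) \<le> exp (N i i / (2 * (1 - q)))"
    proof (rule real_le_lsqrt)
      have "2 * (N i i / (2 * (1 - q))) = N i i / (1 - q)" using q by (simp add: field_simps)
      then have "(exp (N i i / (2 * (1 - q))))\<^sup>2 = exp (N i i / (1 - q))"
        by (metis exp_double)
      then show "G i \<le> (exp (N i i / (2 * (1 - q))))\<^sup>2"
        unfolding G_def by simp
    qed auto
  qed (use Gpos in auto)
  also have "(\<Prod>i<n. exp (N i i / (2 * (1 - q)))) = exp (th * tr / (1 - q))"
  proof -
    have "(\<Sum>i<n. N i i / (2 * (1 - q))) = th * tr / (1 - q)"
      unfolding sum_divide_distrib[symmetric] N(5) using q by (simp add: field_simps)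
    then show ?thesis by (simp add: exp_sum[symmetric])
  qed
  finally show ?thesis by (simp add: q_def)
qed

text \<open>The same scheme with A = N: on [0, q] the inequality 1 / (1 + x) <= 1 - (1 - q) x holds,
  so the diagonal of (1 + N)^{-1} is bounded by \<open>G\<close>, and 1 - x <= exp (- x)
  finishes.\<close>

lemma exp_lower:
  assumes "0 < th" "2 * th * (b * s) < 1"
  shows "(\<integral>\<^sup>+\<omega>. ennreal (exp (- th * bil n B (X \<omega>) (X \<omega>))) \<partial>M)
    \<le> ennreal (exp (- th * tr * (1 - 2 * th * (b * s))))"
proof -
  obtain l N where l: "\<And>x. th * bil n B x x = (\<Sum>j<n. (\<Sum>i<n. l j i * x i)\<^sup>2) / 2"
    and N: "N = (\<lambda>j k. bil n S (l j) (l k))" "sym_mat n N" "\<And>y. 0 \<le> bil n N y y"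
    "\<And>y. bil n N y y \<le> 2 * th * (b * s) * sqn n y" "(\<Sum>i<n. N i i) = 2 * th * tr"
    using factorization[OF assms(1)] by blast
  define q where "q = 2 * th * (b * s)"
  have q: "0 < q" "q < 1" using assms b_pos s_pos by (auto simp: q_def)
  define G where "G i = 1 - N i i * (1 - q)" for i
  have bound: "2 * y i - sqn n y - bil n N y y \<le> G i" if i: "i < n" for i y
  proof -
    let ?e = "\<lambda>j. if j = i then 1 else 0 :: real"
    define z where "z j = y j + (-1) * ?e j" for j
    have y: "y = (\<lambda>j. z j + 1 * ?e j)" by (auto simp: z_def)
    have sy: "2 * y i - sqn n y = 1 - sqn n z" using sqn_minus_unit[OF i, of y] unfolding z_def[abs_def] by simp
    have "bil n N y y = bil n N z z + 2 * bil n N z ?e + N i i"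
      by (subst (1 2) y, subst bil_quad_add[OF N(2)]) (simp add: bil_unit[OF i])
    moreover have "- (2 * bil n N z ?e) \<le> bil n N z z / q + q * N i i"
    proof -
      have "- (2 * q * bil n N z ?e) \<le> bil n N z z + q\<^sup>2 * N i i"
        using bil_nonneg_CS(2)[OF N(2,3), of q z ?e] by (simp add: bil_unit[OF i])
      then show ?thesis using q(1) by (simp add: field_simps power2_eq_square)
    qed
    moreover have "bil n N z z / q \<le> sqn n z"
      using N(4)[of z, folded q_def] q(1) by (simp add: pos_divide_le_eq mult.commute)
    ultimately show ?thesis using sy N(3)[of z] by (simp add: G_def algebra_simps)
  qed
  have Gpos: "0 \<le> G i" if "i < n" for i
    using bound[OF that, of "\<lambda>_. 0"] by (simp add: sqn_def bil_def)
  have "(\<integral>\<^sup>+\<omega>. ennreal (exp (- th * bil n B (X \<omega>) (X \<omega>))) \<partial>M)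
    = (\<integral>\<^sup>+h. ennreal (exp (- bil n N h h / 2)) \<partial>stdGn n)"
  proof -
    have e: "- th * bil n B x x = - (\<Sum>j<n. (\<Sum>i<n. l j i * x i)\<^sup>2) / 2" for x
      using l[of x] by simp
    show ?thesis unfolding e gaussian_vector_exp_neg_squares[OF prob gauss posS] N(1) ..
  qed
  also have "\<dots> \<le> ennreal (\<Prod>i<n. sqrt (G i))"
    using N(2) bound by (rule gaussian_integral_le)
  also have "\<dots> \<le> ennreal (\<Prod>i<n. exp (- N i i * (1 - q) / 2))"
  proof (intro ennreal_leI prod_mono conjI)
    fix i assume "i \<in> {..<n}"
    show "sqrt (G i) \<le> exp (- N i i * (1 - q) / 2)"
    proof (rule real_le_lsqrt)
      have "(exp (- N i i * (1 - q) / 2))\<^sup>2 = exp (- N i i * (1 - q))"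
        by (simp add: exp_double[symmetric])
      then show "G i \<le> (exp (- N i i * (1 - q) / 2))\<^sup>2"
        using exp_ge_add_one_self[of "- N i i * (1 - q)"] unfolding G_def by simp
    qed auto
  qed (use Gpos in auto)
  also have "(\<Prod>i<n. exp (- N i i * (1 - q) / 2)) = exp (- th * tr * (1 - q))"
    using N(5) by (simp add: exp_sum[symmetric] sum_divide_distrib[symmetric] sum_negf sum_distrib_right[symmetric])
  finally show ?thesis by (simp add: q_def)
qed

end

section \<open>Concentration\<close>

context gaussian_quadratic_form
begin

text \<open>Chernoff bounds on both sides. The deviation is measured relative to the trace, which is
  the mean of the form; only the product of the two norm bounds enters.\<close>

lemma tail:
  assumes e: "0 < e" "e \<le> 1" and tr: "0 \<le> tr"
  shows "measure M {\<omega> \<in> space M. e * tr \<le> \<bar>bil n B (X \<omega>) (X \<omega>) - tr\<bar>}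
    \<le> 2 * exp (- e\<^sup>2 * tr / (16 * (b * s)))"
proof -
  interpret M: prob_space M by (rule prob)
  let ?Q = "\<lambda>\<omega>. bil n B (X \<omega>) (X \<omega>)"
  \<comment> \<open>This makes q = e / 4, small enough for the factors 1 / (1 - q) and 1 - q in the
    Laplace bounds to cost at most half of the deviation e * tr.\<close>
  define th where "th = e / (8 * (b * s))"
  define q where "q = 2 * th * (b * s)"
  have bs: "0 < b * s" using b_pos s_pos by simp
  have th: "0 < th" and q: "q = e / 4" "q < 1" using e bs by (auto simp: th_def q_def)
  let ?r = "exp (- e\<^sup>2 * tr / (16 * (b * s)))"
  have r: "th * tr * e / 2 = e\<^sup>2 * tr / (16 * (b * s))"
    by (simp add: th_def power2_eq_square)
  note [measurable] = meas_Q
  have markov: "measure M {\<omega> \<in> space M. 0 \<le> u \<omega>} \<le> exp c"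
    if [measurable]: "u \<in> borel_measurable M" and "(\<integral>\<^sup>+\<omega>. ennreal (exp (u \<omega>)) \<partial>M) \<le> ennreal (exp c)" for u c
  proof -
    have "emeasure M {\<omega> \<in> space M. 0 \<le> u \<omega>} \<le> (\<integral>\<^sup>+\<omega>. ennreal (exp (u \<omega>)) \<partial>M)"
      using nn_integral_Markov_inequality[of "\<lambda>\<omega>. ennreal (exp (u \<omega>))" "space M" M 1]
      by (simp cong: nn_integral_cong)
    then show ?thesis using that(2) by (simp add: M.emeasure_eq_measure) (meson ennreal_le_iff exp_ge_zero order_trans)
  qed
  have "measure M {\<omega> \<in> space M. 0 \<le> th * (?Q \<omega> - tr) - th * (e * tr)} \<le> exp (- (th * tr * e / 2))"
  proof (rule markov)
    have "(\<integral>\<^sup>+\<omega>. ennreal (exp (th * (?Q \<omega> - tr) - th * (e * tr))) \<partial>M)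
       = (\<integral>\<^sup>+\<omega>. ennreal (exp (- th * tr * (1 + e))) * ennreal (exp (th * ?Q \<omega>)) \<partial>M)"
      by (intro nn_integral_cong) (simp add: ennreal_mult'[symmetric] exp_add[symmetric] algebra_simps)
    also have "\<dots> = ennreal (exp (- th * tr * (1 + e))) * (\<integral>\<^sup>+\<omega>. ennreal (exp (th * ?Q \<omega>)) \<partial>M)"
      by (rule nn_integral_cmult) measurable
    also have "\<dots> \<le> ennreal (exp (- th * tr * (1 + e))) * ennreal (exp (th * tr / (1 - q)))"
      using exp_upper[OF th] q by (intro mult_left_mono) (auto simp: q_def)
    also have "\<dots> \<le> ennreal (exp (- (th * tr * e / 2)))"
    proof -
      have "e * q \<le> 1 * q" using q e by (intro mult_right_mono) auto
      moreover have "(1 + e / 2) * (1 - q) = 1 + e / 2 - q - e * q / 2" by (simp add: field_simps)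
      ultimately have "1 \<le> (1 + e / 2) * (1 - q)" using q(1) e by linarith
      then have "1 / (1 - q) \<le> 1 + e / 2" using q(2) by (simp add: pos_divide_le_eq)
      then have "th * tr * (1 / (1 - q)) \<le> th * tr * (1 + e / 2)" using th tr by (intro mult_left_mono) auto
      then show ?thesis
        by (simp add: ennreal_mult'[symmetric] exp_add[symmetric] algebra_simps)
    qed
    finally show "(\<integral>\<^sup>+\<omega>. ennreal (exp (th * (?Q \<omega> - tr) - th * (e * tr))) \<partial>M) \<le> ennreal (exp (- (th * tr * e / 2)))" .
  qed measurable
  moreover have "measure M {\<omega> \<in> space M. 0 \<le> th * (tr - ?Q \<omega>) - th * (e * tr)} \<le> exp (- (th * tr * e / 2))"
  proof (rule markov)
    have "(\<integral>\<^sup>+\<omega>. ennreal (exp (th * (tr - ?Q \<omega>) - th * (e * tr))) \<partial>M)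
       = (\<integral>\<^sup>+\<omega>. ennreal (exp (th * tr * (1 - e))) * ennreal (exp (- th * ?Q \<omega>)) \<partial>M)"
      by (intro nn_integral_cong) (simp add: ennreal_mult'[symmetric] exp_add[symmetric] algebra_simps)
    also have "\<dots> = ennreal (exp (th * tr * (1 - e))) * (\<integral>\<^sup>+\<omega>. ennreal (exp (- th * ?Q \<omega>)) \<partial>M)"
      by (rule nn_integral_cmult) measurable
    also have "\<dots> \<le> ennreal (exp (th * tr * (1 - e))) * ennreal (exp (- th * tr * (1 - q)))"
      using exp_lower[OF th] q by (intro mult_left_mono) (auto simp: q_def)
    also have "\<dots> \<le> ennreal (exp (- (th * tr * e / 2)))"
    proof -
      have "th * tr * q \<le> th * tr * (e / 2)" using th tr e by (intro mult_left_mono) (auto simp: q)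
      then show ?thesis
        by (simp add: ennreal_mult'[symmetric] exp_add[symmetric] algebra_simps)
    qed
    finally show "(\<integral>\<^sup>+\<omega>. ennreal (exp (th * (tr - ?Q \<omega>) - th * (e * tr))) \<partial>M) \<le> ennreal (exp (- (th * tr * e / 2)))" .
  qed measurable
  moreover have "measure M {\<omega> \<in> space M. e * tr \<le> \<bar>?Q \<omega> - tr\<bar>}
     \<le> measure M ({\<omega> \<in> space M. 0 \<le> th * (?Q \<omega> - tr) - th * (e * tr)} \<union> {\<omega> \<in> space M. 0 \<le> th * (tr - ?Q \<omega>) - th * (e * tr)})"
    using th by (intro M.finite_measure_mono) (auto simp: abs_real_def right_diff_distrib[symmetric] split: if_splits)
  moreover have "\<dots> \<le> measure M {\<omega> \<in> space M. 0 \<le> th * (?Q \<omega> - tr) - th * (e * tr)}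
     + measure M {\<omega> \<in> space M. 0 \<le> th * (tr - ?Q \<omega>) - th * (e * tr)}"
    by (rule measure_Un_le) measurable
  ultimately show ?thesis unfolding r by simp
qed

end

lemma summable_exp_neg_powr:
  fixes k d :: real
  assumes "0 < k" "0 < d"
  shows "summable (\<lambda>n. exp (- k * real n powr d))"
proof (rule summable_comparison_test_bigo)
  show "summable (\<lambda>n. norm (real n powr (-2)))" by (simp add: summable_real_powr_iff)
  show "(\<lambda>n. exp (- k * real n powr d)) \<in> O(\<lambda>n. real n powr (-2))"
    using assms by real_asymp
qed

text \<open>With a trace at least linear in n and norm product O(n^g), the exponent in
  \<open>tail\<close> is at least a constant times n^(1 - g). The tails are therefore summable and
  Borel-Cantelli applies for each of the tolerances 1 / (k + 1).\<close>

lemma AE_quadratic_form_ratio: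
  fixes X :: "nat \<Rightarrow> 'a \<Rightarrow> nat \<Rightarrow> real"
  assumes form: "\<And>n. n0 \<le> n \<Longrightarrow> gaussian_quadratic_form M n (X n) (S n) (B n) (b n) (s n)"
    and bs: "\<And>n. n0 \<le> n \<Longrightarrow> b n * s n \<le> C * real n powr g"
    and tr: "\<And>n. n0 \<le> n \<Longrightarrow> c * real n \<le> (\<Sum>i<n. \<Sum>j<n. B n i j * S n i j)"
    and "g < 1" "0 < c" "0 < n0"
  shows "AE \<omega> in M. (\<lambda>n. bil n (B n) (X n \<omega>) (X n \<omega>) / (\<Sum>i<n. \<Sum>j<n. B n i j * S n i j)) \<longlonglongrightarrow> 1"
proof -
  interpret M: prob_space M using gaussian_quadratic_form.prob[OF form[OF order_refl]] .
  define Q where "Q n \<omega> = bil n (B n) (X n \<omega>) (X n \<omega>)" for n \<omega>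
  define t where "t n = (\<Sum>i<n. \<Sum>j<n. B n i j * S n i j)" for n
  have C: "0 < C"
  proof -
    have "0 < b n0 * s n0" using form[OF order_refl] by (simp add: gaussian_quadratic_form_def)
    also have "\<dots> \<le> C * real n0 powr g" by (rule bs) simp
    finally show ?thesis using \<open>0 < n0\<close> by (simp add: zero_less_mult_iff)
  qed
  have ev: "AE \<omega> in M. \<forall>\<^sub>F n in sequentially. \<bar>Q n \<omega> - t n\<bar> < e * t n" if e: "0 < e" "e \<le> 1" for e
  proof -
    \<comment> \<open>Below \<open>n0\<close>, where nothing is assumed, the bad event is set to be
      empty; this does not affect the eventual behaviour.\<close>
    define A where "A n = (if n0 \<le> n then {\<omega> \<in> space M. e * t n \<le> \<bar>Q n \<omega> - t n\<bar>} else {})" for n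
    have sets: "A n \<in> sets M" for n
    proof (cases "n0 \<le> n")
      case True
      have [measurable]: "Q n \<in> borel_measurable M"
        unfolding Q_def[abs_def] by (rule gaussian_quadratic_form.meas_Q[OF form[OF True]])
      have "{\<omega> \<in> space M. e * t n \<le> \<bar>Q n \<omega> - t n\<bar>} \<in> sets M" by measurable
      then show ?thesis by (simp add: A_def True)
    qed (simp add: A_def)
    define k where "k = e\<^sup>2 * c / (16 * C)"
    have k: "0 < k" using e C \<open>0 < c\<close> by (simp add: k_def)
    have le: "measure M (A n) \<le> 2 * exp (- k * real n powr (1 - g))" for n
    proof (cases "n0 \<le> n")
      case True
      interpret F: gaussian_quadratic_form M n "X n" "S n" "B n" "b n" "s n" by (rule form[OF True])
      have n: "0 < real n" using True \<open>0 < n0\<close> by simp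
      have F: "F.tr = t n" by (simp add: F.tr_def t_def)
      have tn: "c * real n \<le> t n" using tr[OF True] by (simp add: t_def)
      then have tn0: "0 \<le> t n" using n \<open>0 < c\<close> by (meson less_imp_le mult_pos_pos order_trans)
      have "k * real n powr (1 - g) = e\<^sup>2 * (c * real n) / (16 * (C * real n powr g))"
        using n by (simp add: k_def powr_diff)
      also have "\<dots> \<le> e\<^sup>2 * t n / (16 * (b n * s n))"
        using tn bs[OF True] n C F.b_pos F.s_pos tn0 by (intro frac_le mult_left_mono mult_pos_pos) auto
      finally have e1: "exp (- e\<^sup>2 * t n / (16 * (b n * s n))) \<le> exp (- k * real n powr (1 - g))" by simp
      have "measure M (A n) \<le> 2 * exp (- e\<^sup>2 * t n / (16 * (b n * s n)))"
        using F.tail[OF e] tn0 True unfolding F A_def Q_def by simp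
      also have "\<dots> \<le> 2 * exp (- k * real n powr (1 - g))"
        by (intro mult_left_mono e1) simp
      finally show ?thesis .
    qed (simp add: A_def)
    have "summable (\<lambda>n. measure M (A n))"
      using le k \<open>g < 1\<close>
      by (intro summable_comparison_test'[OF summable_mult[OF summable_exp_neg_powr, of k "1 - g" 2], of 0]) auto
    then have "AE \<omega> in M. \<forall>\<^sub>F n in sequentially. \<omega> \<in> space M - A n"
      using sets by (intro borel_cantelli_AE1) (auto simp: M.emeasure_eq_measure)
    then show ?thesis
    proof (eventually_elim)
      case (elim \<omega>)
      with eventually_ge_at_top[of n0] show ?case
        by eventually_elim (auto simp: A_def)
    qed
  qed
  have "AE \<omega> in M. \<forall>k. \<forall>\<^sub>F n in sequentially. \<bar>Q n \<omega> - t n\<bar> < (1 / real (Suc k)) * t n"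
    unfolding AE_all_countable by (intro allI ev) auto
  then show ?thesis
  proof eventually_elim
    case (elim \<omega>)
    have "(\<lambda>n. Q n \<omega> / t n) \<longlonglongrightarrow> 1"
    proof (rule LIMSEQ_I)
      fix r :: real assume "0 < r"
      then obtain k where k: "1 / real (Suc k) < r" using nat_approx_posE by blast
      have "\<forall>\<^sub>F n in sequentially. norm (Q n \<omega> / t n - 1) < r"
        using elim[rule_format, of k] eventually_ge_at_top[of n0]
      proof eventually_elim
        case (elim n)
        have "0 < c * real n" using elim \<open>0 < n0\<close> \<open>0 < c\<close> by simp
        then have t: "0 < t n" using tr[of n] elim by (simp add: t_def)
        have "Q n \<omega> / t n - 1 = (Q n \<omega> - t n) / t n" using t by (simp add: diff_divide_distrib)
        then have "norm (Q n \<omega> / t n - 1) = \<bar>Q n \<omega> - t n\<bar> / t n" using t by simp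
        also have "\<dots> < 1 / real (Suc k)" using elim t by (simp add: pos_divide_less_eq)
        finally show ?case using k by simp
      qed
      then show "\<exists>no. \<forall>n\<ge>no. norm (Q n \<omega> / t n - 1) < r" by (simp add: eventually_sequentially)
    qed
    then show ?case by (simp add: Q_def t_def)
  qed
qed

section \<open>Toeplitz forms and their inverses\<close>

definition circ :: "real measure" where
  "circ = density lborel (\<lambda>t. ennreal (indicator {-pi..pi} t / (2 * pi)))"

lemma sets_circ [simp, measurable_cong]: "sets circ = sets borel"
  and space_circ [simp]: "space circ = UNIV"
  by (simp_all add: circ_def)

lemma measurable_circ [simp]: "measurable circ N = measurable borel N"
  by (intro measurable_cong_sets) simp_all

text \<open>The excluded null set consists of the origin, where densities may blow up or vanish, and
  of the end points, where convergence of Fejer means is not established.\<close>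

lemma AE_circI:
  assumes "\<And>t. - pi \<le> t \<Longrightarrow> t \<le> pi \<Longrightarrow> t \<noteq> 0 \<Longrightarrow> t \<noteq> pi \<Longrightarrow> t \<noteq> - pi \<Longrightarrow> P t"
  shows "AE t in circ. P t"
proof -
  have "AE t in lborel. t \<noteq> 0 \<and> t \<noteq> pi \<and> t \<noteq> - pi"
    using AE_lborel_singleton[of 0] AE_lborel_singleton[of pi] AE_lborel_singleton[of "- pi"] by eventually_elim simp
  then have "AE t in lborel. 0 < ennreal (indicator {-pi..pi} t / (2 * pi)) \<longrightarrow> P t"
    by eventually_elim (auto simp: indicator_def intro: assms)
  then show ?thesis unfolding circ_def by (subst AE_density) auto
qed

lemma integrable_circI:
  fixes f :: "real \<Rightarrow> 'b::{banach, second_countable_topology}"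
  assumes [measurable]: "f \<in> borel_measurable borel" and "set_integrable lborel {-pi..pi} f"
  shows "integrable circ f"
proof -
  have "integrable lborel (\<lambda>t. (1 / (2 * pi)) *\<^sub>R (indicator {-pi..pi} t *\<^sub>R f t))"
    using assms(2) unfolding set_integrable_def by (rule integrable_scaleR_right)
  then show ?thesis
    unfolding circ_def by (subst integrable_density) auto
qed

lemma integral_circ:
  fixes f :: "real \<Rightarrow> 'b::{banach, real_normed_field, second_countable_topology}"
  assumes [measurable]: "f \<in> borel_measurable borel"
  shows "integral\<^sup>L circ f = of_real (1 / (2 * pi)) * (LINT t:{-pi..pi}|lborel. f t)"
proof -
  have "integral\<^sup>L circ f = integral\<^sup>L lborel (\<lambda>t. (indicator {-pi..pi} t / (2 * pi)) *\<^sub>R f t)"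
    unfolding circ_def by (subst integral_density) auto
  also have "\<dots> = integral\<^sup>L lborel (\<lambda>t. of_real (1 / (2 * pi)) * (indicator {-pi..pi} t *\<^sub>R f t))"
    by (intro Bochner_Integration.integral_cong) (auto simp: scaleR_conv_of_real)
  also have "\<dots> = of_real (1 / (2 * pi)) * (LINT t:{-pi..pi}|lborel. f t)"
    unfolding set_lebesgue_integral_def by (rule integral_mult_right_zero)
  finally show ?thesis .
qed

lemma prob_space_circ: "prob_space circ"
proof
  have "emeasure circ (space circ) = (\<integral>\<^sup>+t. ennreal (1 / (2 * pi)) * indicator {-pi..pi} t \<partial>lborel)"
    unfolding circ_def by (subst emeasure_density) (auto intro!: nn_integral_cong simp: indicator_def)
  also have "\<dots> = ennreal (1 / (2 * pi)) * ennreal (2 * pi)"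
    by (subst nn_integral_cmult_indicator) auto
  also have "\<dots> = 1" by (subst ennreal_mult'[symmetric]) auto
  finally show "emeasure circ (space circ) = 1" .
qed

interpretation circ: prob_space circ by (rule prob_space_circ)

lemma integrable_circ_bounded_mult:
  fixes f g :: "real \<Rightarrow> real"
  assumes "integrable circ g" "f \<in> borel_measurable borel" "\<And>t. \<bar>f t\<bar> \<le> C"
  shows "integrable circ (\<lambda>t. f t * g t)"
proof (rule Bochner_Integration.integrable_bound)
  show "integrable circ (\<lambda>t. C * \<bar>g t\<bar>)" using assms(1) by simp
  show "(\<lambda>t. f t * g t) \<in> borel_measurable circ"
    using assms(2) borel_measurable_integrable[OF assms(1)] by simp
  show "AE t in circ. norm (f t * g t) \<le> norm (C * \<bar>g t\<bar>)"
    using assms(3) by (intro AE_I2) (auto simp: abs_mult intro!: mult_right_mono order_trans[OF assms(3) abs_ge_self])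
qed

lemma integral_circ_cos:
  fixes m :: int
  shows "(\<integral>t. cos (of_int m * t) \<partial>circ) = (if m = 0 then 1 else 0)"
proof (cases "m = 0")
  case True
  then show ?thesis using circ.prob_space by simp
next
  case False
  have "(\<integral>t. cos (of_int m * t) * indicator {-pi..pi} t \<partial>lborel) = sin (of_int m * pi) / of_int m - sin (of_int m * (- pi)) / of_int m"
    using False by (intro integral_FTC_Icc_real) (auto intro!: derivative_eq_intros)
  also have "\<dots> = 0" by (simp add: sin_times_pi_eq_0[of "of_int m"] mult.commute)
  finally show ?thesis using False
    by (simp add: integral_circ set_lebesgue_integral_def mult.commute)
qed

text \<open>The real part of the rank-one matrix with entries exp (i (j - k) t). For an even symbol
  only this part survives integration, which keeps all Toeplitz matrices real.\<close>

definition cosm :: "real \<Rightarrow> nat \<Rightarrow> nat \<Rightarrow> real" where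
  "cosm t j k = cos ((real j - real k) * t)"

definition toep :: "(real \<Rightarrow> real) \<Rightarrow> nat \<Rightarrow> nat \<Rightarrow> real" where
  "toep g j k = (\<integral>t. cosm t j k * g t \<partial>circ)"

definition dot :: "nat \<Rightarrow> (nat \<Rightarrow> real) \<Rightarrow> (nat \<Rightarrow> real) \<Rightarrow> real" where
  "dot n x y = (\<Sum>i<n. x i * y i)"

lemma cosm_measurable [measurable]: "(\<lambda>t. cosm t j k) \<in> borel_measurable borel"
  by (simp add: cosm_def)

lemma sym_cosm: "sym_mat n (cosm t)"
  unfolding sym_mat_def cosm_def
proof (intro allI impI)
  fix i j
  have "(real j - real i) * t = - ((real i - real j) * t)" by (simp add: algebra_simps)
  then show "cos ((real i - real j) * t) = cos ((real j - real i) * t)" by (simp only: cos_minus)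
qed

lemma sym_toep: "sym_mat n (toep g)"
  using sym_cosm by (simp add: sym_mat_def toep_def)

lemma bil_cosm: "bil n (cosm t) x x = (\<Sum>j<n. x j * cos (real j * t))\<^sup>2 + (\<Sum>j<n. x j * sin (real j * t))\<^sup>2"
  by (simp add: bil_def cosm_def power2_eq_square sum_product sum.distrib[symmetric]
      left_diff_distrib cos_diff algebra_simps)

lemma bil_cosm_nonneg: "0 \<le> bil n (cosm t) x x"
  by (simp add: bil_cosm)

lemma bil_abs_le:
  assumes "\<And>i j. \<bar>A i j\<bar> \<le> 1"
  shows "\<bar>bil n A x x\<bar> \<le> real n * sqn n x"
proof -
  have "\<bar>bil n A x x\<bar> \<le> (\<Sum>i<n. \<Sum>j<n. \<bar>x i * A i j * x j\<bar>)"
    unfolding bil_def by (rule order_trans[OF sum_abs sum_mono[OF sum_abs]])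
  also have "\<dots> \<le> (\<Sum>i<n. \<Sum>j<n. ((x i)\<^sup>2 + (x j)\<^sup>2) / 2)"
  proof (intro sum_mono)
    fix i j
    have "\<bar>x i * A i j * x j\<bar> \<le> 1 * (\<bar>x i\<bar> * \<bar>x j\<bar>)"
      using mult_right_mono[OF assms, of "\<bar>x i\<bar> * \<bar>x j\<bar>" i j] by (simp add: abs_mult mult_ac)
    also have "\<dots> \<le> ((x i)\<^sup>2 + (x j)\<^sup>2) / 2"
      using sum_squares_bound[of "\<bar>x i\<bar>" "\<bar>x j\<bar>"] by (simp add: mult.assoc)
    finally show "\<bar>x i * A i j * x j\<bar> \<le> ((x i)\<^sup>2 + (x j)\<^sup>2) / 2" .
  qed
  also have "\<dots> = real n * sqn n x"
    by (simp add: sum.distrib add_divide_distrib sum_divide_distrib[symmetric] sum_distrib_left[symmetric] sqn_def)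
  finally show ?thesis .
qed

lemma bil_cosm_le: "bil n (cosm t) x x \<le> real n * sqn n x"
  using bil_abs_le[of "cosm t" n x] by (simp add: cosm_def)

lemma integrable_cosm_mult: "integrable circ g \<Longrightarrow> integrable circ (\<lambda>t. cosm t j k * g t)"
  by (intro integrable_circ_bounded_mult[of _ _ 1]) (auto simp: cosm_def)

text \<open>Arbitrary coefficients \<open>a\<close> allow three uses: quadratic forms, Fejer means,
  and the trace of an inverse against another Toeplitz matrix.\<close>

lemma sum_integral_circ:
  assumes "integrable circ g"
  shows "(\<Sum>i<n. \<Sum>j<n. a i j * toep g i j) = (\<integral>t. (\<Sum>i<n. \<Sum>j<n. a i j * cosm t i j) * g t \<partial>circ)"
    and "integrable circ (\<lambda>t. (\<Sum>i<n. \<Sum>j<n. a i j * cosm t i j) * g t)"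
proof -
  have "integrable circ (\<lambda>t. \<Sum>i<n. \<Sum>j<n. a i j * (cosm t i j * g t))"
    using integrable_cosm_mult[OF assms] by (intro Bochner_Integration.integrable_sum) auto
  then show "integrable circ (\<lambda>t. (\<Sum>i<n. \<Sum>j<n. a i j * cosm t i j) * g t)"
    by (simp add: sum_distrib_right mult.assoc)
  have "(\<integral>t. (\<Sum>i<n. \<Sum>j<n. a i j * (cosm t i j * g t)) \<partial>circ) = (\<Sum>i<n. \<Sum>j<n. a i j * toep g i j)"
    unfolding toep_def using integrable_cosm_mult[OF assms] by (simp add: Bochner_Integration.integral_sum)
  then show "(\<Sum>i<n. \<Sum>j<n. a i j * toep g i j) = (\<integral>t. (\<Sum>i<n. \<Sum>j<n. a i j * cosm t i j) * g t \<partial>circ)"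
    by (simp add: sum_distrib_right mult.assoc)
qed

text \<open>The source of all comparisons of Toeplitz matrices: for x = y the symbol is integrated
  against the nonnegative weight |sum x_j exp (i j t)|^2, so pointwise inequalities between symbols
  become inequalities between forms.\<close>

lemma bil_toep:
  assumes "integrable circ g"
  shows "bil n (toep g) x y = (\<integral>t. bil n (cosm t) x y * g t \<partial>circ)"
    and "integrable circ (\<lambda>t. bil n (cosm t) x y * g t)"
  using sum_integral_circ[OF assms, where a = "\<lambda>i j. x i * y j" and n = n]
  by (simp_all add: bil_def mult_ac)

lemma toep_one: "toep (\<lambda>_. 1) j k = (if j = k then 1 else 0)"
  using integral_circ_cos[of "int j - int k"] by (simp add: toep_def cosm_def)

text \<open>Parseval for trigonometric polynomials, read off from the constant symbol 1, whose
  Toeplitz matrix is the identity.\<close>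

lemma integral_bil_cosm: "(\<integral>t. bil n (cosm t) x y \<partial>circ) = dot n x y"
proof -
  have "(\<integral>t. bil n (cosm t) x y \<partial>circ) = bil n (toep (\<lambda>_. 1)) x y"
    using bil_toep(1)[of "\<lambda>_. 1" n x y] by simp
  also have "\<dots> = (\<Sum>i<n. \<Sum>j<n. if i = j then x i * y j else 0)"
    unfolding bil_def toep_one by (intro sum.cong) auto
  also have "\<dots> = dot n x y" by (simp add: dot_def)
  finally show ?thesis .
qed

lemma integrable_bil_cosm: "integrable circ (\<lambda>t. bil n (cosm t) x y)"
  using bil_toep(2)[of "\<lambda>_. 1" n x y] by simp

lemma dot_self: "dot n x x = sqn n x"
  by (simp add: dot_def sqn_def power2_eq_square)

lemma dot_scale: "dot n (\<lambda>i. c * x i) y = c * dot n x y"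
  by (simp add: dot_def sum_distrib_left mult.assoc)

lemma bil_toep_nonneg:
  assumes "integrable circ g" "AE t in circ. 0 \<le> g t"
  shows "0 \<le> bil n (toep g) x x"
  unfolding bil_toep(1)[OF assms(1)]
  using assms(2) by (intro integral_nonneg_AE) (auto simp: bil_cosm_nonneg)

lemma bil_toep_mono:
  assumes "integrable circ g" "integrable circ h" "AE t in circ. g t \<le> h t"
  shows "bil n (toep g) x x \<le> bil n (toep h) x x"
  unfolding bil_toep(1)[OF assms(1)] bil_toep(1)[OF assms(2)]
proof (intro integral_mono_AE bil_toep(2) assms(1,2))
  show "AE t in circ. bil n (cosm t) x x * g t \<le> bil n (cosm t) x x * h t"
    using assms(3) by eventually_elim (intro mult_left_mono bil_cosm_nonneg)
qed

section \<open>Inverses of positive definite matrices in variational form\<close>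

definition is_inv :: "nat \<Rightarrow> (nat \<Rightarrow> nat \<Rightarrow> real) \<Rightarrow> (nat \<Rightarrow> nat \<Rightarrow> real) \<Rightarrow> bool" where
  "is_inv n A B \<longleftrightarrow> (\<forall>i<n. \<forall>k<n. (\<Sum>j<n. A i j * B j k) = (if i = k then 1 else 0))"

definition app :: "nat \<Rightarrow> (nat \<Rightarrow> nat \<Rightarrow> real) \<Rightarrow> (nat \<Rightarrow> real) \<Rightarrow> nat \<Rightarrow> real" where
  "app n B x = (\<lambda>j. \<Sum>k<n. B j k * x k)"

lemma bil_app: "bil n A x y = dot n x (app n A y)"
  by (simp add: bil_def dot_def app_def sum_distrib_left mult_ac)

lemma dot_cong: "(\<And>i. i < n \<Longrightarrow> y i = z i) \<Longrightarrow> dot n x y = dot n x z"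
  by (simp add: dot_def)

lemma app_inv:
  assumes "is_inv n A B" "i < n"
  shows "app n A (app n B x) i = x i"
proof -
  have "app n A (app n B x) i = (\<Sum>k<n. (\<Sum>j<n. A i j * B j k) * x k)"
    unfolding app_def by (rule sum_exchange[where h = "A i" and l = B, simplified])
  also have "\<dots> = (\<Sum>k<n. if i = k then x k else 0)"
    using assms by (intro sum.cong) (auto simp: is_inv_def)
  finally show ?thesis using assms(2) by simp
qed

locale pd_inverse =
  fixes n :: nat and A B :: "nat \<Rightarrow> nat \<Rightarrow> real"
  assumes symA: "sym_mat n A" and posA: "\<And>y. 0 \<le> bil n A y y" and inv: "is_inv n A B"
begin

lemma bil_A_app: "bil n A z (app n B x) = dot n z x"
  unfolding bil_app by (intro dot_cong app_inv[OF inv])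

lemma bil_B: "bil n B x y = bil n A (app n B x) (app n B y)"
proof -
  have "bil n A (app n B x) (app n B y) = bil n A (app n B y) (app n B x)" by (rule bil_sym[OF symA])
  also have "\<dots> = dot n (app n B y) x" by (rule bil_A_app)
  finally show ?thesis by (simp add: bil_app dot_def mult.commute)
qed

lemma symB: "sym_mat n B"
proof -
  have "bil n B x y = bil n B y x" for x y unfolding bil_B by (rule bil_sym[OF symA])
  then have e: "bil n B (\<lambda>l. if l = i then 1 else 0) (\<lambda>l. if l = j then 1 else 0)
    = bil n B (\<lambda>l. if l = j then 1 else 0) (\<lambda>l. if l = i then 1 else 0)" for i j by blast
  show ?thesis unfolding sym_mat_def
  proof (intro allI impI)
    fix i j assume "i < n" "j < n"
    with e[of i j] show "B i j = B j i" by (simp add: bil_unit_left if_distrib cong: if_cong)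
  qed
qed

lemma posB: "0 \<le> bil n B x x"
  unfolding bil_B by (rule posA)

text \<open>Positivity of A at z - A^{-1} x. Equality holds at z = A^{-1} x, so the form of the
  inverse is a supremum over z: any test vector gives a lower bound.\<close>

lemma variational: "2 * dot n z x - bil n A z z \<le> bil n B x x"
proof -
  have "0 \<le> bil n A (\<lambda>i. z i + (-1) * app n B x i) (\<lambda>i. z i + (-1) * app n B x i)" by (rule posA)
  then show ?thesis unfolding bil_quad_add[OF symA] bil_A_app bil_B by simp
qed

lemma variational_eq: "bil n B x x = 2 * dot n (app n B x) x - bil n A (app n B x) (app n B x)"
  using bil_A_app[of "app n B x" x] bil_B[of x x] by simp

end

text \<open>If y is optimal for the inverse of \<open>A'\<close>, then y / K is used as a test
  vector for the inverse of \<open>A\<close>.\<close>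

lemma bil_inv_antimono:
  assumes A: "pd_inverse n A B" and A': "pd_inverse n A' B'" and "0 < K"
    and le: "\<And>x. bil n A x x \<le> K * bil n A' x x"
  shows "bil n B' x x \<le> K * bil n B x x"
proof -
  interpret A: pd_inverse n A B by (rule A)
  interpret A': pd_inverse n A' B' by (rule A')
  define y where "y = app n B' x"
  have "2 * dot n (\<lambda>i. (1 / K) * y i) x - bil n A (\<lambda>i. (1 / K) * y i) (\<lambda>i. (1 / K) * y i) \<le> bil n B x x"
    by (rule A.variational)
  moreover have "dot n (\<lambda>i. (1 / K) * y i) x = dot n y x / K"
    by (simp add: dot_def sum_divide_distrib)
  moreover have "bil n A (\<lambda>i. (1 / K) * y i) (\<lambda>i. (1 / K) * y i) = bil n A y y / K\<^sup>2"
    unfolding bil_scale_left bil_scale_right by (simp add: power2_eq_square)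
  ultimately have "2 * dot n y x / K - bil n A y y / K\<^sup>2 \<le> bil n B x x" by simp
  then have "2 * dot n y x - bil n A y y / K \<le> K * bil n B x x"
    using \<open>0 < K\<close> by (simp add: field_simps power2_eq_square)
  moreover have "bil n A y y / K \<le> bil n A' y y" using le[of y] \<open>0 < K\<close> by (simp add: field_simps)
  moreover have "bil n B' x x = 2 * dot n y x - bil n A' y y" unfolding y_def by (rule A'.variational_eq)
  ultimately show ?thesis by linarith
qed

text \<open>Cauchy-Schwarz with weight g(t), pointwise in t, bounds twice the cross term of x and y
  by the x-form over g plus g times the y-form. Integrating with y = T_n(g)^{-1} x gives 2 <y, x> -
  <y, T_n(g) y> on the left, which is the form of the inverse.\<close>

lemma toep_inv_le:
  assumes inv: "pd_inverse n (toep g) B" and g: "integrable circ g" "integrable circ (\<lambda>t. 1 / g t)"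
    and pos: "AE t in circ. 0 < g t"
  shows "bil n B x x \<le> bil n (toep (\<lambda>t. 1 / g t)) x x"
proof -
  interpret I: pd_inverse n "toep g" B by (rule inv)
  define y where "y = app n B x"
  have "(\<integral>t. 2 * bil n (cosm t) x y \<partial>circ) \<le> (\<integral>t. bil n (cosm t) x x * (1 / g t) + bil n (cosm t) y y * g t \<partial>circ)"
  proof (rule integral_mono_AE)
    show "AE t in circ. 2 * bil n (cosm t) x y \<le> bil n (cosm t) x x * (1 / g t) + bil n (cosm t) y y * g t"
      using pos
    proof eventually_elim
      case (elim t)
      have "2 * g t * bil n (cosm t) x y \<le> bil n (cosm t) x x + (g t)\<^sup>2 * bil n (cosm t) y y"
        by (intro bil_nonneg_CS sym_cosm bil_cosm_nonneg)
      then show ?case using elim by (simp add: field_simps power2_eq_square)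
    qed
    show "integrable circ (\<lambda>t. bil n (cosm t) x x * (1 / g t) + bil n (cosm t) y y * g t)"
      by (intro Bochner_Integration.integrable_add bil_toep(2) g)
    show "integrable circ (\<lambda>t. 2 * bil n (cosm t) x y)"
      by (intro integrable_mult_right integrable_bil_cosm)
  qed
  also have "\<dots> = bil n (toep (\<lambda>t. 1 / g t)) x x + bil n (toep g) y y"
    using bil_toep(2)[OF g(2), of n x x] bil_toep(2)[OF g(1), of n y y]
    by (simp add: bil_toep(1)[OF g(1)] bil_toep(1)[OF g(2)])
  also have "(\<integral>t. 2 * bil n (cosm t) x y \<partial>circ) = 2 * dot n y x"
    by (simp add: integral_bil_cosm) (simp add: dot_def mult.commute)
  finally show ?thesis
    using I.variational_eq[of x] unfolding y_def by linarith
qed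

text \<open>Symbols are even, so Toeplitz matrices are built from cosines alone; this replaces the Fejer
  kernel by its average over \<open>l - t\<close> and \<open>l + t\<close>.\<close>

definition fejer :: "nat \<Rightarrow> real \<Rightarrow> real \<Rightarrow> real" where
  "fejer n l t = (\<Sum>i<n. \<Sum>j<n. cosm l i j * cosm t i j) / real n"

definition fejer_conv :: "nat \<Rightarrow> (real \<Rightarrow> real) \<Rightarrow> real \<Rightarrow> real" where
  "fejer_conv n g l = (\<Sum>i<n. \<Sum>j<n. cosm l i j * toep g i j) / real n"

lemma fejer_conv_integral:
  assumes "integrable circ g"
  shows "fejer_conv n g l = (\<integral>t. fejer n l t * g t \<partial>circ)" and "integrable circ (\<lambda>t. fejer n l t * g t)"
  using sum_integral_circ[OF assms, where a = "cosm l" and n = n]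
  by (simp_all add: fejer_conv_def fejer_def)

lemma fejer_conv_one:
  assumes "0 < n"
  shows "fejer_conv n (\<lambda>_. 1) l = 1"
  using assms unfolding fejer_conv_def toep_one by (simp add: if_distrib cosm_def cong: if_cong)

lemma sum_mult_cosm:
  "(\<Sum>i<n. \<Sum>j<n. A i j * cosm l i j)
    = bil n A (\<lambda>j. cos (real j * l)) (\<lambda>j. cos (real j * l)) + bil n A (\<lambda>j. sin (real j * l)) (\<lambda>j. sin (real j * l))"
  by (simp add: bil_def cosm_def sum.distrib[symmetric] left_diff_distrib cos_diff algebra_simps)

lemma toep_inv_trace_upper:
  assumes "pd_inverse n (toep g) B" "integrable circ g" "integrable circ (\<lambda>t. 1 / g t)" "AE t in circ. 0 < g t"
  shows "(\<Sum>i<n. \<Sum>j<n. B i j * cosm l i j) / real n \<le> fejer_conv n (\<lambda>t. 1 / g t) l"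
proof -
  have "(\<Sum>i<n. \<Sum>j<n. B i j * cosm l i j) \<le> (\<Sum>i<n. \<Sum>j<n. toep (\<lambda>t. 1 / g t) i j * cosm l i j)"
    unfolding sum_mult_cosm by (intro add_mono toep_inv_le assms)
  then show ?thesis unfolding fejer_conv_def by (intro divide_right_mono) (simp_all add: mult.commute)
qed

text \<open>The test vectors are the cosine and sine vectors divided by F =
  \<open>fejer_conv n g l\<close>. Among scalar multiples c the sum of the two bounds is 2 c n - c^2
  n F, maximal at c = 1 / F.\<close>

lemma toep_inv_trace_lower:
  assumes "pd_inverse n (toep g) B" "0 < n" "0 < fejer_conv n g l"
  shows "1 / fejer_conv n g l \<le> (\<Sum>i<n. \<Sum>j<n. B i j * cosm l i j) / real n"
proof -
  interpret I: pd_inverse n "toep g" B by (rule assms(1))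
  define F where "F = fejer_conv n g l"
  define c where "c j = cos (real j * l)" for j :: nat
  define s where "s j = sin (real j * l)" for j :: nat
  have F: "bil n (toep g) c c + bil n (toep g) s s = real n * F"
    using assms(2) sum_mult_cosm[where n = n and A = "toep g" and l = l]
    by (simp add: F_def fejer_conv_def c_def[abs_def] s_def[abs_def] mult.commute)
  have one: "dot n c c + dot n s s = real n"
    by (simp add: dot_def c_def s_def sum.distrib[symmetric] power2_eq_square[symmetric])
  have "2 * ((1 / F) * dot n x x) - (1 / F)\<^sup>2 * bil n (toep g) x x \<le> bil n B x x" for x
    using I.variational[of "\<lambda>i. (1 / F) * x i" x]
    unfolding bil_scale_left bil_scale_right dot_scale by (simp add: power2_eq_square)
  from add_mono[OF this[of c] this[of s]]
  have "2 * ((1 / F) * (dot n c c + dot n s s)) - (1 / F)\<^sup>2 * (bil n (toep g) c c + bil n (toep g) s s)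
     \<le> bil n B c c + bil n B s s"
    by (simp add: algebra_simps)
  then have "real n / F \<le> bil n B c c + bil n B s s"
    unfolding one F using assms(3) by (simp add: F_def power2_eq_square field_simps)
  also have "\<dots> = (\<Sum>i<n. \<Sum>j<n. B i j * cosm l i j)"
    unfolding sum_mult_cosm c_def[abs_def] s_def[abs_def] ..
  finally show ?thesis using assms(2) by (simp add: F_def field_simps)
qed

section \<open>Fejer means and power bounds\<close>

lemma mult_cos_le_sin:
  assumes "0 \<le> z" "z \<le> pi"
  shows "z * cos z \<le> sin z"
proof -
  have "sin 0 - 0 * cos 0 \<le> sin z - z * cos z"
  proof (rule DERIV_nonneg_imp_nondecreasing[OF assms(1)])
    fix x assume x: "0 \<le> x" "x \<le> z"
    have "((\<lambda>z. sin z - z * cos z) has_real_derivative x * sin x) (at x)"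
      by (auto intro!: derivative_eq_intros)
    moreover have "0 \<le> x * sin x" using x assms by (intro mult_nonneg_nonneg sin_ge_zero) auto
    ultimately show "\<exists>y. ((\<lambda>z. sin z - z * cos z) has_real_derivative y) (at x) \<and> 0 \<le> y" by blast
  qed
  then show ?thesis by simp
qed

text \<open>A crude Jordan inequality: sin y = 2 sin (y/2) cos (y/2) is at least y cos^2 (y/2) = y
  (1 + cos y) / 2.\<close>

lemma half_le_sin:
  assumes "0 \<le> y" "y \<le> pi / 2"
  shows "y / 2 \<le> sin y"
proof -
  have "y / 2 * cos (y / 2) \<le> sin (y / 2)" using assms by (intro mult_cos_le_sin) auto
  moreover have c: "0 \<le> cos (y / 2)" using assms by (intro cos_ge_zero) auto
  ultimately have "2 * (y / 2 * cos (y / 2)) * cos (y / 2) \<le> 2 * sin (y / 2) * cos (y / 2)"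
    by (intro mult_right_mono) auto
  also have "\<dots> = sin y" using sin_double[of "y / 2"] by simp
  finally have "y * (cos (y / 2))\<^sup>2 \<le> sin y" by (simp add: power2_eq_square)
  moreover have "2 * (cos (y / 2))\<^sup>2 = 1 + cos y" using cos_double_cos[of "y / 2"] by simp
  then have "y * (2 * (cos (y / 2))\<^sup>2) = y * (1 + cos y)" by (simp only:)
  then have "2 * (y * (cos (y / 2))\<^sup>2) = y + y * cos y" by (simp add: algebra_simps)
  moreover have "0 \<le> y * cos y" using assms by (intro mult_nonneg_nonneg cos_ge_zero) auto
  ultimately show ?thesis by linarith
qed

text \<open>The minimum is the distance from x to the multiples of 2 pi.\<close>

lemma abs_sin_half_ge:
  assumes "\<bar>x\<bar> \<le> 2 * pi"
  shows "min \<bar>x\<bar> (2 * pi - \<bar>x\<bar>) / 4 \<le> \<bar>sin (x / 2)\<bar>"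
proof -
  define y where "y = \<bar>x\<bar> / 2"
  have y: "0 \<le> y" "y \<le> pi" using assms by (auto simp: y_def)
  have "\<bar>sin (x / 2)\<bar> = \<bar>sin y\<bar>" unfolding y_def by (cases "0 \<le> x") auto
  also have "\<dots> = sin y" using y by (simp add: sin_ge_zero)
  finally have s: "\<bar>sin (x / 2)\<bar> = sin y" .
  have "min y (pi - y) / 2 \<le> sin y"
  proof (cases "y \<le> pi / 2")
    case True
    then show ?thesis using half_le_sin[of y] y by (simp add: min_def)
  next
    case False
    then show ?thesis using half_le_sin[of "pi - y"] y by (simp add: min_def)
  qed
  then show ?thesis unfolding s by (simp add: y_def min_def split: if_splits)
qed

definition fejer_kernel :: "nat \<Rightarrow> real \<Rightarrow> real" where
  "fejer_kernel n x = (\<Sum>i<n. \<Sum>j<n. cosm x i j) / real n"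

lemma fejer_kernel_bil: "fejer_kernel n x = bil n (cosm x) (\<lambda>_. 1) (\<lambda>_. 1) / real n"
  by (simp add: fejer_kernel_def bil_def)

lemma fejer_kernel_nonneg: "0 \<le> fejer_kernel n x"
  by (simp add: fejer_kernel_bil bil_cosm_nonneg)

lemma fejer_kernel_le: "fejer_kernel n x \<le> real n"
  using bil_cosm_le[of n x "\<lambda>_. 1"]
  by (cases "n = 0") (auto simp: fejer_kernel_bil sqn_def field_simps)

lemma cmod_one_minus_cis: "(cmod (1 - cis x))\<^sup>2 = 4 * (sin (x / 2))\<^sup>2"
proof -
  have "(cmod (1 - cis x))\<^sup>2 = 2 - 2 * cos x"
    unfolding cmod_power2 using sin_cos_squared_add[of x] by (simp add: power2_eq_square algebra_simps)
  then show ?thesis using cos_double_sin[of "x / 2"] by simp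
qed

text \<open>The geometric sum S = sum exp (i j x) satisfies |1 - exp (i x)| |S| <= 2, and n times
  the kernel is |S|^2. The product form avoids dividing by a sine that may vanish.\<close>

lemma fejer_kernel_sin: "(sin (x / 2))\<^sup>2 * fejer_kernel n x \<le> 1 / real n"
proof -
  define S where "S = (\<Sum>j<n. cis (real j * x))"
  have "(1 - cis x) * S = 1 - cis (real n * x)"
  proof -
    have "S = (\<Sum>j<n. cis x ^ j)" unfolding S_def by (intro sum.cong refl Complex.DeMoivre[symmetric])
    then show ?thesis using one_diff_power_eq[of "cis x" n] by (simp add: Complex.DeMoivre)
  qed
  then have "cmod (1 - cis x) * cmod S = cmod (1 - cis (real n * x))" by (metis norm_mult)
  also have "\<dots> \<le> 2" using norm_triangle_ineq4[of 1 "cis (real n * x)"] by simp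
  finally have "(cmod (1 - cis x) * cmod S)\<^sup>2 \<le> 2\<^sup>2" by (intro power_mono) auto
  moreover note cmod_one_minus_cis
  moreover have "(cmod S)\<^sup>2 = bil n (cosm x) (\<lambda>_. 1) (\<lambda>_. 1)"
    by (simp add: S_def cmod_power2 bil_cosm)
  ultimately have "(sin (x / 2))\<^sup>2 * bil n (cosm x) (\<lambda>_. 1) (\<lambda>_. 1) \<le> 1" by (simp add: power_mult_distrib)
  then show ?thesis unfolding fejer_kernel_bil by (simp add: divide_right_mono)
qed

lemma fejer_eq: "fejer n l t = (fejer_kernel n (l - t) + fejer_kernel n (l + t)) / 2"
proof -
  have "cosm l i j * cosm t i j = (cosm (l - t) i j + cosm (l + t) i j) / 2" for i j
    by (simp add: cosm_def cos_times_cos right_diff_distrib distrib_left)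
  then show ?thesis
    by (simp add: fejer_def fejer_kernel_def sum.distrib sum_divide_distrib[symmetric] add_divide_distrib)
qed

lemma fejer_nonneg: "0 \<le> fejer n l t"
  by (simp add: fejer_eq fejer_kernel_nonneg)

lemma fejer_abs: "fejer n \<bar>l\<bar> t = fejer n l t"
proof (cases "0 \<le> l")
  case False
  have "cosm (- l) = cosm l" by (intro ext) (simp add: cosm_def)
  then show ?thesis using False by (simp add: fejer_def)
qed simp

text \<open>The second bound is the geometric mean of the first and of the trivial bound n. Being
  independent of n, it serves for domination, while the first gives convergence.\<close>

lemma fejer_kernel_away:
  assumes "0 < m" "m \<le> \<bar>x\<bar>" "\<bar>x\<bar> \<le> 2 * pi - m"
  shows "fejer_kernel n x \<le> 16 / (m\<^sup>2 * real n)" and "0 < n \<Longrightarrow> fejer_kernel n x \<le> 4 / m"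
proof -
  define s where "s = m / 4"
  have s: "0 < s" "s\<^sup>2 \<le> (sin (x / 2))\<^sup>2"
  proof -
    have "s \<le> \<bar>sin (x / 2)\<bar>" using abs_sin_half_ge[of x] assms by (simp add: s_def min_def split: if_splits)
    then have "s\<^sup>2 \<le> \<bar>sin (x / 2)\<bar>\<^sup>2" using assms by (intro power_mono) (auto simp: s_def)
    then show "s\<^sup>2 \<le> (sin (x / 2))\<^sup>2" by simp
  qed (use assms in \<open>simp add: s_def\<close>)
  have "s\<^sup>2 * fejer_kernel n x \<le> (sin (x / 2))\<^sup>2 * fejer_kernel n x"
    by (intro mult_right_mono s fejer_kernel_nonneg)
  also note fejer_kernel_sin
  finally have *: "s\<^sup>2 * fejer_kernel n x \<le> 1 / real n" .
  then have "fejer_kernel n x \<le> (1 / real n) / s\<^sup>2" using s by (subst pos_le_divide_eq) (simp_all add: mult.commute)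
  also have "\<dots> = 16 / (m\<^sup>2 * real n)" using assms by (simp add: s_def power2_eq_square)
  finally show "fejer_kernel n x \<le> 16 / (m\<^sup>2 * real n)" .
  assume n: "0 < n"
  have "(s * fejer_kernel n x)\<^sup>2 = (s\<^sup>2 * fejer_kernel n x) * fejer_kernel n x" by (simp add: power2_eq_square)
  also have "\<dots> \<le> (1 / real n) * real n"
    using * by (intro mult_mono fejer_kernel_le) (auto simp: fejer_kernel_nonneg)
  also have "\<dots> = 1\<^sup>2" using n by simp
  finally have "s * fejer_kernel n x \<le> 1" by (rule power2_le_imp_le) simp
  then show "fejer_kernel n x \<le> 4 / m" using assms by (simp add: s_def field_simps)
qed

text \<open>Near |l| continuity controls the difference and the Fejer kernel has mass 1; elsewhere
  the kernel is O(1/n) against an integrable function. The symbol may thus be unbounded away from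
  |l|.\<close>

lemma fejer_conv_tendsto:
  assumes g: "integrable circ g" and even: "\<And>t. g (- t) = g t"
    and l: "0 < \<bar>l\<bar>" "\<bar>l\<bar> < pi" and cont: "isCont g \<bar>l\<bar>"
  shows "(\<lambda>n. fejer_conv n g l) \<longlonglongrightarrow> g l"
proof (rule LIMSEQ_I)
  fix r :: real assume r: "0 < r"
  have gabs: "g \<bar>t\<bar> = g t" for t using even[of t] by (cases "0 \<le> t") auto
  define L where "L = \<bar>l\<bar>"
  obtain d where d: "0 < d" "\<And>t. \<bar>t - L\<bar> < d \<Longrightarrow> \<bar>g t - g L\<bar> < r / 2"
    using cont[unfolded continuous_at_eps_delta, rule_format, of "r / 2"] r by (auto simp: dist_real_def L_def)
  \<comment> \<open>The bound \<open>pi - L\<close> keeps l + t away from 2 pi, the other zero of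
    the denominator of the kernel.\<close>
  define m where "m = min d (pi - L)"
  have m: "0 < m" "m \<le> d" "m \<le> pi - L" using d l by (auto simp: m_def L_def)
  define K where "K = (\<integral>t. \<bar>g t\<bar> + \<bar>g L\<bar> \<partial>circ)"
  have K: "0 \<le> K" unfolding K_def by (intro integral_nonneg_AE) auto
  have bound: "norm (fejer_conv n g l - g l) \<le> r / 2 + 16 / (m\<^sup>2 * real n) * K" if n: "0 < n" for n
  proof -
    have one: "(\<integral>t. fejer n l t \<partial>circ) = 1" "integrable circ (\<lambda>t. fejer n l t)"
      using fejer_conv_integral[of "\<lambda>_. 1" n l] fejer_conv_one[OF n] by simp_all
    have "fejer_conv n g l - g l = (\<integral>t. fejer n l t * g t - fejer n l t * g l \<partial>circ)"
      using fejer_conv_integral[OF g, of n l] one by simp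
    also have "norm \<dots> \<le> (\<integral>t. norm (fejer n l t * g t - fejer n l t * g l) \<partial>circ)"
      by (rule integral_norm_bound)
    also have "\<dots> \<le> (\<integral>t. r / 2 * fejer n l t + 16 / (m\<^sup>2 * real n) * (\<bar>g t\<bar> + \<bar>g L\<bar>) \<partial>circ)"
    proof (intro integral_mono_AE AE_circI)
      show "integrable circ (\<lambda>t. norm (fejer n l t * g t - fejer n l t * g l))"
        using fejer_conv_integral(2)[OF g, of n l] one by (intro integrable_norm Bochner_Integration.integrable_diff) auto
      show "integrable circ (\<lambda>t. r / 2 * fejer n l t + 16 / (m\<^sup>2 * real n) * (\<bar>g t\<bar> + \<bar>g L\<bar>))"
        using g one by (intro Bochner_Integration.integrable_add integrable_mult_right) auto
      fix t assume t: "- pi \<le> t" "t \<le> pi"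
      have e: "norm (fejer n l t * g t - fejer n l t * g l) = fejer n l t * \<bar>g t - g l\<bar>"
        by (simp add: right_diff_distrib[symmetric] abs_mult fejer_nonneg)
      show "norm (fejer n l t * g t - fejer n l t * g l)
        \<le> r / 2 * fejer n l t + 16 / (m\<^sup>2 * real n) * (\<bar>g t\<bar> + \<bar>g L\<bar>)"
      proof (cases "\<bar>\<bar>t\<bar> - L\<bar> < d")
        case True
        then have "\<bar>g t - g l\<bar> \<le> r / 2" using d(2)[of "\<bar>t\<bar>"] gabs[of l] by (simp add: gabs L_def)
        then have "fejer n l t * \<bar>g t - g l\<bar> \<le> r / 2 * fejer n l t"
          by (subst mult.commute) (intro mult_right_mono fejer_nonneg)
        then show ?thesis unfolding e by (intro add_increasing2) simp_all
      next
        case False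
        have "fejer_kernel n (L - t) \<le> 16 / (m\<^sup>2 * real n)" "fejer_kernel n (L + t) \<le> 16 / (m\<^sup>2 * real n)"
          using False m t l by (auto intro!: fejer_kernel_away simp: L_def abs_real_def split: if_splits)
        then have "fejer n l t \<le> 16 / (m\<^sup>2 * real n)"
          using fejer_abs[of n l t, folded L_def] unfolding fejer_eq by simp
        moreover have "\<bar>g t - g l\<bar> \<le> \<bar>g t\<bar> + \<bar>g L\<bar>" by (simp add: L_def gabs)
        ultimately have "fejer n l t * \<bar>g t - g l\<bar> \<le> 16 / (m\<^sup>2 * real n) * (\<bar>g t\<bar> + \<bar>g L\<bar>)"
          by (intro mult_mono) (auto simp: fejer_nonneg)
        moreover have "0 \<le> r / 2 * fejer n l t" using r by (simp add: fejer_nonneg)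
        ultimately show ?thesis unfolding e by simp
      qed
    qed
    also have "\<dots> = r / 2 + 16 / (m\<^sup>2 * real n) * K"
      unfolding K_def using g one
      by (subst Bochner_Integration.integral_add) (auto simp del: integral_add)
    finally show ?thesis .
  qed
  have "(\<lambda>n. 16 / (m\<^sup>2 * real n) * K) \<longlonglongrightarrow> 0"
    using m by real_asymp
  then have "\<forall>\<^sub>F n in sequentially. 16 / (m\<^sup>2 * real n) * K < r / 2"
    using r by (intro order_tendstoD) auto
  then have "\<forall>\<^sub>F n in sequentially. norm (fejer_conv n g l - g l) < r"
    using eventually_gt_at_top[of 0]
  proof eventually_elim
    case (elim n)
    then show ?case using bound[of n] by simp
  qed
  then show "\<exists>no. \<forall>n\<ge>no. norm (fejer_conv n g l - g l) < r" by (simp add: eventually_sequentially)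
qed

section \<open>Symbols with a power singularity: norms and Fejer means\<close>

lemma integrable_circ_powr:
  assumes "b < 1"
  shows "integrable circ (\<lambda>t. \<bar>t\<bar> powr (- b))"
proof (rule integrable_circI)
  let ?h = "\<lambda>t::real. indicator {0..pi} t *\<^sub>R (t powr (- b))"
  have "(\<lambda>t. t powr (- b)) integrable_on {0..pi}"
    using assms by (intro integrable_on_powr_from_0) auto
  then have "(\<lambda>t. t powr (- b)) absolutely_integrable_on {0..pi}"
    by (intro nonnegative_absolutely_integrable_1) auto
  then have h: "integrable lborel ?h"
    unfolding set_integrable_def by (subst (asm) integrable_completion) auto
  from lborel_integrable_real_affine[OF h, of "-1" 0] have h': "integrable lborel (\<lambda>t. ?h (- t))" by simp
  show "set_integrable lborel {-pi..pi} (\<lambda>t. \<bar>t\<bar> powr (- b))"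
    unfolding set_integrable_def
  proof (rule Bochner_Integration.integrable_bound)
    show "integrable lborel (\<lambda>t. ?h t + ?h (- t))" using h h' by (rule Bochner_Integration.integrable_add)
    show "AE t in lborel. norm (indicator {-pi..pi} t *\<^sub>R \<bar>t\<bar> powr (- b)) \<le> norm (?h t + ?h (- t))"
      by (intro AE_I2) (auto simp: indicator_def abs_real_def)
  qed measurable
qed measurable

lemma integrable_circ_bounded:
  assumes "h \<in> borel_measurable borel" "\<And>t. t \<noteq> 0 \<Longrightarrow> \<bar>t\<bar> \<le> pi \<Longrightarrow> 0 \<le> h t \<and> h t \<le> C * \<bar>t\<bar> powr (- c)" "c < 1"
  shows "integrable circ h"
proof (rule Bochner_Integration.integrable_bound)
  show "integrable circ (\<lambda>t. C * \<bar>t\<bar> powr (- c))" by (intro integrable_mult_right integrable_circ_powr assms)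
  show "AE t in circ. norm (h t) \<le> norm (C * \<bar>t\<bar> powr (- c))"
    using assms(2) by (intro AE_circI) (force simp: abs_le_iff)
qed (use assms in simp)

definition powr_mean :: "real \<Rightarrow> real" where
  "powr_mean b = (\<integral>t. \<bar>t\<bar> powr (- b) \<partial>circ)"

lemma powr_mean_nonneg: "0 \<le> powr_mean b"
  unfolding powr_mean_def by (intro integral_nonneg_AE) auto

text \<open>Split at |t| = 1/n. Outside, |t|^(-a) is at most n^a and Parseval applies; inside, the
  trigonometric weight is at most n |x|^2 and |t|^(-a) is at most n^(a - b) |t|^(-b), which is
  integrable. Taking b close to 1 brings the exponent close to a.\<close>

lemma toep_norm_le:
  assumes g: "integrable circ g" "AE t in circ. g t \<le> C * \<bar>t\<bar> powr (- a)"
    and "0 \<le> a" "a \<le> b" "b < 1" "0 \<le> C" "0 < n"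
  shows "bil n (toep g) x x \<le> C * (1 + powr_mean b) * real n powr (a + (1 - b)) * sqn n x"
proof -
  define N where "N = real n"
  have N: "1 \<le> N" using \<open>0 < n\<close> by (simp add: N_def)
  note ib = integrable_circ_powr[OF \<open>b < 1\<close>]
  have pw: "\<bar>t\<bar> powr (- a) \<le> N powr a + N powr (a - b) * \<bar>t\<bar> powr (- b)" if "t \<noteq> 0" for t
  proof (cases "1 / N \<le> \<bar>t\<bar>")
    case True
    have "\<bar>t\<bar> powr (- a) = (1 / \<bar>t\<bar>) powr a" using that by (simp add: powr_minus powr_divide field_simps)
    also have "\<dots> \<le> N powr a" using True N that \<open>0 \<le> a\<close> by (intro powr_mono2) (auto simp: field_simps)
    finally show ?thesis by (simp add: add_increasing2)
  next
    case False
    have "\<bar>t\<bar> powr (- a) = \<bar>t\<bar> powr (b - a) * \<bar>t\<bar> powr (- b)" by (simp add: powr_add[symmetric])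
    also have "\<dots> \<le> (1 / N) powr (b - a) * \<bar>t\<bar> powr (- b)"
      using False \<open>a \<le> b\<close> by (intro mult_right_mono powr_mono2) auto
    also have "(1 / N) powr (b - a) = N powr (a - b)" using N by (simp add: powr_divide powr_minus[symmetric] powr_diff)
    finally show ?thesis by (simp add: add_increasing)
  qed
  have "bil n (toep g) x x = (\<integral>t. bil n (cosm t) x x * g t \<partial>circ)" by (rule bil_toep(1)[OF g(1)])
  also have "\<dots> \<le> (\<integral>t. C * N powr a * bil n (cosm t) x x + C * N powr (a - b) * N * sqn n x * \<bar>t\<bar> powr (- b) \<partial>circ)"
  proof (rule integral_mono_AE)
    show "integrable circ (\<lambda>t. C * N powr a * bil n (cosm t) x x + C * N powr (a - b) * N * sqn n x * \<bar>t\<bar> powr (- b))"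
      by (intro Bochner_Integration.integrable_add integrable_mult_right integrable_bil_cosm ib)
    have "AE t in circ. t \<noteq> 0" by (rule AE_circI)
    with g(2) show "AE t in circ. bil n (cosm t) x x * g t
      \<le> C * N powr a * bil n (cosm t) x x + C * N powr (a - b) * N * sqn n x * \<bar>t\<bar> powr (- b)"
    proof eventually_elim
      case (elim t)
      let ?B = "bil n (cosm t) x x"
      have "g t \<le> C * (N powr a + N powr (a - b) * \<bar>t\<bar> powr (- b))"
        using elim pw[of t] \<open>0 \<le> C\<close> by (meson mult_left_mono order_trans)
      then have "?B * g t \<le> ?B * (C * (N powr a + N powr (a - b) * \<bar>t\<bar> powr (- b)))"
        by (intro mult_left_mono bil_cosm_nonneg)
      also have "\<dots> = C * N powr a * ?B + C * N powr (a - b) * \<bar>t\<bar> powr (- b) * ?B" by (simp add: algebra_simps)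
      also have "\<dots> \<le> C * N powr a * ?B + C * N powr (a - b) * \<bar>t\<bar> powr (- b) * (N * sqn n x)"
        using bil_cosm_le[of n t x] \<open>0 \<le> C\<close> by (intro add_left_mono mult_left_mono) (auto simp: N_def)
      finally show ?case by (simp add: mult_ac)
    qed
  qed (rule bil_toep(2)[OF g(1)])
  also have "\<dots> = C * N powr a * sqn n x + C * N powr (a - b) * N * sqn n x * powr_mean b"
    unfolding powr_mean_def using integrable_bil_cosm ib
    by (subst Bochner_Integration.integral_add) (auto simp: integral_bil_cosm dot_self)
  also have "\<dots> = C * sqn n x * N powr a + C * sqn n x * powr_mean b * N powr (a + (1 - b))"
    using N by (simp add: powr_add powr_diff mult_ac)
  also have "\<dots> \<le> C * sqn n x * N powr (a + (1 - b)) + C * sqn n x * powr_mean b * N powr (a + (1 - b))"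
    using N \<open>0 \<le> C\<close> \<open>b < 1\<close> by (intro add_right_mono mult_left_mono powr_mono) (auto simp: sqn_nonneg)
  finally show ?thesis by (simp add: N_def algebra_simps)
qed

text \<open>Split at |t| = |l| / 2. Outside, the symbol is of order |l|^(-a) and the kernel has mass
  1; inside, the kernel is at most 8 / |l| for every n, and |t|^(-a) is at most |l|^(b - a)
  |t|^(-b). The bound is uniform in n at the price of the extra exponent 1 - b.\<close>

lemma fejer_conv_le:
  assumes w: "integrable circ w" "\<And>t. t \<noteq> 0 \<Longrightarrow> \<bar>t\<bar> \<le> pi \<Longrightarrow> w t \<le> C * \<bar>t\<bar> powr (- a)"
    and "0 \<le> a" "a \<le> b" "b < 1" "0 \<le> C" "0 < n" and l: "l \<noteq> 0" "\<bar>l\<bar> \<le> pi"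
  shows "fejer_conv n w l \<le> C * (2 powr a * pi powr (1 - b) + 8 * powr_mean b) * \<bar>l\<bar> powr (- (a + (1 - b)))"
proof -
  define L where "L = \<bar>l\<bar>"
  have L: "0 < L" "L \<le> pi" using l by (auto simp: L_def)
  note ib = integrable_circ_powr[OF \<open>b < 1\<close>]
  have one: "(\<integral>t. fejer n l t \<partial>circ) = 1" "integrable circ (\<lambda>t. fejer n l t)"
    using fejer_conv_integral[of "\<lambda>_. 1" n l] fejer_conv_one[OF \<open>0 < n\<close>] by simp_all
  define A where "A = C * (2 powr a * L powr (- a))"
  define D where "D = 8 * C * L powr (b - a - 1)"
  have "fejer_conv n w l = (\<integral>t. fejer n l t * w t \<partial>circ)" by (rule fejer_conv_integral(1)[OF w(1)])
  also have "\<dots> \<le> (\<integral>t. A * fejer n l t + D * \<bar>t\<bar> powr (- b) \<partial>circ)"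
  proof (intro integral_mono_AE AE_circI)
    show "integrable circ (\<lambda>t. A * fejer n l t + D * \<bar>t\<bar> powr (- b))"
      by (intro Bochner_Integration.integrable_add integrable_mult_right one ib)
    show "integrable circ (\<lambda>t. fejer n l t * w t)" by (rule fejer_conv_integral(2)[OF w(1)])
    fix t assume t: "- pi \<le> t" "t \<le> pi" "t \<noteq> 0"
    have wt: "w t \<le> C * \<bar>t\<bar> powr (- a)" using w(2) t by auto
    show "fejer n l t * w t \<le> A * fejer n l t + D * \<bar>t\<bar> powr (- b)"
    proof (cases "L / 2 \<le> \<bar>t\<bar>")
      case True
      have "\<bar>t\<bar> powr (- a) \<le> (L / 2) powr (- a)"
        using True L \<open>0 \<le> a\<close> by (intro powr_mono2') auto
      also have "\<dots> = 2 powr a * L powr (- a)" using L by (simp add: powr_divide powr_minus field_simps)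
      finally have "w t \<le> A" unfolding A_def using wt \<open>0 \<le> C\<close> by (meson mult_left_mono order_trans)
      then have "fejer n l t * w t \<le> fejer n l t * A" by (intro mult_left_mono fejer_nonneg)
      moreover have "0 \<le> D * \<bar>t\<bar> powr (- b)" using \<open>0 \<le> C\<close> by (simp add: D_def)
      ultimately show ?thesis by (simp add: mult.commute)
    next
      case False
      have "fejer_kernel n x \<le> 4 / (L / 2)" if "L / 2 \<le> \<bar>x\<bar>" "\<bar>x\<bar> \<le> 2 * pi - L / 2" for x
        using that L \<open>0 < n\<close> by (intro fejer_kernel_away(2)) auto
      from this[of "L - t"] this[of "L + t"]
      have "fejer_kernel n (L - t) \<le> 4 / (L / 2)" "fejer_kernel n (L + t) \<le> 4 / (L / 2)"
        using False L by linarith+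
      then have F: "fejer n l t \<le> 8 / L"
        using fejer_abs[of n l t, folded L_def] unfolding fejer_eq by simp
      have "\<bar>t\<bar> powr (- a) = \<bar>t\<bar> powr (b - a) * \<bar>t\<bar> powr (- b)" by (simp add: powr_add[symmetric])
      also have "\<dots> \<le> L powr (b - a) * \<bar>t\<bar> powr (- b)"
        using False \<open>a \<le> b\<close> L by (intro mult_right_mono powr_mono2) auto
      finally have W: "w t \<le> C * (L powr (b - a) * \<bar>t\<bar> powr (- b))"
        using wt \<open>0 \<le> C\<close> by (meson mult_left_mono order_trans)
      have "fejer n l t * w t \<le> fejer n l t * (C * (L powr (b - a) * \<bar>t\<bar> powr (- b)))"
        by (intro mult_left_mono W fejer_nonneg)
      also have "\<dots> \<le> 8 / L * (C * (L powr (b - a) * \<bar>t\<bar> powr (- b)))"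
        using \<open>0 \<le> C\<close> by (intro mult_right_mono F) auto
      also have "\<dots> = D * \<bar>t\<bar> powr (- b)" using L by (simp add: D_def powr_diff mult_ac)
      finally show ?thesis using \<open>0 \<le> C\<close> fejer_nonneg[of n l t] by (simp add: A_def add_increasing)
    qed
  qed
  also have "\<dots> = A + D * powr_mean b"
    unfolding powr_mean_def using one ib by (subst Bochner_Integration.integral_add) auto
  also have "\<dots> \<le> C * (2 powr a * (pi powr (1 - b) * L powr (- (a + (1 - b))))) + 8 * C * L powr (- (a + (1 - b))) * powr_mean b"
  proof (intro add_mono)
    have "L powr (- a) = L powr (1 - b) * L powr (- (a + (1 - b)))" by (simp add: powr_add[symmetric])
    also have "\<dots> \<le> pi powr (1 - b) * L powr (- (a + (1 - b)))"
      using L \<open>b < 1\<close> by (intro mult_right_mono powr_mono2) auto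
    finally show "A \<le> C * (2 powr a * (pi powr (1 - b) * L powr (- (a + (1 - b)))))"
      unfolding A_def using \<open>0 \<le> C\<close> by (intro mult_left_mono) auto
    have "b - a - 1 = - (a + (1 - b))" by simp
    then have "D = 8 * C * L powr (- (a + (1 - b)))" unfolding D_def by (simp only:)
    then show "D * powr_mean b \<le> 8 * C * L powr (- (a + (1 - b))) * powr_mean b" by simp
  qed
  also have "\<dots> = C * (2 powr a * pi powr (1 - b) + 8 * powr_mean b) * L powr (- (a + (1 - b)))"
    by (simp add: algebra_simps)
  finally show ?thesis by (simp add: L_def)
qed

section \<open>Convergence of Toeplitz quadratic forms\<close>

text \<open>Existence of \<open>B\<close> excludes the failure value of the Gauss-Jordan algorithm,
  and uniqueness of inverses pins down its result.\<close>

lemma is_inv_mat_inverse: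
  fixes T :: "'b::field mat"
  assumes T: "T \<in> carrier_mat n n" and B: "B \<in> carrier_mat n n" and TB: "T * B = 1\<^sub>m n"
  shows "mat_inverse T = Some B"
proof (cases "mat_inverse T")
  case None
  have "B * T = 1\<^sub>m n" by (rule mat_mult_left_right_inverse[OF T B TB])
  then have "T \<in> Units (ring_mat TYPE('b) n ())"
    unfolding Units_def using T B TB by (auto simp: ring_mat_simps)
  then show ?thesis using mat_inverse(1)[OF T None, where b = "()"] by blast
next
  case (Some B')
  then have B': "B' * T = 1\<^sub>m n" "B' \<in> carrier_mat n n" using mat_inverse(2)[OF T Some] by auto
  have "B' = B' * (T * B)" using TB B' by simp
  also have "\<dots> = (B' * T) * B" by (rule assoc_mult_mat[symmetric, OF B'(2) T B])
  also have "\<dots> = B" using B' B by simp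
  finally show ?thesis using Some by simp
qed

text \<open>\<open>c\<close> stands for the embedding of the reals into the complex numbers; as a
  ring homomorphism it carries a real inverse to one of the complex Toeplitz matrix.\<close>

lemma mat_mult_is_inv:
  fixes c :: "real \<Rightarrow> 'b::comm_ring_1"
  assumes "is_inv n A B" and c: "\<And>x y. c (x * y) = c x * c y" "\<And>x y. c (x + y) = c x + c y" "c 0 = 0" "c 1 = 1"
  shows "mat n n (\<lambda>(j, k). c (A j k)) * mat n n (\<lambda>(j, k). c (B j k)) = 1\<^sub>m n"
proof (rule eq_matI)
  fix i k assume "i < dim_row (1\<^sub>m n :: 'b mat)" "k < dim_col (1\<^sub>m n :: 'b mat)"
  then have ik: "i < n" "k < n" by auto
  have sum: "c (\<Sum>j\<in>J. h j) = (\<Sum>j\<in>J. c (h j))" if "finite J" for J :: "nat set" and h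
    using that by induction (simp_all add: c)
  have "(mat n n (\<lambda>(j, k). c (A j k)) * mat n n (\<lambda>(j, k). c (B j k))) $$ (i, k) = (\<Sum>j<n. c (A i j) * c (B j k))"
    using ik by (simp add: scalar_prod_def lessThan_atLeast0)
  also have "\<dots> = c (\<Sum>j<n. A i j * B j k)" by (simp add: sum c)
  also have "\<dots> = 1\<^sub>m n $$ (i, k)" using assms(1) ik by (simp add: is_inv_def c)
  finally show "(mat n n (\<lambda>(j, k). c (A j k)) * mat n n (\<lambda>(j, k). c (B j k))) $$ (i, k) = 1\<^sub>m n $$ (i, k)" .
qed auto

lemma ex_is_inv:
  assumes "\<And>x i. bil n A x x = 0 \<Longrightarrow> i < n \<Longrightarrow> x i = 0"
  shows "\<exists>B. is_inv n A B"
proof -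
  define T where "T = mat n n (\<lambda>(i, j). A i j)"
  have T: "T \<in> carrier_mat n n" by (simp add: T_def)
  have "det T \<noteq> 0"
  proof
    assume "det T = 0"
    then obtain v where v: "v \<in> carrier_vec n" "v \<noteq> 0\<^sub>v n" "T *\<^sub>v v = 0\<^sub>v n"
      using det_0_iff_vec_prod_zero_field[OF T] by auto
    have "app n A (\<lambda>i. v $ i) i = 0" if "i < n" for i
    proof -
      have "app n A (\<lambda>i. v $ i) i = (T *\<^sub>v v) $ i"
        using that v(1) by (simp add: app_def T_def scalar_prod_def lessThan_atLeast0)
      then show ?thesis using that v(3) by simp
    qed
    then have "bil n A (\<lambda>i. v $ i) (\<lambda>i. v $ i) = 0" by (simp add: bil_app dot_def)
    then have "v $ i = 0" if "i < n" for i using assms that by blast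
    then show False using v by auto
  qed
  then have "T \<in> Units (ring_mat TYPE(real) n ())" by (rule det_non_zero_imp_unit[OF T])
  then obtain B where B: "mat_inverse T = Some B" using mat_inverse(1)[OF T, where b = "()"] by (cases "mat_inverse T") auto
  then have TB: "T * B = 1\<^sub>m n" "B \<in> carrier_mat n n" using mat_inverse(2)[OF T] by auto
  have "is_inv n A (\<lambda>j k. B $$ (j, k))"
    unfolding is_inv_def
  proof (intro allI impI)
    fix i k assume ik: "i < n" "k < n"
    have "(\<Sum>j<n. A i j * B $$ (j, k)) = (T * B) $$ (i, k)"
      using ik TB(2) by (simp add: T_def scalar_prod_def lessThan_atLeast0)
    then show "(\<Sum>j<n. A i j * B $$ (j, k)) = (if i = k then 1 else 0)" using TB ik by simp
  qed
  then show ?thesis by blast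
qed

text \<open>A positive symbol forces the trigonometric polynomial with coefficients x to vanish
  almost everywhere, and Parseval returns x = 0.\<close>

lemma bil_toep_eq_0D:
  assumes g: "integrable circ g" "AE t in circ. 0 < g t" and "bil n (toep g) x x = 0" "i < n"
  shows "x i = 0"
proof -
  have nn: "AE t in circ. 0 \<le> bil n (cosm t) x x * g t"
    using g(2) by eventually_elim (simp add: bil_cosm_nonneg)
  have "(\<integral>t. bil n (cosm t) x x * g t \<partial>circ) = 0" using assms(3) bil_toep(1)[OF g(1)] by simp
  then have "AE t in circ. bil n (cosm t) x x * g t = 0"
    using integral_nonneg_eq_0_iff_AE[OF bil_toep(2)[OF g(1)] nn] by simp
  with g(2) have "AE t in circ. bil n (cosm t) x x = 0" by eventually_elim simp
  then have "(\<integral>t. bil n (cosm t) x x \<partial>circ) = (\<integral>t. 0 \<partial>circ)"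
    by (intro integral_cong_AE) (auto intro: borel_measurable_integrable[OF integrable_bil_cosm, simplified])
  then have "sqn n x = 0" by (simp add: integral_bil_cosm dot_self)
  then show ?thesis using \<open>i < n\<close> by (simp add: sqn_def sum_nonneg_eq_0_iff)
qed

lemma toep_pd_inverse:
  assumes "integrable circ g" "AE t in circ. 0 < g t" "is_inv n (toep g) B"
  shows "pd_inverse n (toep g) B"
  using assms(2) by unfold_locales (auto intro!: sym_toep bil_toep_nonneg assms(1,3) elim: eventually_mono)

text \<open>At the origin \<open>f\<close> has a pole of order at most \<open>b\<close> and
  \<open>g\<close> a zero of order at most \<open>a\<close>. The condition a + b < 1 makes f / g
  integrable and leaves room for both norm estimates.\<close>

locale toeplitz_pair =
  fixes f g :: "real \<Rightarrow> real" and Cf Cg a b :: real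
  assumes f_meas [measurable]: "f \<in> borel_measurable borel" and g_meas [measurable]: "g \<in> borel_measurable borel"
    and g_even: "\<And>t. g (- t) = g t"
    and f_pos: "\<And>t. t \<noteq> 0 \<Longrightarrow> \<bar>t\<bar> \<le> pi \<Longrightarrow> 0 < f t" and g_pos: "\<And>t. t \<noteq> 0 \<Longrightarrow> \<bar>t\<bar> \<le> pi \<Longrightarrow> 0 < g t"
    and f_le: "\<And>t. t \<noteq> 0 \<Longrightarrow> \<bar>t\<bar> \<le> pi \<Longrightarrow> f t \<le> Cf * \<bar>t\<bar> powr (- b)"
    and g_ge: "\<And>t. t \<noteq> 0 \<Longrightarrow> \<bar>t\<bar> \<le> pi \<Longrightarrow> 1 / g t \<le> Cg * \<bar>t\<bar> powr (- a)"
    and g_int: "integrable circ g" and g_cont: "\<And>t. 0 < t \<Longrightarrow> t < pi \<Longrightarrow> isCont g t"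
    and a: "0 \<le> a" and b: "0 \<le> b" and ab: "a + b < 1"
begin

text \<open>Slack with a + b + 3 e = 1: each of the two operator norms may lose n^e and the total
  exponent a + b + 2 e still stays below 1.\<close>

definition e :: real where "e = (1 - a - b) / 3"

lemma e: "0 < e" "a \<le> 1 - e" "b \<le> 1 - e" "1 - e < 1" "a + b + 2 * e < 1"
  using a b ab by (auto simp: e_def field_simps)

lemma C_pos: "0 < Cf" "0 < Cg"
proof -
  have "0 < f 1" "0 < 1 / g 1" using f_pos[of 1] g_pos[of 1] pi_gt3 by auto
  moreover have "f 1 \<le> Cf" "1 / g 1 \<le> Cg" using f_le[of 1] g_ge[of 1] pi_gt3 by auto
  ultimately show "0 < Cf" "0 < Cg" by linarith+
qed

lemma f_int: "integrable circ f"
proof (rule integrable_circ_bounded)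
  show "b < 1" using a ab by simp
  show "0 \<le> f t \<and> f t \<le> Cf * \<bar>t\<bar> powr (- b)" if "t \<noteq> 0" "\<bar>t\<bar> \<le> pi" for t
    using f_le[OF that] f_pos[OF that] by simp
qed simp

lemma w_int: "integrable circ (\<lambda>t. 1 / g t)"
proof (rule integrable_circ_bounded)
  show "a < 1" using b ab by simp
  show "0 \<le> 1 / g t \<and> 1 / g t \<le> Cg * \<bar>t\<bar> powr (- a)" if "t \<noteq> 0" "\<bar>t\<bar> \<le> pi" for t
    using g_ge[OF that] g_pos[OF that] by simp
qed simp

lemma AE_pos: "AE t in circ. 0 < f t" "AE t in circ. 0 < g t"
  by (auto intro!: AE_circI f_pos g_pos)

definition lim :: real where "lim = (\<integral>t. f t / g t \<partial>circ)"

lemma f_div_g_int: "integrable circ (\<lambda>t. f t / g t)"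
proof (rule integrable_circ_bounded)
  show "a + b < 1" by (rule ab)
  show "0 \<le> f t / g t \<and> f t / g t \<le> (Cf * Cg) * \<bar>t\<bar> powr (- (a + b))" if "t \<noteq> 0" "\<bar>t\<bar> \<le> pi" for t
  proof -
    have "f t * (1 / g t) \<le> (Cf * \<bar>t\<bar> powr (- b)) * (Cg * \<bar>t\<bar> powr (- a))"
      using f_le[OF that] g_ge[OF that] f_pos[OF that] g_pos[OF that] by (intro mult_mono) auto
    then show ?thesis using f_pos[OF that] g_pos[OF that] by (simp add: powr_add[symmetric] mult_ac add.commute)
  qed
qed simp

text \<open>Positivity makes the traces grow at least linearly in n, as the concentration argument
  requires.\<close>

lemma lim_pos: "0 < lim"
proof -
  have nn: "AE t in circ. 0 \<le> f t / g t" using AE_pos by eventually_elim simp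
  have "lim \<noteq> 0"
  proof
    assume "lim = 0"
    then have "AE t in circ. f t / g t = 0"
      using integral_nonneg_eq_0_iff_AE[OF f_div_g_int nn] by (simp add: lim_def)
    with AE_pos have "AE t in circ. False" by eventually_elim simp
    then show False by simp
  qed
  moreover have "0 \<le> lim" unfolding lim_def by (rule integral_nonneg_AE[OF nn])
  ultimately show ?thesis by simp
qed

lemma trace_tendsto:
  assumes inv: "\<And>n. is_inv n (toep g) (B n)"
  shows "(\<lambda>n. (\<Sum>i<n. \<Sum>j<n. B n i j * toep f i j) / real n) \<longlonglongrightarrow> lim"
proof -
  define D where "D n l = (\<Sum>i<n. \<Sum>j<n. B n i j * cosm l i j) / real n" for n l
  note pd = toep_pd_inverse[OF g_int AE_pos(2) inv]
  \<comment> \<open>The constant of \<open>fejer_conv_le\<close> at exponent 1 - e; the price is a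
    factor |l|^(-e), which the slack in a + b < 1 pays for in the dominated convergence
    below.\<close>
  define K where "K = Cg * (2 powr a * pi powr (1 - (1 - e)) + 8 * powr_mean (1 - e))"
  have D_nn: "0 \<le> D n l" for n l
    unfolding D_def sum_mult_cosm using pd_inverse.posB[OF pd] by (intro divide_nonneg_nonneg add_nonneg_nonneg) auto
  have D_le: "D n l \<le> fejer_conv n (\<lambda>t. 1 / g t) l" for n l
    unfolding D_def by (rule toep_inv_trace_upper[OF pd g_int w_int AE_pos(2)])
  have K: "D n l \<le> K * \<bar>l\<bar> powr (- (a + e))" if l: "l \<noteq> 0" "\<bar>l\<bar> \<le> pi" for n l
  proof (cases "n = 0")
    case True
    then show ?thesis using C_pos powr_mean_nonneg[of "1 - e"] by (simp add: D_def K_def)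
  next
    case False
    then show ?thesis
      using order_trans[OF D_le fejer_conv_le[of "\<lambda>t. 1 / g t" Cg a "1 - e" n l]] w_int g_ge a e C_pos l
      by (simp add: K_def)
  qed
  have D_lim: "(\<lambda>n. D n l) \<longlonglongrightarrow> 1 / g l" if l: "0 < \<bar>l\<bar>" "\<bar>l\<bar> < pi" for l
  proof -
    have gl: "0 < g l" "0 < g \<bar>l\<bar>" using g_pos l by auto
    have F: "(\<lambda>n. fejer_conv n g l) \<longlonglongrightarrow> g l"
      by (rule fejer_conv_tendsto[OF g_int g_even l g_cont[OF l]])
    have W: "(\<lambda>n. fejer_conv n (\<lambda>t. 1 / g t) l) \<longlonglongrightarrow> 1 / g l"
    proof (rule fejer_conv_tendsto[OF w_int _ l])
      show "1 / g (- t) = 1 / g t" for t by (simp add: g_even)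
      show "isCont (\<lambda>t. 1 / g t) \<bar>l\<bar>"
        unfolding isCont_def
        by (rule tendsto_divide[OF tendsto_const g_cont[OF l, unfolded isCont_def]]) (use gl in simp)
    qed
    have "\<forall>\<^sub>F n in sequentially. 0 < fejer_conv n g l" by (rule order_tendstoD(1)[OF F gl(1)])
    then have ev: "\<forall>\<^sub>F n in sequentially. 1 / fejer_conv n g l \<le> D n l"
      using eventually_gt_at_top[of 0]
      by eventually_elim (auto simp: D_def intro!: toep_inv_trace_lower[OF pd])
    have L: "(\<lambda>n. 1 / fejer_conv n g l) \<longlonglongrightarrow> 1 / g l" by (rule tendsto_divide[OF tendsto_const F]) (use gl in simp)
    show ?thesis by (rule tendsto_sandwich[OF ev _ L W]) (intro always_eventually allI D_le)
  qed
  have "(\<lambda>n. \<integral>l. D n l * f l \<partial>circ) \<longlonglongrightarrow> (\<integral>l. (1 / g l) * f l \<partial>circ)"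
  proof (rule integral_dominated_convergence)
    show "integrable circ (\<lambda>l. (K * Cf) * \<bar>l\<bar> powr (- (a + e + b)))"
      using e by (intro integrable_mult_right integrable_circ_powr) auto
    show "AE l in circ. (\<lambda>n. D n l * f l) \<longlonglongrightarrow> 1 / g l * f l"
      by (intro AE_circI tendsto_mult_right D_lim) auto
    show "AE l in circ. norm (D n l * f l) \<le> (K * Cf) * \<bar>l\<bar> powr (- (a + e + b))" for n
    proof (intro AE_circI)
      fix l assume l: "- pi \<le> l" "l \<le> pi" "l \<noteq> 0"
      have fl: "0 < f l" "f l \<le> Cf * \<bar>l\<bar> powr (- b)" using f_pos f_le l by auto
      have Kl: "D n l \<le> K * \<bar>l\<bar> powr (- (a + e))" using K l by auto
      have "norm (D n l * f l) = D n l * f l" using D_nn fl by simp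
      also have "\<dots> \<le> (K * \<bar>l\<bar> powr (- (a + e))) * (Cf * \<bar>l\<bar> powr (- b))"
        using D_nn fl Kl by (intro mult_mono) (auto intro: order_trans[OF D_nn])
      also have "\<dots> = (K * Cf) * (\<bar>l\<bar> powr (- (a + e)) * \<bar>l\<bar> powr (- b))" by (simp add: mult_ac)
      also have "\<bar>l\<bar> powr (- (a + e)) * \<bar>l\<bar> powr (- b) = \<bar>l\<bar> powr (- (a + e + b))"
        unfolding powr_add[symmetric] by (simp add: algebra_simps)
      finally show "norm (D n l * f l) \<le> (K * Cf) * \<bar>l\<bar> powr (- (a + e + b))" .
    qed
  qed (simp_all add: D_def)
  moreover have "(\<integral>l. D n l * f l \<partial>circ) = (\<Sum>i<n. \<Sum>j<n. B n i j * toep f i j) / real n" for n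
    unfolding sum_integral_circ(1)[OF f_int] D_def by simp
  ultimately show ?thesis by (simp add: lim_def)
qed

lemma AE_tendsto:
  fixes M :: "'a measure" and X :: "nat \<Rightarrow> 'a \<Rightarrow> nat \<Rightarrow> real"
  assumes M: "prob_space M" and X: "\<And>n. gaussian_vector M n (X n) (toep f)"
    and inv: "\<And>n. is_inv n (toep g) (B n)"
  shows "AE \<omega> in M. (\<lambda>n. bil n (B n) (X n \<omega>) (X n \<omega>) / real n) \<longlonglongrightarrow> lim"
proof -
  note pd = toep_pd_inverse[OF g_int AE_pos(2) inv]
  define t where "t n = (\<Sum>i<n. \<Sum>j<n. B n i j * toep f i j)" for n
  have t_lim: "(\<lambda>n. t n / real n) \<longlonglongrightarrow> lim" unfolding t_def by (rule trace_tendsto[OF inv])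
  then have "\<forall>\<^sub>F n in sequentially. lim / 2 < t n / real n" using lim_pos by (intro order_tendstoD) auto
  then obtain n1 where n1: "\<And>n. n1 \<le> n \<Longrightarrow> lim / 2 < t n / real n" by (auto simp: eventually_sequentially)
  define n0 where "n0 = max n1 1"
  have n0: "0 < n0" "\<And>n. n0 \<le> n \<Longrightarrow> 0 < n" "\<And>n. n0 \<le> n \<Longrightarrow> n1 \<le> n" by (auto simp: n0_def)
  define k where "k = powr_mean (1 - e)"
  have k: "0 \<le> k" by (simp add: k_def powr_mean_nonneg)
  \<comment> \<open>Norm bounds of order n^(b + e) for T_n(f) and, with \<open>c\<close>, of order
    n^(a + e) for T_n(g)^{-1}, the latter through T_n(1/g).\<close>
  define s where "s n = Cf * (1 + k) * real n powr (b + (1 - (1 - e)))" for n :: nat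
  define c where "c n = Cg * (1 + k) * real n powr (a + (1 - (1 - e)))" for n :: nat
  have "AE \<omega> in M. (\<lambda>n. bil n (B n) (X n \<omega>) (X n \<omega>) / (\<Sum>i<n. \<Sum>j<n. B n i j * toep f i j)) \<longlonglongrightarrow> 1"
  proof (rule AE_quadratic_form_ratio[where b = c and s = s and S = "\<lambda>_. toep f"])
    show "0 < n0" by (rule n0)
    show "0 < lim / 2" using lim_pos by simp
    show "a + b + 2 * e < 1" by (rule e)
    fix n assume n: "n0 \<le> n"
    have n': "0 < n" "n1 \<le> n" using n0 n by auto
    show "c n * s n \<le> (Cg * (1 + k) * (Cf * (1 + k))) * real n powr (a + b + 2 * e)"
    proof -
      have "real n powr (a + b + 2 * e) = real n powr (a + e) * real n powr (b + e)"
        unfolding powr_add[symmetric] by (simp add: algebra_simps)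
      then show ?thesis by (simp add: c_def s_def)
    qed
    show "lim / 2 * real n \<le> (\<Sum>i<n. \<Sum>j<n. B n i j * toep f i j)"
      using n1[OF n'(2)] n' unfolding t_def[symmetric] by (simp add: field_simps)
    show "gaussian_quadratic_form M n (X n) (toep f) (B n) (c n) (s n)"
    proof (rule gaussian_quadratic_form.intro)
      show "prob_space M" by (rule M)
      show "gaussian_vector M n (X n) (toep f)" by (rule X)
      show "sym_mat n (toep f)" by (rule sym_toep)
      show "0 \<le> bil n (toep f) y y" for y
        using AE_pos(1) by (intro bil_toep_nonneg f_int) (auto elim: eventually_mono)
      show "bil n (toep f) y y \<le> s n * sqn n y" for y
        unfolding s_def k_def using f_le e b C_pos n'
        by (intro toep_norm_le f_int AE_circI) auto
      show "sym_mat n (B n)" "0 \<le> bil n (B n) y y" for y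
        using pd_inverse.symB[OF pd] pd_inverse.posB[OF pd] by auto
      have "bil n (B n) y y \<le> bil n (toep (\<lambda>t. 1 / g t)) y y" for y
        by (rule toep_inv_le[OF pd g_int w_int AE_pos(2)])
      moreover have "bil n (toep (\<lambda>t. 1 / g t)) y y \<le> c n * sqn n y" for y
        unfolding c_def k_def using g_ge e a C_pos n'
        by (intro toep_norm_le w_int AE_circI) auto
      ultimately show "bil n (B n) y y \<le> c n * sqn n y" for y by (rule order_trans)
      show "0 < c n" "0 < s n" using C_pos k n' by (auto simp: c_def s_def intro!: mult_pos_pos)
    qed
  qed
  then show ?thesis
  proof eventually_elim
    case (elim \<omega>)
    have T: "(\<lambda>n. bil n (B n) (X n \<omega>) (X n \<omega>) / t n * (t n / real n)) \<longlonglongrightarrow> 1 * lim"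
      using elim t_lim unfolding t_def by (rule tendsto_mult)
    have "\<forall>\<^sub>F n in sequentially. bil n (B n) (X n \<omega>) (X n \<omega>) / t n * (t n / real n) = bil n (B n) (X n \<omega>) (X n \<omega>) / real n"
      using eventually_ge_at_top[of n1]
    proof eventually_elim
      case (elim n)
      have "t n \<noteq> 0" using n1[OF elim] lim_pos by auto
      then show ?case by simp
    qed
    from Lim_transform_eventually[OF T this] show ?case by simp
  qed
qed

end

section \<open>The shape of the fractional Gaussian noise density\<close>

text \<open>The terms k = n + 1 and k = -(n + 1) of the periodization; for |t| <= pi both bases are
  at least pi, so the absolute values disappear and the only singular term is k = 0.\<close>

definition fgn_tail :: "real \<Rightarrow> real \<Rightarrow> real" where
  "fgn_tail u t = (\<Sum>n. (2 * pi * real (Suc n) - t) powr (- (2 * u + 1)) + (2 * pi * real (Suc n) + t) powr (- (2 * u + 1)))"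

definition shape :: "real \<Rightarrow> real \<Rightarrow> real" where
  "shape u t = 4 * (sin (t / 2))\<^sup>2 * (\<bar>t\<bar> powr (- (2 * u + 1)) + fgn_tail u t)"

text \<open>One half of the tail at t = pi. With s = 2 u + 1 it equals pi^(-s) (1 - 2^(-s)) zeta(s)
  for u > 0, and it diverges as u tends to 0.\<close>

definition odd_zeta :: "real \<Rightarrow> real" where
  "odd_zeta u = (\<Sum>n. (pi * real (2 * n + 1)) powr (- (2 * u + 1)))"

text \<open>The factor 3 is attained at n = 0 with |t| = pi, where the larger base is 3 pi and the
  odd multiple is pi.\<close>

lemma base_bounds:
  assumes "\<bar>t\<bar> \<le> pi"
  shows "pi * real (2 * n + 1) \<le> 2 * pi * real (Suc n) - t" "pi * real (2 * n + 1) \<le> 2 * pi * real (Suc n) + t"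
    and "2 * pi * real (Suc n) - t \<le> 3 * (pi * real (2 * n + 1))" "2 * pi * real (Suc n) + t \<le> 3 * (pi * real (2 * n + 1))"
    and "pi \<le> 2 * pi * real (Suc n) - t" "pi \<le> 2 * pi * real (Suc n) + t"
proof -
  have *: "pi * real (2 * n + 1) = 2 * (pi * real n) + pi" "2 * pi * real (Suc n) = 2 * (pi * real n) + 2 * pi"
    by (simp_all add: algebra_simps)
  obtain A where A: "pi * real n = A" "0 \<le> A" by simp
  have t: "t \<le> pi" "- pi \<le> t" using assms by auto
  show "pi * real (2 * n + 1) \<le> 2 * pi * real (Suc n) - t" "pi * real (2 * n + 1) \<le> 2 * pi * real (Suc n) + t"
    "2 * pi * real (Suc n) - t \<le> 3 * (pi * real (2 * n + 1))" "2 * pi * real (Suc n) + t \<le> 3 * (pi * real (2 * n + 1))"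
    "pi \<le> 2 * pi * real (Suc n) - t" "pi \<le> 2 * pi * real (Suc n) + t"
    unfolding * A(1) using t A(2) pi_gt_zero by auto
qed

lemma summable_odd_zeta: "0 < u \<Longrightarrow> summable (\<lambda>n. (pi * real (2 * n + 1)) powr (- (2 * u + 1)))"
proof (rule summable_comparison_test'[of _ 0])
  assume u: "0 < u"
  show "summable (\<lambda>n. real (Suc n) powr (- (2 * u + 1)))"
    using u by (subst summable_Suc_iff) (simp add: summable_real_powr_iff)
  fix n :: nat
  have "1 * real (Suc n) \<le> pi * real (2 * n + 1)" using pi_gt3 by (intro mult_mono) auto
  then show "norm ((pi * real (2 * n + 1)) powr (- (2 * u + 1))) \<le> real (Suc n) powr (- (2 * u + 1))"
    using u by simp (intro powr_mono2', auto)
qed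

lemma pi_times_odd_pos: "0 < pi * real (2 * n + 1)"
  by (intro mult_pos_pos) auto

lemma tail_term_le:
  assumes "0 < u" "\<bar>t\<bar> \<le> pi"
  shows "(2 * pi * real (Suc n) - t) powr (- (2 * u + 1)) \<le> (pi * real (2 * n + 1)) powr (- (2 * u + 1))"
    and "(2 * pi * real (Suc n) + t) powr (- (2 * u + 1)) \<le> (pi * real (2 * n + 1)) powr (- (2 * u + 1))"
  by (intro powr_mono2'; use assms(1) base_bounds[OF assms(2), of n] pi_times_odd_pos[of n] in linarith)+

lemma summable_tail_terms:
  assumes "0 < u" "\<bar>t\<bar> \<le> pi"
  shows "summable (\<lambda>n. (2 * pi * real (Suc n) - t) powr (- (2 * u + 1)))"
    and "summable (\<lambda>n. (2 * pi * real (Suc n) + t) powr (- (2 * u + 1)))"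
  using tail_term_le[OF assms]
  by (auto intro!: summable_comparison_test'[OF summable_odd_zeta[OF assms(1)], of 0] simp del: of_nat_Suc of_nat_add)

lemma summable_tail:
  assumes "0 < u" "\<bar>t\<bar> \<le> pi"
  shows "summable (\<lambda>n. (2 * pi * real (Suc n) - t) powr (- (2 * u + 1)) + (2 * pi * real (Suc n) + t) powr (- (2 * u + 1)))"
  by (intro summable_add summable_tail_terms assms)

lemma fgn_tail_le:
  assumes "0 < u" "\<bar>t\<bar> \<le> pi"
  shows "fgn_tail u t \<le> 2 * odd_zeta u"
proof -
  have "fgn_tail u t \<le> (\<Sum>n. 2 * (pi * real (2 * n + 1)) powr (- (2 * u + 1)))"
    unfolding fgn_tail_def
  proof (intro suminf_le summable_tail summable_mult summable_odd_zeta assms)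
    show "(2 * pi * real (Suc n) - t) powr (- (2 * u + 1)) + (2 * pi * real (Suc n) + t) powr (- (2 * u + 1))
      \<le> 2 * (pi * real (2 * n + 1)) powr (- (2 * u + 1))" for n
      using tail_term_le[OF assms, of n] by linarith
  qed
  also have "\<dots> = 2 * odd_zeta u" unfolding odd_zeta_def by (rule suminf_mult[OF summable_odd_zeta[OF assms(1)]])
  finally show ?thesis .
qed

lemma odd_zeta_ge:
  assumes "0 < u" "u < 1"
  shows "1 / pi ^ 3 \<le> odd_zeta u"
proof -
  have "1 / pi ^ 3 = pi powr (-3)" using powr_neg_numeral[of pi "num.Bit1 num.One"] by simp
  also have "\<dots> \<le> pi powr (- (2 * u + 1))" using assms pi_gt3 by (intro powr_mono) auto
  also have "\<dots> = (\<Sum>n<1. (pi * real (2 * n + 1)) powr (- (2 * u + 1)))" by simp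
  also have "\<dots> \<le> odd_zeta u" unfolding odd_zeta_def
    by (intro sum_le_suminf summable_odd_zeta assms) auto
  finally show ?thesis .
qed

lemma odd_zeta_pos: "0 < u \<Longrightarrow> u < 1 \<Longrightarrow> 0 < odd_zeta u"
  by (rule less_le_trans[OF _ odd_zeta_ge]) auto

text \<open>Every base is at most 3 times the corresponding odd multiple of pi, and 3^(-(2u + 1)) >=
  1/27 because u < 1. Together with \<open>fgn_tail_le\<close> the tail is comparable to
  \<open>odd_zeta u\<close> uniformly down to u = 0, where both diverge.\<close>

lemma fgn_tail_ge:
  assumes "0 < u" "u < 1" "\<bar>t\<bar> \<le> pi"
  shows "2 / 27 * odd_zeta u \<le> fgn_tail u t"
proof -
  have "2 / 27 * odd_zeta u = (\<Sum>n. 2 / 27 * (pi * real (2 * n + 1)) powr (- (2 * u + 1)))"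
    unfolding odd_zeta_def by (rule suminf_mult[symmetric, OF summable_odd_zeta[OF assms(1)]])
  also have "\<dots> \<le> fgn_tail u t"
    unfolding fgn_tail_def
  proof (intro suminf_le summable_tail summable_mult summable_odd_zeta assms)
    fix n :: nat
    let ?m = "pi * real (2 * n + 1)"
    have "1 / 27 = (3::real) powr (-3)" using powr_neg_numeral[of 3 "num.Bit1 num.One"] by simp
    also have "\<dots> \<le> 3 powr (- (2 * u + 1))" using assms by (intro powr_mono) auto
    finally have "1 / 27 * ?m powr (- (2 * u + 1)) \<le> 3 powr (- (2 * u + 1)) * ?m powr (- (2 * u + 1))"
      by (intro mult_right_mono) auto
    also have "\<dots> = (3 * ?m) powr (- (2 * u + 1))" by (simp add: powr_mult)
    finally have c: "1 / 27 * ?m powr (- (2 * u + 1)) \<le> (3 * ?m) powr (- (2 * u + 1))" .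
    have mono: "(3 * ?m) powr (- (2 * u + 1)) \<le> y powr (- (2 * u + 1))" if "pi \<le> y" "y \<le> 3 * ?m" for y
    proof (rule powr_mono2')
      show "0 < y" using that(1) pi_gt_zero by linarith
    qed (use that assms(1) in simp_all)
    have "(3 * ?m) powr (- (2 * u + 1)) \<le> (2 * pi * real (Suc n) - t) powr (- (2 * u + 1))"
      "(3 * ?m) powr (- (2 * u + 1)) \<le> (2 * pi * real (Suc n) + t) powr (- (2 * u + 1))"
      using mono base_bounds[OF assms(3), of n] by blast+
    with c show "2 / 27 * ?m powr (- (2 * u + 1))
      \<le> (2 * pi * real (Suc n) - t) powr (- (2 * u + 1)) + (2 * pi * real (Suc n) + t) powr (- (2 * u + 1))"
      by linarith
  qed
  finally show ?thesis .
qed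

lemma fgn_tail_pos: "0 < u \<Longrightarrow> u < 1 \<Longrightarrow> \<bar>t\<bar> \<le> pi \<Longrightarrow> 0 < fgn_tail u t"
  using fgn_tail_ge[of u t] odd_zeta_pos[of u] by linarith

text \<open>The integers split into 0 and two injective images of the natural numbers. At t = 0 both
  sides use the value 0 of \<open>powr\<close> at base 0.\<close>

lemma shape_eq:
  assumes "0 < u" "\<bar>t\<bar> \<le> pi"
  shows "fgn_shape u t = shape u t"
proof -
  define p where "p k = \<bar>t - 2 * pi * real_of_int k\<bar> powr (- (2 * u + 1))" for k :: int
  let ?A = "\<lambda>n. (2 * pi * real (Suc n) - t) powr (- (2 * u + 1))"
  let ?B = "\<lambda>n. (2 * pi * real (Suc n) + t) powr (- (2 * u + 1))"
  have pA: "p \<circ> (\<lambda>n. int n + 1) = ?A" and pB: "p \<circ> (\<lambda>n. - (int n + 1)) = ?B"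
  proof -
    have e: "real_of_int (int n + 1) = real (Suc n)" "real_of_int (- (int n + 1)) = - real (Suc n)" for n
      by simp_all
    have "\<bar>t - y\<bar> = y - t" if "pi \<le> y - t" for y using that pi_gt_zero by linarith
    moreover have "\<bar>t - - y\<bar> = y + t" if "pi \<le> y + t" for y using that pi_gt_zero by linarith
    ultimately have "\<bar>t - 2 * pi * real_of_int (int n + 1)\<bar> = 2 * pi * real (Suc n) - t"
      "\<bar>t - 2 * pi * real_of_int (- (int n + 1))\<bar> = 2 * pi * real (Suc n) + t" for n
      using base_bounds(5,6)[OF assms(2), of n] unfolding e mult_minus_right by blast+
    then show "p \<circ> (\<lambda>n. int n + 1) = ?A" "p \<circ> (\<lambda>n. - (int n + 1)) = ?B"
      by (simp_all only: p_def o_def)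
  qed
  have A: "(p has_sum suminf ?A) (range (\<lambda>n. int n + 1))"
    by (subst has_sum_reindex)
       (simp add: inj_on_def, unfold pA, intro sums_nonneg_imp_has_sum summable_sums summable_tail_terms[OF assms] powr_ge_zero)
  have B: "(p has_sum suminf ?B) (range (\<lambda>n. - (int n + 1)))"
    by (subst has_sum_reindex)
       (simp add: inj_on_def, unfold pB, intro sums_nonneg_imp_has_sum summable_sums summable_tail_terms[OF assms] powr_ge_zero)
  have "(p has_sum (suminf ?A + suminf ?B)) (range (\<lambda>n. int n + 1) \<union> range (\<lambda>n. - (int n + 1)))"
    by (intro has_sum_Un_disjoint A B) auto
  moreover have "range (\<lambda>n. int n + 1) \<union> range (\<lambda>n. - (int n + 1)) = UNIV - {0}"
  proof (intro Set.set_eqI iffI)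
    fix k :: int assume "k \<in> UNIV - {0}"
    then have "k = int (nat (k - 1)) + 1 \<or> k = - (int (nat (- k - 1)) + 1)" by auto
    then show "k \<in> range (\<lambda>n. int n + 1) \<union> range (\<lambda>n. - (int n + 1))" by blast
  qed auto
  ultimately have "(p has_sum (suminf ?A + suminf ?B)) (UNIV - {0})" by simp
  moreover have "(p has_sum p 0) {0}" using has_sum_finite[of "{0}" p] by simp
  ultimately have "(p has_sum (p 0 + (suminf ?A + suminf ?B))) ({0} \<union> (UNIV - {0}))"
    by (intro has_sum_Un_disjoint) auto
  moreover have "suminf ?A + suminf ?B = fgn_tail u t"
    unfolding fgn_tail_def by (rule suminf_add[OF summable_tail_terms[OF assms]])
  ultimately have "(p has_sum (p 0 + fgn_tail u t)) UNIV" by simp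
  then have "infsum p UNIV = p 0 + fgn_tail u t" by (rule infsumI)
  then have "infsum p UNIV = \<bar>t\<bar> powr (- (2 * u + 1)) + fgn_tail u t" by (simp add: p_def)
  moreover have "(cmod (exp (\<i> * complex_of_real t) - 1))\<^sup>2 = 4 * (sin (t / 2))\<^sup>2"
    using cmod_one_minus_cis[of t] by (simp add: cis_conv_exp norm_minus_commute)
  ultimately show ?thesis unfolding fgn_shape_def shape_def p_def[abs_def] by simp
qed

lemma sin_half_sq_bounds:
  assumes "\<bar>t\<bar> \<le> pi"
  shows "t\<^sup>2 / 4 \<le> 4 * (sin (t / 2))\<^sup>2" and "4 * (sin (t / 2))\<^sup>2 \<le> t\<^sup>2"
proof -
  have "\<bar>t\<bar> / 4 \<le> \<bar>sin (t / 2)\<bar>" using abs_sin_half_ge[of t] assms by (simp add: min_def split: if_splits)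
  then have "(\<bar>t\<bar> / 4)\<^sup>2 \<le> \<bar>sin (t / 2)\<bar>\<^sup>2" by (intro power_mono) auto
  then show "t\<^sup>2 / 4 \<le> 4 * (sin (t / 2))\<^sup>2" by (simp add: power_divide)
  have "\<bar>sin (t / 2)\<bar>\<^sup>2 \<le> \<bar>t / 2\<bar>\<^sup>2" by (intro power_mono abs_sin_x_le_abs_x) auto
  then show "4 * (sin (t / 2))\<^sup>2 \<le> t\<^sup>2" by (simp add: power_divide)
qed

text \<open>Raising the order of a pole costs a power of pi, because |t| may exceed 1.\<close>

lemma powr_neg_le_scaled:
  assumes "t \<noteq> 0" "\<bar>t\<bar> \<le> pi" "c \<le> d"
  shows "\<bar>t\<bar> powr (- c) \<le> pi powr (d - c) * \<bar>t\<bar> powr (- d)"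
proof -
  have "\<bar>t\<bar> powr (- c) = \<bar>t\<bar> powr (d - c) * \<bar>t\<bar> powr (- d)" by (simp add: powr_add[symmetric])
  also have "\<dots> \<le> pi powr (d - c) * \<bar>t\<bar> powr (- d)"
    using assms by (intro mult_right_mono powr_mono2) auto
  finally show ?thesis .
qed

lemma square_mult_powr: "t \<noteq> 0 \<Longrightarrow> t\<^sup>2 * \<bar>t\<bar> powr (- (2 * u + 1)) = \<bar>t\<bar> powr (- (2 * u - 1))"
  for t :: real
proof -
  assume "t \<noteq> 0"
  then have t: "t\<^sup>2 = \<bar>t\<bar> powr 2" by simp
  have e: "2 + - (2 * u + 1) = - (2 * u - 1)" by simp
  show ?thesis unfolding t powr_add[symmetric] e ..
qed

section \<open>Power bounds at the origin and dependence on the parameter\<close>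

lemma shape_ge:
  assumes "0 < u" "u < 1" "t \<noteq> 0" "\<bar>t\<bar> \<le> pi"
  shows "\<bar>t\<bar> powr (- (2 * u - 1)) / 4 \<le> shape u t"
proof -
  have "t\<^sup>2 / 4 * \<bar>t\<bar> powr (- (2 * u + 1)) \<le> shape u t"
    unfolding shape_def using fgn_tail_pos[OF assms(1,2,4)] sin_half_sq_bounds[OF assms(4)]
    by (intro mult_mono) auto
  then show ?thesis using square_mult_powr[OF assms(3), of u] by simp
qed

lemma shape_pos: "0 < u \<Longrightarrow> u < 1 \<Longrightarrow> t \<noteq> 0 \<Longrightarrow> \<bar>t\<bar> \<le> pi \<Longrightarrow> 0 < shape u t"
  by (rule less_le_trans[OF _ shape_ge]) auto

lemma shape_nonneg: "0 < u \<Longrightarrow> u < 1 \<Longrightarrow> \<bar>t\<bar> \<le> pi \<Longrightarrow> 0 \<le> shape u t"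
  unfolding shape_def using fgn_tail_pos[of u t] by (intro mult_nonneg_nonneg add_nonneg_nonneg) auto

lemma shape_le':
  assumes "0 < u" "u < 1" "\<bar>t\<bar> \<le> pi"
  shows "shape u t \<le> t\<^sup>2 * (\<bar>t\<bar> powr (- (2 * u + 1)) + 2 * odd_zeta u)"
  unfolding shape_def using fgn_tail_le[OF assms(1,3)] fgn_tail_pos[OF assms] sin_half_sq_bounds(2)[OF assms(3)]
  by (intro mult_mono) auto

lemma shape_le:
  assumes "0 < u" "u < 1" "t \<noteq> 0" "\<bar>t\<bar> \<le> pi"
  shows "shape u t \<le> (1 + 2 * odd_zeta u * pi powr (2 * u + 1)) * \<bar>t\<bar> powr (- (2 * u - 1))"
proof -
  have "1 \<le> pi powr (2 * u + 1) * \<bar>t\<bar> powr (- (2 * u + 1))"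
    using powr_neg_le_scaled[OF assms(3,4), of 0 "2 * u + 1"] assms by simp
  then have "2 * odd_zeta u * 1 \<le> 2 * odd_zeta u * (pi powr (2 * u + 1) * \<bar>t\<bar> powr (- (2 * u + 1)))"
    using odd_zeta_pos[OF assms(1,2)] by (intro mult_left_mono) auto
  then have "t\<^sup>2 * (\<bar>t\<bar> powr (- (2 * u + 1)) + 2 * odd_zeta u)
    \<le> t\<^sup>2 * ((1 + 2 * odd_zeta u * pi powr (2 * u + 1)) * \<bar>t\<bar> powr (- (2 * u + 1)))"
    by (intro mult_left_mono) (auto simp: algebra_simps)
  also have "\<dots> = (1 + 2 * odd_zeta u * pi powr (2 * u + 1)) * \<bar>t\<bar> powr (- (2 * u - 1))"
    using square_mult_powr[OF assms(3), of u] by (simp add: mult_ac)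
  finally show ?thesis using shape_le'[OF assms(1,2,4)] by linarith
qed

lemma shape_measurable [measurable]: "shape u \<in> borel_measurable borel"
  unfolding shape_def[abs_def] fgn_tail_def by measurable

lemma shape_even: "shape u (- t) = shape u t"
  by (simp add: shape_def fgn_tail_def add.commute)

lemma isCont_shape:
  assumes "0 < u" "0 < t" "t < pi"
  shows "isCont (shape u) t"
proof -
  let ?F = "\<lambda>n t. (2 * pi * real (Suc n) - t) powr (- (2 * u + 1)) + (2 * pi * real (Suc n) + t) powr (- (2 * u + 1))"
  have "uniform_limit {-pi..pi} (\<lambda>n t. \<Sum>i<n. ?F i t) (\<lambda>t. suminf (\<lambda>i. ?F i t)) sequentially"
  proof (rule Weierstrass_m_test)
    show "summable (\<lambda>n. 2 * (pi * real (2 * n + 1)) powr (- (2 * u + 1)))"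
      by (intro summable_mult summable_odd_zeta assms)
    fix n t assume "t \<in> {-pi..pi}"
    then have "\<bar>t\<bar> \<le> pi" by auto
    from tail_term_le[OF assms(1) this, of n]
    show "norm (?F n t) \<le> 2 * (pi * real (2 * n + 1)) powr (- (2 * u + 1))" by simp
  qed
  moreover have "\<forall>\<^sub>F n in sequentially. continuous_on {-pi..pi} (\<lambda>t. \<Sum>i<n. ?F i t)"
  proof (intro always_eventually allI continuous_on_sum continuous_on_add continuous_on_powr continuous_intros ballI)
    fix i t assume "t \<in> {-pi..pi}"
    then have "\<bar>t\<bar> \<le> pi" by auto
    from base_bounds(5,6)[OF this, of i] pi_gt_zero
    show "2 * pi * real (Suc i) - t \<noteq> 0" "2 * pi * real (Suc i) + t \<noteq> 0" by linarith+
  qed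
  ultimately have "continuous_on {-pi..pi} (\<lambda>t. suminf (\<lambda>i. ?F i t))"
    by (intro uniform_limit_theorem[of _ "\<lambda>n t. \<Sum>i<n. ?F i t"]) auto
  then have c: "continuous_on {-pi..pi} (fgn_tail u)" unfolding fgn_tail_def .
  have "isCont (fgn_tail u) t"
    by (rule continuous_on_interior[OF c]) (use assms in auto)
  then show ?thesis unfolding shape_def[abs_def] using assms
    by (intro continuous_intros) auto
qed

text \<open>All bases are at least |t|, so each term gains at most |t|^(-2(v - u)). The factor is
  unbounded near t = 0; the estimate serves continuity in the parameter at fixed t.\<close>

lemma shape_mono_upper:
  assumes "0 < u" "u \<le> v" "t \<noteq> 0" "\<bar>t\<bar> \<le> pi"
  shows "shape v t \<le> \<bar>t\<bar> powr (- (2 * (v - u))) * shape u t"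
proof -
  let ?c = "\<bar>t\<bar> powr (- (2 * (v - u)))"
  have step: "y powr (- (2 * v + 1)) \<le> ?c * y powr (- (2 * u + 1))" if "\<bar>t\<bar> \<le> y" for y
  proof -
    have "y powr (- (2 * v + 1)) = y powr (- (2 * (v - u))) * y powr (- (2 * u + 1))"
      by (simp add: powr_add[symmetric])
    also have "\<dots> \<le> ?c * y powr (- (2 * u + 1))"
      using that assms by (intro mult_right_mono powr_mono2') auto
    finally show ?thesis .
  qed
  have "fgn_tail v t \<le> (\<Sum>n. ?c * ((2 * pi * real (Suc n) - t) powr (- (2 * u + 1)) + (2 * pi * real (Suc n) + t) powr (- (2 * u + 1))))"
    unfolding fgn_tail_def
  proof (intro suminf_le summable_tail summable_mult)
    fix n
    have "\<bar>t\<bar> \<le> 2 * pi * real (Suc n) - t" "\<bar>t\<bar> \<le> 2 * pi * real (Suc n) + t"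
      using base_bounds(5,6)[OF assms(4), of n] assms(4) by linarith+
    from step[OF this(1)] step[OF this(2)]
    show "(2 * pi * real (Suc n) - t) powr (- (2 * v + 1)) + (2 * pi * real (Suc n) + t) powr (- (2 * v + 1))
      \<le> ?c * ((2 * pi * real (Suc n) - t) powr (- (2 * u + 1)) + (2 * pi * real (Suc n) + t) powr (- (2 * u + 1)))"
      by (simp only: distrib_left)
  qed (use assms in auto)
  also have "\<dots> = ?c * fgn_tail u t"
    unfolding fgn_tail_def by (rule suminf_mult[OF summable_tail[OF assms(1,4)]])
  finally have "\<bar>t\<bar> powr (- (2 * v + 1)) + fgn_tail v t \<le> ?c * (\<bar>t\<bar> powr (- (2 * u + 1)) + fgn_tail u t)"
    using step[of "\<bar>t\<bar>", OF order_refl] by (simp only: distrib_left)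
  then have "4 * (sin (t / 2))\<^sup>2 * (\<bar>t\<bar> powr (- (2 * v + 1)) + fgn_tail v t)
    \<le> 4 * (sin (t / 2))\<^sup>2 * (?c * (\<bar>t\<bar> powr (- (2 * u + 1)) + fgn_tail u t))"
    by (intro mult_left_mono) auto
  then show ?thesis unfolding shape_def by (simp only: mult_ac)
qed

text \<open>The first summand comes from the central term, where |t| <= pi costs pi^(2(v - u)). The
  second comes from the tails: an error (2/a) * 2 * \<open>odd_zeta (a / 2)\<close> per unit of v -
  u, divided by the uniform lower bound 2 / (27 pi^3) of the tail.\<close>

definition lip_const :: "real \<Rightarrow> real" where
  "lip_const a = 2 * ln pi + 54 * odd_zeta (a / 2) * pi ^ 3 / a"

text \<open>The opposite comparison has a factor uniform in t that tends to 1 as v - u tends to 0.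
  This is the one-sided estimate behind the rescaled monotonicity of \<open>rho_n\<close>.\<close>

lemma shape_mono_lower:
  assumes "0 < a" "a \<le> u" "u \<le> v" "v < 1" "\<bar>t\<bar> \<le> pi" "t \<noteq> 0"
  shows "shape u t \<le> exp (lip_const a * (v - u)) * shape v t"
proof -
  define x where "x = v - u"
  have x: "0 \<le> x" using assms by (simp add: x_def)
  define L2 where "L2 = 54 * odd_zeta (a / 2) * pi ^ 3 / a"
  have z: "0 < odd_zeta (a / 2)" using assms by (intro odd_zeta_pos) auto
  have L2: "0 \<le> L2" using z assms by (simp add: L2_def)
  have lnpi: "0 \<le> 2 * ln pi" using pi_gt3 by simp
  have L: "lip_const a = 2 * ln pi + L2" by (simp add: lip_const_def L2_def)
  have c: "exp (2 * ln pi * x) \<le> exp (lip_const a * x)" "exp (L2 * x) \<le> exp (lip_const a * x)"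
    using x L2 lnpi by (auto simp: L distrib_right)
  have "\<bar>t\<bar> powr (- (2 * u + 1)) \<le> pi powr (2 * x) * \<bar>t\<bar> powr (- (2 * v + 1))"
    using powr_neg_le_scaled[OF assms(6,5), of "2 * u + 1" "2 * v + 1"] assms by (simp add: x_def algebra_simps)
  also have "pi powr (2 * x) = exp (2 * ln pi * x)" by (simp add: powr_def mult_ac)
  also have "exp (2 * ln pi * x) * \<bar>t\<bar> powr (- (2 * v + 1)) \<le> exp (lip_const a * x) * \<bar>t\<bar> powr (- (2 * v + 1))"
    by (intro mult_right_mono c) auto
  finally have 1: "\<bar>t\<bar> powr (- (2 * u + 1)) \<le> exp (lip_const a * x) * \<bar>t\<bar> powr (- (2 * v + 1))" .
  \<comment> \<open>The difference of the powers is at most 2 x ln y times the larger one. The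
    logarithm is absorbed by y^a / a, and since u >= a the exponent left over is at most -(a + 1),
    that of the summable tail with parameter a / 2.\<close>
  have step: "y powr (- (2 * u + 1)) \<le> y powr (- (2 * v + 1)) + 2 * x / a * y powr (- (2 * (a / 2) + 1))" if y: "pi \<le> y" for y
  proof -
    have y1: "1 < y" using y pi_gt3 by simp
    have "1 - y powr (- (2 * x)) \<le> 2 * x * ln y"
      using exp_ge_add_one_self[of "- (2 * x * ln y)"] y1 by (simp add: powr_def)
    also have "\<dots> \<le> 2 * x * (y powr a / a)"
    proof (intro mult_left_mono)
      have "a * ln y \<le> exp (a * ln y)" using exp_ge_add_one_self[of "a * ln y"] by linarith
      then show "ln y \<le> y powr a / a" using y1 assms by (simp add: powr_def field_simps)
    qed (use x in auto)
    finally have "(1 - y powr (- (2 * x))) * y powr (- (2 * u + 1)) \<le> 2 * x * (y powr a / a) * y powr (- (2 * u + 1))"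
      by (intro mult_right_mono) auto
    moreover have "y powr (- (2 * x)) * y powr (- (2 * u + 1)) = y powr (- (2 * v + 1))"
      by (simp add: powr_add[symmetric] x_def algebra_simps)
    moreover have "2 * x * (y powr a / a) * y powr (- (2 * u + 1)) = 2 * x / a * y powr (a - (2 * u + 1))"
      unfolding diff_conv_add_uminus powr_add by simp
    moreover have "2 * x / a * y powr (a - (2 * u + 1)) \<le> 2 * x / a * y powr (- (2 * (a / 2) + 1))"
      using x assms y1 by (intro mult_left_mono powr_mono) auto
    ultimately show ?thesis by (simp only: left_diff_distrib mult_1_left)
  qed
  have "fgn_tail u t \<le> (\<Sum>n. ((2 * pi * real (Suc n) - t) powr (- (2 * v + 1)) + (2 * pi * real (Suc n) + t) powr (- (2 * v + 1)))
     + 2 * x / a * ((2 * pi * real (Suc n) - t) powr (- (2 * (a / 2) + 1)) + (2 * pi * real (Suc n) + t) powr (- (2 * (a / 2) + 1))))"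
    unfolding fgn_tail_def
  proof (intro suminf_le summable_add[OF summable_tail summable_mult[OF summable_tail]] summable_tail)
    fix n
    from step[OF base_bounds(5)[OF assms(5), of n]] step[OF base_bounds(6)[OF assms(5), of n]]
    show "(2 * pi * real (Suc n) - t) powr (- (2 * u + 1)) + (2 * pi * real (Suc n) + t) powr (- (2 * u + 1))
      \<le> ((2 * pi * real (Suc n) - t) powr (- (2 * v + 1)) + (2 * pi * real (Suc n) + t) powr (- (2 * v + 1)))
     + 2 * x / a * ((2 * pi * real (Suc n) - t) powr (- (2 * (a / 2) + 1)) + (2 * pi * real (Suc n) + t) powr (- (2 * (a / 2) + 1)))"
      unfolding distrib_left by linarith
  qed (use assms in auto)
  also have "\<dots> = fgn_tail v t + 2 * x / a * fgn_tail (a / 2) t"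
    unfolding fgn_tail_def using assms
    by (subst suminf_add[symmetric] suminf_mult[symmetric], (intro summable_tail summable_mult; simp)+)+ simp
  also have "\<dots> \<le> fgn_tail v t + 2 * x / a * (2 * odd_zeta (a / 2))"
    using assms x by (intro add_left_mono mult_left_mono fgn_tail_le) auto
  also have "\<dots> \<le> fgn_tail v t + (L2 * x) * fgn_tail v t"
  proof -
    have "2 / 27 * (1 / pi ^ 3) \<le> 2 / 27 * odd_zeta v" using assms by (intro mult_left_mono odd_zeta_ge) auto
    also have "\<dots> \<le> fgn_tail v t" using assms by (intro fgn_tail_ge) auto
    finally have "(L2 * x) * (2 / 27 * (1 / pi ^ 3)) \<le> (L2 * x) * fgn_tail v t"
      using L2 x by (intro mult_left_mono) auto
    moreover have "(L2 * x) * (2 / 27 * (1 / pi ^ 3)) = 2 * x / a * (2 * odd_zeta (a / 2))"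
      using assms by (simp add: L2_def field_simps)
    ultimately show ?thesis by simp
  qed
  also have "\<dots> = (1 + L2 * x) * fgn_tail v t" by (simp add: algebra_simps)
  also have "\<dots> \<le> exp (L2 * x) * fgn_tail v t"
    using assms fgn_tail_pos[of v t] by (intro mult_right_mono exp_ge_add_one_self) auto
  also have "\<dots> \<le> exp (lip_const a * x) * fgn_tail v t"
    using assms fgn_tail_pos[of v t] by (intro mult_right_mono c) auto
  finally have "\<bar>t\<bar> powr (- (2 * u + 1)) + fgn_tail u t \<le> exp (lip_const a * x) * (\<bar>t\<bar> powr (- (2 * v + 1)) + fgn_tail v t)"
    using 1 by (simp only: distrib_left)
  then have "4 * (sin (t / 2))\<^sup>2 * (\<bar>t\<bar> powr (- (2 * u + 1)) + fgn_tail u t)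
    \<le> 4 * (sin (t / 2))\<^sup>2 * (exp (lip_const a * x) * (\<bar>t\<bar> powr (- (2 * v + 1)) + fgn_tail v t))"
    by (intro mult_left_mono) auto
  then show ?thesis unfolding shape_def x_def by (simp only: mult_ac)
qed

section \<open>Spectral densities and the definitions of the statement\<close>

definition shape_mean :: "real \<Rightarrow> real" where
  "shape_mean u = (\<integral>t. shape u t \<partial>circ)"

definition fgn_density :: "real \<Rightarrow> real \<Rightarrow> real" where
  "fgn_density u t = shape u t / shape_mean u"

lemma integrable_shape:
  assumes "0 < u" "u < 1"
  shows "integrable circ (shape u)"
proof (rule integrable_circ_bounded)
  show "2 * u - 1 < 1" using assms by simp
  show "0 \<le> shape u t \<and> shape u t \<le> (1 + 2 * odd_zeta u * pi powr (2 * u + 1)) * \<bar>t\<bar> powr (- (2 * u - 1))"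
    if "t \<noteq> 0" "\<bar>t\<bar> \<le> pi" for t
    using shape_nonneg[OF assms that(2)] shape_le[OF assms that] by simp
qed simp

text \<open>The uniform tail bound is integrated against 4 sin^2 (t/2) = 2 - 2 cos t, which has mean
  2.\<close>

lemma shape_mean_ge:
  assumes "0 < u" "u < 1"
  shows "4 / 27 * odd_zeta u \<le> shape_mean u"
proof -
  have c: "4 * (sin (t / 2))\<^sup>2 = 2 - 2 * cos (of_int 1 * t)" for t :: real
    using cos_double_sin[of "t / 2"] by simp
  have i: "integrable circ (\<lambda>t. cos (of_int 1 * t))"
    by (intro circ.integrable_const_bound[of _ 1]) auto
  have "4 / 27 * odd_zeta u = (\<integral>t. (2 - 2 * cos (of_int 1 * t)) * (2 / 27 * odd_zeta u) \<partial>circ)"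
    using i integral_circ_cos[of 1] circ.prob_space by simp
  also have "\<dots> \<le> shape_mean u"
    unfolding shape_mean_def
  proof (intro integral_mono_AE AE_circI integrable_shape assms)
    show "integrable circ (\<lambda>t. (2 - 2 * cos (of_int 1 * t)) * (2 / 27 * odd_zeta u))"
      using i by (intro integrable_mult_left Bochner_Integration.integrable_diff integrable_mult_right) auto
    fix t assume t: "- pi \<le> t" "t \<le> pi"
    have "4 * (sin (t / 2))\<^sup>2 * (2 / 27 * odd_zeta u) \<le> shape u t"
      unfolding shape_def using fgn_tail_ge[OF assms, of t] t by (intro mult_left_mono add_increasing) auto
    then show "(2 - 2 * cos (of_int 1 * t)) * (2 / 27 * odd_zeta u) \<le> shape u t" unfolding c .
  qed
  finally show ?thesis .
qed

lemma shape_mean_pos: "0 < u \<Longrightarrow> u < 1 \<Longrightarrow> 0 < shape_mean u"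
  by (rule less_le_trans[OF _ shape_mean_ge]) (simp_all add: odd_zeta_pos)

lemma f_fgn_eq:
  assumes "0 < u" "\<bar>t\<bar> \<le> pi"
  shows "f_fgn u t = fgn_density u t"
proof -
  have "(LINT t:{-pi..pi}|lborel. fgn_shape u t) = (LINT t:{-pi..pi}|lborel. shape u t)"
    using assms(1) by (intro set_lebesgue_integral_cong) (auto intro!: shape_eq)
  then have "C_fgn u = 1 / shape_mean u"
    by (simp add: C_fgn_def shape_mean_def integral_circ)
  then show ?thesis using shape_eq[OF assms] by (simp add: f_fgn_def fgn_density_def)
qed

lemma fgn_density_measurable [measurable]: "fgn_density u \<in> borel_measurable borel"
  unfolding fgn_density_def[abs_def] by measurable

lemma fgn_density_even: "fgn_density u (- t) = fgn_density u t"
  by (simp add: fgn_density_def shape_even)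

lemma fgn_density_pos: "0 < u \<Longrightarrow> u < 1 \<Longrightarrow> t \<noteq> 0 \<Longrightarrow> \<bar>t\<bar> \<le> pi \<Longrightarrow> 0 < fgn_density u t"
  by (simp add: fgn_density_def shape_pos shape_mean_pos)

lemma integrable_fgn_density: "0 < u \<Longrightarrow> u < 1 \<Longrightarrow> integrable circ (fgn_density u)"
  unfolding fgn_density_def[abs_def] by (intro integrable_divide_zero integrable_shape)

lemma integral_circ_uminus:
  fixes f :: "real \<Rightarrow> real"
  assumes [measurable]: "f \<in> borel_measurable borel"
  shows "(\<integral>t. f (- t) \<partial>circ) = (\<integral>t. f t \<partial>circ)"
proof -
  have "(\<integral>t. indicator {-pi..pi} t *\<^sub>R f t \<partial>lborel) = (\<integral>t. indicator {-pi..pi} (- t) *\<^sub>R f (- t) \<partial>lborel)"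
    using lborel_integral_real_affine[of "-1" "\<lambda>t. indicator {-pi..pi} t *\<^sub>R f t" 0] by simp
  also have "\<dots> = (\<integral>t. indicator {-pi..pi} t *\<^sub>R f (- t) \<partial>lborel)"
    by (intro Bochner_Integration.integral_cong) (auto simp: indicator_def)
  finally show ?thesis by (simp add: integral_circ set_lebesgue_integral_def)
qed

text \<open>The sine part vanishes because the density is even.\<close>

lemma fourier_coeff_fgn:
  assumes "0 < u" "u < 1"
  shows "fourier_coeff (f_fgn u) (int j - int k) = complex_of_real (toep (fgn_density u) j k)"
proof -
  define m where "m = int j - int k"
  let ?e = "\<lambda>t. exp (- \<i> * of_int m * complex_of_real t)"
  let ?g = "fgn_density u"
  have "fourier_coeff (f_fgn u) m
     = complex_of_real (1 / (2 * pi)) * (LINT t:{-pi..pi}|lborel. ?e t * complex_of_real (?g t))"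
    unfolding fourier_coeff_def using assms(1)
    by (intro arg_cong2[where f = times] refl set_lebesgue_integral_cong) (auto simp: f_fgn_eq)
  also have "\<dots> = (\<integral>t. ?e t * complex_of_real (?g t) \<partial>circ)"
    by (subst integral_circ) auto
  also have "\<dots> = (\<integral>t. complex_of_real (cos (real_of_int m * t) * ?g t) + \<i> * complex_of_real (- (sin (real_of_int m * t) * ?g t)) \<partial>circ)"
  proof (intro Bochner_Integration.integral_cong refl)
    fix t
    have "?e t = cis (- (real_of_int m * t))" by (simp add: cis_conv_exp algebra_simps)
    then show "?e t * complex_of_real (?g t) = complex_of_real (cos (real_of_int m * t) * ?g t) + \<i> * complex_of_real (- (sin (real_of_int m * t) * ?g t))"
      by (simp add: complex_eq_iff)
  qed
  also have "\<dots> = complex_of_real (\<integral>t. cos (real_of_int m * t) * ?g t \<partial>circ) + \<i> * complex_of_real (- (\<integral>t. sin (real_of_int m * t) * ?g t \<partial>circ))"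
  proof -
    have "integrable circ (\<lambda>t. cos (real_of_int m * t) * ?g t)" "integrable circ (\<lambda>t. sin (real_of_int m * t) * ?g t)"
      by (rule integrable_circ_bounded_mult[of _ _ 1]; use assms in \<open>simp add: integrable_fgn_density\<close>)+
    moreover have "(\<integral>t. complex_of_real (c t) + \<i> * complex_of_real (- s t) \<partial>circ)
      = complex_of_real (\<integral>t. c t \<partial>circ) + \<i> * complex_of_real (- (\<integral>t. s t \<partial>circ))"
      if "integrable circ c" "integrable circ s" for c s
      using that by (subst Bochner_Integration.integral_add) auto
    ultimately show ?thesis by blast
  qed
  also have "(\<integral>t. sin (real_of_int m * t) * ?g t \<partial>circ) = 0"
    using integral_circ_uminus[of "\<lambda>t. sin (real_of_int m * t) * ?g t"] by (simp add: fgn_density_even)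
  also have "(\<integral>t. cos (real_of_int m * t) * ?g t \<partial>circ) = toep ?g j k"
    by (simp add: toep_def cosm_def m_def)
  finally show ?thesis by (simp add: m_def)
qed

lemma toeplitz_fgn:
  assumes "0 < u" "u < 1"
  shows "toeplitz n (f_fgn u) = mat n n (\<lambda>(j, k). complex_of_real (toep (fgn_density u) j k))"
  unfolding toeplitz_def fourier_coeff_fgn[OF assms] ..

lemma rho_n_eq:
  assumes u: "0 < u" "u < 1" and inv: "is_inv n (toep (fgn_density u)) B"
  shows "rho_n n x u = bil n B x x / real n"
proof -
  let ?T = "mat n n (\<lambda>(j, k). complex_of_real (toep (fgn_density u) j k))"
  let ?B = "mat n n (\<lambda>(j, k). complex_of_real (B j k))"
  have "mat_inverse ?T = Some ?B"
    by (rule is_inv_mat_inverse[of _ n]) (auto intro!: mat_mult_is_inv[OF inv])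
  then have "rho_n n x u = (1 / real n) * Re (\<Sum>j<n. \<Sum>k<n. complex_of_real (x j) * ?B $$ (j, k) * complex_of_real (x k))"
    unfolding rho_n_def toeplitz_fgn[OF u] by simp
  also have "(\<Sum>j<n. \<Sum>k<n. complex_of_real (x j) * ?B $$ (j, k) * complex_of_real (x k)) = complex_of_real (bil n B x x)"
    unfolding bil_def of_real_sum by (intro sum.cong) auto
  finally show ?thesis by simp
qed

lemma rho_inf_eq:
  assumes "0 < h" "0 < u"
  shows "rho_inf h u = (\<integral>t. fgn_density h t / fgn_density u t \<partial>circ)"
proof -
  have "(LINT t:{-pi..pi}|lborel. f_fgn h t / f_fgn u t) = (LINT t:{-pi..pi}|lborel. fgn_density h t / fgn_density u t)"
    using assms by (intro set_lebesgue_integral_cong) (auto simp: f_fgn_eq)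
  then show ?thesis by (simp add: rho_inf_def integral_circ)
qed

lemma fgn_inverse:
  assumes "0 < u" "u < 1"
  obtains B where "\<And>n. is_inv n (toep (fgn_density u)) (B n)"
proof -
  have "AE t in circ. 0 < fgn_density u t"
    using assms by (intro AE_circI fgn_density_pos) auto
  then have "\<exists>B. is_inv n (toep (fgn_density u)) B" for n
    using assms by (intro ex_is_inv bil_toep_eq_0D[OF integrable_fgn_density])
  then show ?thesis using that by metis
qed

lemma gaussian_vector_cong:
  assumes "\<And>j k. j < n \<Longrightarrow> k < n \<Longrightarrow> S j k = S' j k" "gaussian_vector M n X S"
  shows "gaussian_vector M n X S'"
proof -
  have "(\<Sum>i<n. \<Sum>j<n. a i * S i j * a j) = (\<Sum>i<n. \<Sum>j<n. a i * S' i j * a j)" for a :: "nat \<Rightarrow> real"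
    using assms(1) by (intro sum.cong) auto
  then show ?thesis using assms(2) unfolding gaussian_vector_def by simp
qed

lemma fgn_density_ge:
  assumes "0 < u" "u < 1" "t \<noteq> 0" "\<bar>t\<bar> \<le> pi"
  shows "\<bar>t\<bar> powr (- (2 * u - 1)) / (4 * shape_mean u) \<le> fgn_density u t"
  using shape_ge[OF assms] shape_mean_pos[OF assms(1,2)] by (simp add: fgn_density_def field_simps)

lemma fgn_density_le:
  assumes "0 < u" "u < 1"
  obtains C where "0 < C" "\<And>t. t \<noteq> 0 \<Longrightarrow> \<bar>t\<bar> \<le> pi \<Longrightarrow> fgn_density u t \<le> C * \<bar>t\<bar> powr (- (2 * u - 1))"
proof
  let ?C = "(1 + 2 * odd_zeta u * pi powr (2 * u + 1)) / shape_mean u"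
  show "0 < ?C" using odd_zeta_pos[OF assms] shape_mean_pos[OF assms] by (intro divide_pos_pos add_pos_nonneg) auto
  show "fgn_density u t \<le> ?C * \<bar>t\<bar> powr (- (2 * u - 1))" if "t \<noteq> 0" "\<bar>t\<bar> \<le> pi" for t
    using divide_right_mono[OF shape_le[OF assms that], of "shape_mean u"] shape_mean_pos[OF assms]
    by (simp add: fgn_density_def)
qed

text \<open>Exponents are replaced by their positive parts, so that the bounds of the general
  theorem apply to singularities and to zeros of the spectral densities alike.\<close>

lemma toeplitz_pair_fgn:
  assumes h: "0 < h" "h < 1" and u: "0 < u" "u < 1" "h - 1 / 2 < u"
  obtains Cf Cg where "toeplitz_pair (fgn_density h) (fgn_density u) Cf Cg (max 0 (1 - 2 * u)) (max 0 (2 * h - 1))"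
proof -
  obtain C where C: "0 < C" "\<And>t. t \<noteq> 0 \<Longrightarrow> \<bar>t\<bar> \<le> pi \<Longrightarrow> fgn_density h t \<le> C * \<bar>t\<bar> powr (- (2 * h - 1))"
    using fgn_density_le[OF h] by blast
  define a where "a = max 0 (1 - 2 * u)"
  define b where "b = max 0 (2 * h - 1)"
  have J: "0 < shape_mean u" by (rule shape_mean_pos[OF u(1,2)])
  have "toeplitz_pair (fgn_density h) (fgn_density u) (C * pi powr (b - (2 * h - 1)))
      (4 * shape_mean u * pi powr (a - (1 - 2 * u))) a b"
  proof
    fix t :: real assume t: "t \<noteq> 0" "\<bar>t\<bar> \<le> pi"
    show "0 < fgn_density h t" "0 < fgn_density u t" using fgn_density_pos h u t by auto
    have "fgn_density h t \<le> C * \<bar>t\<bar> powr (- (2 * h - 1))" by (rule C(2)[OF t])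
    also have "\<dots> \<le> C * (pi powr (b - (2 * h - 1)) * \<bar>t\<bar> powr (- b))"
      using C(1) t by (intro mult_left_mono powr_neg_le_scaled) (auto simp: b_def)
    finally show "fgn_density h t \<le> C * pi powr (b - (2 * h - 1)) * \<bar>t\<bar> powr (- b)" by (simp add: mult.assoc)
    have "1 / fgn_density u t \<le> 1 / (\<bar>t\<bar> powr (- (2 * u - 1)) / (4 * shape_mean u))"
      using fgn_density_ge[OF u(1,2) t] t J by (intro divide_left_mono mult_pos_pos divide_pos_pos fgn_density_pos u) auto
    also have "\<dots> = 4 * shape_mean u * \<bar>t\<bar> powr (- (1 - 2 * u))"
    proof -
      have "\<bar>t\<bar> powr (- (2 * u - 1)) * \<bar>t\<bar> powr (- (1 - 2 * u)) = 1" using t by (simp add: powr_add[symmetric])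
      then show ?thesis using t by (simp add: field_simps)
    qed
    also have "\<dots> \<le> 4 * shape_mean u * (pi powr (a - (1 - 2 * u)) * \<bar>t\<bar> powr (- a))"
      using J t by (intro mult_left_mono powr_neg_le_scaled) (auto simp: a_def)
    finally show "1 / fgn_density u t \<le> 4 * shape_mean u * pi powr (a - (1 - 2 * u)) * \<bar>t\<bar> powr (- a)"
      by (simp add: mult.assoc)
  next
    fix t :: real assume "0 < t" "t < pi"
    then show "isCont (fgn_density u) t"
      unfolding fgn_density_def[abs_def] using J isCont_shape[OF u(1), of t] by (auto intro!: continuous_intros)
  next
    show "a + b < 1" using h u by (auto simp: a_def b_def max_def)
  qed (auto simp: fgn_density_even a_def b_def intro!: integrable_fgn_density u)
  then show ?thesis using that by (simp add: a_def b_def)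
qed

text \<open>Polya's argument: between two grid points monotonicity traps F n u, and uniform
  continuity of the limit closes the gap. Convergence is assumed at rational points only, since
  almost sure convergence is available on a countable set.\<close>

lemma uniform_limit_antimono:
  fixes F :: "nat \<Rightarrow> real \<Rightarrow> real" and G :: "real \<Rightarrow> real"
  assumes anti: "\<And>n u v. a \<le> u \<Longrightarrow> u \<le> v \<Longrightarrow> v \<le> b \<Longrightarrow> F n v \<le> F n u"
    and lim: "\<And>u. u \<in> \<rat> \<Longrightarrow> a \<le> u \<Longrightarrow> u \<le> b \<Longrightarrow> (\<lambda>n. F n u) \<longlonglongrightarrow> G u"
    and cont: "continuous_on {a..b} G" and ab: "a \<in> \<rat>" "b \<in> \<rat>" "a < b"
  shows "uniform_limit {a..b} F G sequentially"
proof (rule uniform_limitI)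
  fix e :: real assume e: "0 < e"
  have "uniformly_continuous_on {a..b} G" using cont by (intro compact_uniformly_continuous) auto
  then obtain d where d: "0 < d" "\<And>x y. x \<in> {a..b} \<Longrightarrow> y \<in> {a..b} \<Longrightarrow> dist y x < d \<Longrightarrow> dist (G y) (G x) < e / 2"
    using e unfolding uniformly_continuous_on_def by (metis half_gt_zero)
  \<comment> \<open>Enough equal subdivisions for a mesh below \<open>d\<close>; rational end points
    make all nodes rational.\<close>
  obtain N :: nat where N: "(b - a) / d < real N" using reals_Archimedean2 by blast
  have N0: "0 < real N" using N ab d by (meson divide_pos_pos diff_gt_0_iff_gt less_trans)
  define w where "w = (b - a) / real N"
  have w: "0 < w" "w < d" "w * real N = b - a" using N N0 d ab by (auto simp: w_def field_simps)
  define p where "p i = a + w * real i" for i :: nat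
  have p: "p i \<in> \<rat>" "a \<le> p i" for i using ab w by (auto simp: p_def w_def intro!: Rats_add Rats_mult Rats_divide Rats_diff)
  have pN: "p i \<le> b" if "i \<le> N" for i
    using mult_left_mono[of "real i" "real N" w] that w by (simp add: p_def)
  have "\<forall>\<^sub>F n in sequentially. \<forall>i\<in>{..N}. dist (F n (p i)) (G (p i)) < e / 2"
    using e p pN by (intro eventually_ball_finite ballI tendstoD lim) auto
  then show "\<forall>\<^sub>F n in sequentially. \<forall>u\<in>{a..b}. dist (F n u) (G u) < e"
  proof eventually_elim
    case (elim n)
    show ?case
    proof
      fix u assume u: "u \<in> {a..b}"
      define j where "j = nat \<lfloor>(u - a) / w\<rfloor>"
      have "0 \<le> (u - a) / w" using u w by simp
      then have "real j \<le> (u - a) / w" "(u - a) / w < real j + 1" unfolding j_def by linarith+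
      then have j: "p j \<le> u" "u < p j + w" using w by (simp_all add: p_def field_simps)
      have jN: "j \<le> N"
      proof (rule ccontr)
        assume "\<not> j \<le> N"
        then have "w * real (Suc N) \<le> w * real j" using w by (intro mult_left_mono) auto
        moreover have "w * real j \<le> b - a" using j u by (simp add: p_def)
        ultimately show False using w by (simp add: algebra_simps)
      qed
      have close: "\<bar>G x - G u\<bar> < e / 2" if "x \<in> {a..b}" "\<bar>x - u\<bar> < d" for x
        using d(2)[OF u that(1)] that(2) by (simp add: dist_real_def)
      have Fp: "\<bar>F n (p i) - G (p i)\<bar> < e / 2" if "i \<le> N" for i
        using elim that by (auto simp: dist_real_def)
      have "F n u \<le> F n (p j)" using p j u by (intro anti) auto
      moreover have "\<bar>G (p j) - G u\<bar> < e / 2" using p pN[OF jN] j w by (intro close) auto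
      ultimately have upper: "F n u < G u + e" using Fp[OF jN] by linarith
      have lower: "G u - e < F n u"
      proof (cases "j = N")
        case True
        then have "p j = b" using w by (simp add: p_def)
        then have up: "u = p j" using u j by simp
        have "- (e / 2) < F n (p j) - G (p j)" using Fp[OF jN] by (simp only: abs_less_iff) linarith
        then show ?thesis using e unfolding up by linarith
      next
        case False
        then have jN': "Suc j \<le> N" using jN by simp
        have pS: "p (Suc j) = p j + w" by (simp add: p_def algebra_simps)
        have "F n (p (Suc j)) \<le> F n u" using p j u pN[OF jN'] pS by (intro anti) auto
        moreover have "\<bar>G (p (Suc j)) - G u\<bar> < e / 2"
          using p(2)[of "Suc j"] pN[OF jN'] pS j w by (intro close) auto
        ultimately show ?thesis using Fp[OF jN'] by linarith
      qed
      show "dist (F n u) (G u) < e" using upper lower by (simp add: dist_real_def abs_less_iff)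
    qed
  qed
qed

section \<open>Uniformity in the parameter\<close>

lemma shape_mean_mono:
  assumes "0 < a" "a \<le> u" "u \<le> v" "v < 1"
  shows "shape_mean u \<le> exp (lip_const a * (v - u)) * shape_mean v"
proof -
  have "shape_mean u \<le> (\<integral>t. exp (lip_const a * (v - u)) * shape v t \<partial>circ)"
    unfolding shape_mean_def using assms
    by (intro integral_mono_AE AE_circI integrable_mult_right integrable_shape shape_mono_lower) auto
  then show ?thesis by (simp add: shape_mean_def)
qed

lemma fgn_density_mono:
  assumes "0 < a" "a \<le> u" "u \<le> v" "v < 1" "t \<noteq> 0" "\<bar>t\<bar> \<le> pi"
  shows "fgn_density u t \<le> exp (lip_const a * (v - u)) * (shape_mean v / shape_mean u) * fgn_density v t"
proof -
  have J: "0 < shape_mean u" "0 < shape_mean v" using assms by (auto intro!: shape_mean_pos)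
  have "shape u t \<le> exp (lip_const a * (v - u)) * shape v t" using assms by (intro shape_mono_lower) auto
  then have "shape u t / shape_mean u \<le> exp (lip_const a * (v - u)) * shape v t / shape_mean u"
    using J by (intro divide_right_mono) auto
  then show ?thesis using J by (simp add: fgn_density_def)
qed

text \<open>A general symbol \<open>g\<close> is allowed because the lemma is used twice: with
  another density f_v for monotonicity on I, and with the regularized critical density off
  I.\<close>

lemma rho_n_compare:
  assumes u: "0 < u" "u < 1" and g: "integrable circ g" "AE t in circ. 0 < g t" and inv: "is_inv n (toep g) B"
    and le: "\<And>t. t \<noteq> 0 \<Longrightarrow> \<bar>t\<bar> \<le> pi \<Longrightarrow> fgn_density u t \<le> K * g t" and K: "0 < K"
  shows "bil n B x x / real n \<le> K * rho_n n x u"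
proof -
  obtain Bu where Bu: "\<And>n. is_inv n (toep (fgn_density u)) (Bu n)" using fgn_inverse[OF u] by blast
  have pos: "AE t in circ. 0 < fgn_density u t" using u by (intro AE_circI fgn_density_pos) auto
  have "bil n B x x \<le> K * bil n (Bu n) x x"
  proof (rule bil_inv_antimono[OF _ _ K])
    show "pd_inverse n (toep (fgn_density u)) (Bu n)" by (intro toep_pd_inverse integrable_fgn_density u pos Bu)
    show "pd_inverse n (toep g) B" by (intro toep_pd_inverse g inv)
    fix y
    have "bil n (toep (fgn_density u)) y y \<le> bil n (toep (\<lambda>t. K * g t)) y y"
      using le by (intro bil_toep_mono integrable_fgn_density u integrable_mult_right g AE_circI) auto
    also have "toep (\<lambda>t. K * g t) = (\<lambda>i j. K * toep g i j)"
      by (intro ext) (simp add: toep_def mult.left_commute)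
    finally show "bil n (toep (fgn_density u)) y y \<le> K * bil n (toep g) y y"
      by (simp add: bil_def sum_distrib_left mult_ac)
  qed
  then have "bil n B x x / real n \<le> K * bil n (Bu n) x x / real n" by (intro divide_right_mono) auto
  then show ?thesis using rho_n_eq[OF u Bu, of n x] by simp
qed

lemma rho_n_mono:
  assumes "0 < a" "a \<le> u" "u \<le> v" "v < 1"
  shows "rho_n n x v \<le> exp (lip_const a * (v - u)) * (shape_mean v / shape_mean u) * rho_n n x u"
proof -
  have v: "0 < v" "v < 1" using assms by auto
  obtain B where B: "\<And>n. is_inv n (toep (fgn_density v)) (B n)" using fgn_inverse[OF v] by blast
  have "bil n (B n) x x / real n \<le> exp (lip_const a * (v - u)) * (shape_mean v / shape_mean u) * rho_n n x u"
    using assms v shape_mean_pos[of u] shape_mean_pos[of v]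
    by (intro rho_n_compare[where g = "fgn_density v"] integrable_fgn_density AE_circI fgn_density_pos B fgn_density_mono) auto
  then show ?thesis using rho_n_eq[OF v B] by simp
qed

text \<open>Dominated convergence, with the integrand at the left end point as majorant through
  \<open>shape_mono_lower\<close>. The factor in front and the division by \<open>shape\<close>
  instead of the density match the weight used below, which absorbs the normalization.\<close>

lemma rho_inf_continuous:
  assumes h: "0 < h" "h < 1" and ab: "0 < a" "h - 1 / 2 < a" "a \<le> b" "b < 1"
  shows "continuous_on {a..b} (\<lambda>u. exp (- lip_const a * u) * (\<integral>t. fgn_density h t / shape u t \<partial>circ))"
proof -
  have "continuous_on {a..b} (\<lambda>u. \<integral>t. fgn_density h t / shape u t \<partial>circ)"
    unfolding continuous_on_sequentially o_def
  proof (intro allI ballI impI)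
    fix v :: "nat \<Rightarrow> real" and u
    assume u: "u \<in> {a..b}" and v: "(\<forall>n. v n \<in> {a..b}) \<and> v \<longlonglongrightarrow> u"
    obtain Cf Cg where "toeplitz_pair (fgn_density h) (fgn_density a) Cf Cg (max 0 (1 - 2 * a)) (max 0 (2 * h - 1))"
      using toeplitz_pair_fgn[OF h, of a] ab by auto
    then interpret P: toeplitz_pair "fgn_density h" "fgn_density a" Cf Cg "max 0 (1 - 2 * a)" "max 0 (2 * h - 1)" .
    have Ja: "0 < shape_mean a" using ab by (intro shape_mean_pos) auto
    let ?L = "lip_const a"
    show "(\<lambda>n. \<integral>t. fgn_density h t / shape (v n) t \<partial>circ) \<longlonglongrightarrow> (\<integral>t. fgn_density h t / shape u t \<partial>circ)"
    proof (rule integral_dominated_convergence)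
      show "integrable circ (\<lambda>t. exp (?L * (b - a)) / shape_mean a * (fgn_density h t / fgn_density a t))"
        by (intro integrable_mult_right P.f_div_g_int)
      show "AE t in circ. norm (fgn_density h t / shape (v n) t)
        \<le> exp (?L * (b - a)) / shape_mean a * (fgn_density h t / fgn_density a t)" for n
      proof (intro AE_circI)
        fix t assume t: "- pi \<le> t" "t \<le> pi" "t \<noteq> 0"
        have vn: "a \<le> v n" "v n \<le> b" using v by auto
        have s: "0 < shape (v n) t" "0 < shape a t" "0 < fgn_density h t"
          using ab vn t h by (auto intro!: shape_pos fgn_density_pos)
        have "shape a t \<le> exp (?L * (v n - a)) * shape (v n) t"
          using ab vn t by (intro shape_mono_lower) auto
        also have "\<dots> \<le> exp (?L * (b - a)) * shape (v n) t"
        proof -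
          have "0 \<le> ?L" using ab odd_zeta_pos[of "a / 2"] pi_gt3
            unfolding lip_const_def by (intro add_nonneg_nonneg divide_nonneg_pos mult_nonneg_nonneg) auto
          then show ?thesis using vn s by (intro mult_right_mono) (auto intro: mult_left_mono)
        qed
        finally have "1 / shape (v n) t \<le> exp (?L * (b - a)) / shape a t"
          using s by (simp add: field_simps)
        then have "fgn_density h t * (1 / shape (v n) t) \<le> fgn_density h t * (exp (?L * (b - a)) / shape a t)"
          using s by (intro mult_left_mono) auto
        then show "norm (fgn_density h t / shape (v n) t)
          \<le> exp (?L * (b - a)) / shape_mean a * (fgn_density h t / fgn_density a t)"
          using s Ja by (simp add: fgn_density_def[of a] mult_ac)
      qed
      show "AE t in circ. (\<lambda>n. fgn_density h t / shape (v n) t) \<longlonglongrightarrow> fgn_density h t / shape u t"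
      proof (intro AE_circI)
        fix t assume t: "- pi \<le> t" "t \<le> pi" "t \<noteq> 0"
        \<comment> \<open>A Lipschitz constant for ln (shape u t) in the parameter at fixed t: one
          part for each direction of comparison, the second growing like |ln |t||.\<close>
        define k where "k = \<bar>?L\<bar> + 2 * \<bar>ln \<bar>t\<bar>\<bar>"
        have cmp: "shape x t \<le> exp (k * \<bar>x - y\<bar>) * shape y t" if xy: "x \<in> {a..b}" "y \<in> {a..b}" for x y
        proof (cases "x \<le> y")
          case True
          have "shape x t \<le> exp (?L * (y - x)) * shape y t"
            using ab xy t True by (intro shape_mono_lower) auto
          also have "\<dots> \<le> exp (k * \<bar>x - y\<bar>) * shape y t"
            using True ab xy t by (intro mult_right_mono shape_nonneg) (auto simp: k_def intro!: mult_right_mono)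
          finally show ?thesis .
        next
          case False
          have "shape x t \<le> \<bar>t\<bar> powr (- (2 * (x - y))) * shape y t"
            using ab xy t False by (intro shape_mono_upper) auto
          also have "\<bar>t\<bar> powr (- (2 * (x - y))) = exp (- (2 * ln \<bar>t\<bar>) * (x - y))"
            using t by (simp add: powr_def algebra_simps)
          also have "exp (- (2 * ln \<bar>t\<bar>) * (x - y)) * shape y t \<le> exp (k * \<bar>x - y\<bar>) * shape y t"
          proof (intro mult_right_mono shape_nonneg)
            have "- (2 * ln \<bar>t\<bar>) \<le> k" unfolding k_def by linarith
            then show "exp (- (2 * ln \<bar>t\<bar>) * (x - y)) \<le> exp (k * \<bar>x - y\<bar>)"
              using False mult_right_mono[of "- (2 * ln \<bar>t\<bar>)" k "x - y"] by simp
          qed (use ab xy t in auto)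
          finally show ?thesis .
        qed
        have vlim: "v \<longlonglongrightarrow> u" and vin: "\<And>n. v n \<in> {a..b}" using v by auto
        have z: "(\<lambda>n. k * \<bar>v n - u\<bar>) \<longlonglongrightarrow> 0"
          using tendsto_mult_left[OF tendsto_rabs[OF LIM_zero[OF vlim]], of k] by simp
        have E: "(\<lambda>n. exp (k * \<bar>v n - u\<bar>) * shape u t) \<longlonglongrightarrow> shape u t"
          using tendsto_mult_right[OF tendsto_exp[OF z], of "shape u t"] by simp
        have E': "(\<lambda>n. exp (- (k * \<bar>v n - u\<bar>)) * shape u t) \<longlonglongrightarrow> shape u t"
          using tendsto_mult_right[OF tendsto_exp[OF tendsto_minus[OF z]], of "shape u t"] by simp
        have lim: "(\<lambda>n. shape (v n) t) \<longlonglongrightarrow> shape u t"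
        proof (rule tendsto_sandwich[OF _ _ E' E])
          show "\<forall>\<^sub>F n in sequentially. shape (v n) t \<le> exp (k * \<bar>v n - u\<bar>) * shape u t"
            using cmp[OF vin u] by (intro always_eventually allI)
          show "\<forall>\<^sub>F n in sequentially. exp (- (k * \<bar>v n - u\<bar>)) * shape u t \<le> shape (v n) t"
          proof (intro always_eventually allI)
            fix n
            have "shape u t \<le> exp (k * \<bar>v n - u\<bar>) * shape (v n) t" using cmp[OF u vin[of n]] by (simp add: abs_minus_commute)
            then have "exp (- (k * \<bar>v n - u\<bar>)) * shape u t \<le> exp (- (k * \<bar>v n - u\<bar>)) * (exp (k * \<bar>v n - u\<bar>) * shape (v n) t)"
              by (intro mult_left_mono) auto
            then show "exp (- (k * \<bar>v n - u\<bar>)) * shape u t \<le> shape (v n) t"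
              by (simp add: mult.assoc[symmetric] exp_add[symmetric])
          qed
        qed
        have "0 < shape u t" using ab u t by (intro shape_pos) auto
        then show "(\<lambda>n. fgn_density h t / shape (v n) t) \<longlonglongrightarrow> fgn_density h t / shape u t"
          by (intro tendsto_divide tendsto_const lim) auto
      qed
    qed simp_all
  qed
  then show ?thesis by (intro continuous_intros)
qed

lemma rho_uniform_limit_interval:
  assumes h: "0 < h" "h < 1" and ab: "0 < a" "h - 1 / 2 < a" "a < b" "b < 1" "a \<in> \<rat>" "b \<in> \<rat>"
    and lim: "\<And>u. u \<in> \<rat> \<Longrightarrow> a \<le> u \<Longrightarrow> u \<le> b \<Longrightarrow> (\<lambda>n. rho_n n (x n) u) \<longlonglongrightarrow> rho_inf h u"
  shows "uniform_limit {a..b} (\<lambda>n u. rho_n n (x n) u) (rho_inf h) sequentially"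
proof -
  let ?L = "lip_const a"
  \<comment> \<open>The comparison factor exp (L (v - u)) * J v / J u, with J the mean of the shape,
    is exactly c u / c v; hence c u * rho_n(u) is antimonotone.\<close>
  define c where "c u = exp (- ?L * u) / shape_mean u" for u
  have J: "0 < shape_mean u" if "a \<le> u" "u \<le> b" for u using that ab by (intro shape_mean_pos) auto
  have c: "0 < c u" if "a \<le> u" "u \<le> b" for u using J[OF that] by (simp add: c_def)
  have G: "c u * rho_inf h u = exp (- ?L * u) * (\<integral>t. fgn_density h t / shape u t \<partial>circ)" if "a \<le> u" "u \<le> b" for u
  proof -
    have "rho_inf h u = (\<integral>t. shape_mean u * (fgn_density h t / shape u t) \<partial>circ)"
      using that ab h by (subst rho_inf_eq) (auto simp: fgn_density_def[of u] mult_ac)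
    also have "\<dots> = shape_mean u * (\<integral>t. fgn_density h t / shape u t \<partial>circ)"
      by (rule integral_mult_right_zero)
    finally show ?thesis using J[OF that] by (simp add: c_def)
  qed
  have U: "uniform_limit {a..b} (\<lambda>n u. c u * rho_n n (x n) u) (\<lambda>u. c u * rho_inf h u) sequentially"
  proof (rule uniform_limit_antimono[OF _ _ _ ab(5,6,3)])
    show "continuous_on {a..b} (\<lambda>u. c u * rho_inf h u)"
      using rho_inf_continuous[OF h, of a b] ab G by (simp cong: continuous_on_cong_simp)
    show "(\<lambda>n. c u * rho_n n (x n) u) \<longlonglongrightarrow> c u * rho_inf h u" if "u \<in> \<rat>" "a \<le> u" "u \<le> b" for u
      by (intro tendsto_mult_left lim that)
    show "c v * rho_n n (x n) v \<le> c u * rho_n n (x n) u" if uv: "a \<le> u" "u \<le> v" "v \<le> b" for n u v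
    proof -
      have Ju: "0 < shape_mean u" "0 < shape_mean v" using uv J by auto
      have "c v * rho_n n (x n) v \<le> c v * (exp (?L * (v - u)) * (shape_mean v / shape_mean u) * rho_n n (x n) u)"
        using uv ab c[of v] by (intro mult_left_mono rho_n_mono) auto
      also have "\<dots> = (exp (- ?L * v) * exp (?L * (v - u))) / shape_mean u * rho_n n (x n) u"
        using Ju by (simp add: c_def)
      also have "exp (- ?L * v) * exp (?L * (v - u)) = exp (- ?L * u)"
        unfolding exp_add[symmetric] by (simp add: algebra_simps)
      finally show ?thesis by (simp add: c_def)
    qed
  qed
  show ?thesis
  proof (rule uniform_limitI)
    fix e :: real assume e: "0 < e"
    \<comment> \<open>The weight is bounded below on the interval by its value at b, so it can be
      divided out uniformly.\<close>
    have cb: "c b \<le> c u" if u: "a \<le> u" "u \<le> b" for u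
    proof -
      have "exp (- ?L * b) * shape_mean u \<le> exp (- ?L * b) * (exp (?L * (b - u)) * shape_mean b)"
        using u ab by (intro mult_left_mono shape_mean_mono) auto
      also have "\<dots> = exp (- ?L * u) * shape_mean b"
        unfolding mult.assoc[symmetric] exp_add[symmetric] by (simp add: algebra_simps)
      finally show ?thesis using J[OF u] J[of b] ab unfolding c_def by (simp add: frac_le_eq divide_le_eq field_simps)
    qed
    have c0: "0 < c b" using c[of b] ab by simp
    have "\<forall>\<^sub>F n in sequentially. \<forall>u\<in>{a..b}. dist (c u * rho_n n (x n) u) (c u * rho_inf h u) < c b * e"
      using U e c0 by (intro uniform_limitD) auto
    then show "\<forall>\<^sub>F n in sequentially. \<forall>u\<in>{a..b}. dist (rho_n n (x n) u) (rho_inf h u) < e"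
    proof eventually_elim
      case (elim n)
      show ?case
      proof
        fix u assume u: "u \<in> {a..b}"
        let ?d = "\<bar>rho_n n (x n) u - rho_inf h u\<bar>"
        have cu: "0 < c u" "c b \<le> c u" using u c cb by auto
        have "c b * ?d \<le> c u * ?d" using cu by (intro mult_right_mono) auto
        also have "\<dots> = dist (c u * rho_n n (x n) u) (c u * rho_inf h u)"
          using cu by (simp add: dist_real_def right_diff_distrib[symmetric] abs_mult)
        also have "\<dots> < c b * e" using elim u by blast
        finally show "dist (rho_n n (x n) u) (rho_inf h u) < e" using c0 by (simp add: dist_real_def)
      qed
    qed
  qed
qed

lemma rho_uniform_limit_compact:
  assumes h: "0 < h" "h < 1" and K: "compact K" "K \<subseteq> {h - 1 / 2 <..< 1} \<inter> {0 <..< 1}"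
    and lim: "\<And>u. u \<in> \<rat> \<Longrightarrow> u \<in> {h - 1 / 2 <..< 1} \<inter> {0 <..< 1} \<Longrightarrow> (\<lambda>n. rho_n n (x n) u) \<longlonglongrightarrow> rho_inf h u"
  shows "uniform_limit K (\<lambda>n u. rho_n n (x n) u) (rho_inf h) sequentially"
proof (cases "K = {}")
  case True
  then show ?thesis by (simp add: uniform_limit_iff)
next
  case False
  obtain m where m: "m \<in> K" "\<And>u. u \<in> K \<Longrightarrow> m \<le> u" using compact_attains_inf[OF K(1) False] by blast
  obtain m' where m': "m' \<in> K" "\<And>u. u \<in> K \<Longrightarrow> u \<le> m'" using compact_attains_sup[OF K(1) False] by blast
  have "max 0 (h - 1 / 2) < m" "m' < 1" using m m' K(2) by auto
  then obtain a b where a: "a \<in> \<rat>" "max 0 (h - 1 / 2) < a" "a < m" and b: "b \<in> \<rat>" "m' < b" "b < 1"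
    using Rats_dense_in_real by metis
  have "m \<le> m'" using m m' by auto
  have "uniform_limit {a..b} (\<lambda>n u. rho_n n (x n) u) (rho_inf h) sequentially"
    using a b \<open>m \<le> m'\<close> by (intro rho_uniform_limit_interval h lim) auto
  then show ?thesis
  proof (rule uniform_limit_on_subset)
    show "K \<subseteq> {a..b}" using m(2) m'(2) a b by fastforce
  qed
qed

text \<open>The constant must not depend on u, although normalization degenerates as u tends to 0.
  The numerator carries \<open>odd_zeta u\<close> in its tail and the mean is at least 4/27 of it,
  so the divergence cancels; pi^5 and pi^3 come from changing exponents, with 2(v - u) <= 2, 2v + 1
  <= 3 and 1 / odd_zeta u <= pi^3.\<close>

lemma fgn_density_le_critical:
  assumes "0 < u" "u \<le> v" "v < 1" "t \<noteq> 0" "\<bar>t\<bar> \<le> pi"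
  shows "fgn_density u t \<le> 27 * (pi ^ 5 + 2 * pi ^ 3) * shape_mean v * fgn_density v t"
proof -
  have u1: "u < 1" using assms by simp
  have z: "0 < odd_zeta u" "1 / pi ^ 3 \<le> odd_zeta u" using odd_zeta_pos odd_zeta_ge assms(1) u1 by auto
  let ?p = "\<lambda>u. \<bar>t\<bar> powr (- (2 * u + 1))"
  have pw: "pi powr x \<le> pi ^ k" if "x \<le> real k" for x k
  proof -
    have "pi powr x \<le> pi powr real k" using that pi_gt3 by (intro powr_mono) auto
    then show ?thesis by (simp add: powr_realpow)
  qed
  have p1: "?p u \<le> pi ^ 2 * ?p v"
  proof -
    have "?p u \<le> pi powr ((2 * v + 1) - (2 * u + 1)) * ?p v"
      using assms by (intro powr_neg_le_scaled) auto
    also have "\<dots> \<le> pi ^ 2 * ?p v" using assms by (intro mult_right_mono pw) auto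
    finally show ?thesis .
  qed
  have p2: "1 \<le> pi ^ 3 * ?p v"
  proof -
    have "1 \<le> pi powr (2 * v + 1) * ?p v"
      using powr_neg_le_scaled[OF assms(4,5), of 0 "2 * v + 1"] assms by simp
    also have "\<dots> \<le> pi ^ 3 * ?p v" using assms by (intro mult_right_mono pw) auto
    finally show ?thesis .
  qed
  have "fgn_density u t \<le> (t\<^sup>2 * (?p u + 2 * odd_zeta u)) / (4 / 27 * odd_zeta u)"
    unfolding fgn_density_def using assms u1 z
    by (intro frac_le shape_le' shape_mean_ge mult_nonneg_nonneg add_nonneg_nonneg) auto
  also have "\<dots> = 27 / 4 * t\<^sup>2 * (?p u * (1 / odd_zeta u) + 2)" using z by (simp add: field_simps)
  also have "\<dots> \<le> 27 / 4 * t\<^sup>2 * ((pi ^ 2 * ?p v) * pi ^ 3 + 2 * (pi ^ 3 * ?p v))"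
  proof -
    have "1 / odd_zeta u \<le> pi ^ 3" using z by (simp add: field_simps)
    then have "?p u * (1 / odd_zeta u) \<le> (pi ^ 2 * ?p v) * pi ^ 3" using z by (intro mult_mono p1) auto
    with p2 show ?thesis by (intro mult_left_mono) auto
  qed
  also have "\<dots> = 27 * (pi ^ 5 + 2 * pi ^ 3) * (\<bar>t\<bar> powr (- (2 * v - 1)) / 4)"
    unfolding square_mult_powr[OF assms(4), symmetric] by (simp add: algebra_simps eval_nat_numeral)
  also have "\<dots> \<le> 27 * (pi ^ 5 + 2 * pi ^ 3) * shape v t"
    using assms by (intro mult_left_mono shape_ge) auto
  also have "\<dots> = 27 * (pi ^ 5 + 2 * pi ^ 3) * shape_mean v * fgn_density v t"
    using shape_mean_pos[of v] assms by (simp add: fgn_density_def)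
  finally show ?thesis .
qed

section \<open>The critical density\<close>

text \<open>Without the shift the exponents at the critical parameter would be 2 - 2h and 2h - 1,
  with sum exactly 1. The shift bounds the symbol below and replaces the first exponent by
  0.\<close>

lemma toeplitz_pair_critical:
  assumes h: "1 / 2 < h" "h < 1" and d: "0 < d"
  obtains Cf where "toeplitz_pair (fgn_density h) (\<lambda>t. fgn_density (h - 1 / 2) t + d) Cf (1 / d) 0 (2 * h - 1)"
proof -
  have v: "0 < h - 1 / 2" "h - 1 / 2 < 1" and h0: "0 < h" using h by auto
  obtain C where C: "\<And>t. t \<noteq> 0 \<Longrightarrow> \<bar>t\<bar> \<le> pi \<Longrightarrow> fgn_density h t \<le> C * \<bar>t\<bar> powr (- (2 * h - 1))"
    using fgn_density_le[OF h0 h(2)] by metis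
  have "toeplitz_pair (fgn_density h) (\<lambda>t. fgn_density (h - 1 / 2) t + d) C (1 / d) 0 (2 * h - 1)"
  proof
    fix t :: real assume t: "t \<noteq> 0" "\<bar>t\<bar> \<le> pi"
    have p: "0 < fgn_density (h - 1 / 2) t" using t v by (intro fgn_density_pos) auto
    show "0 < fgn_density h t" using h0 h t by (intro fgn_density_pos) auto
    show "0 < fgn_density (h - 1 / 2) t + d" using p d by simp
    show "fgn_density h t \<le> C * \<bar>t\<bar> powr (- (2 * h - 1))" by (rule C[OF t])
    have "1 / (fgn_density (h - 1 / 2) t + d) \<le> 1 / d" using p d by (intro divide_left_mono) auto
    then show "1 / (fgn_density (h - 1 / 2) t + d) \<le> 1 / d * \<bar>t\<bar> powr (- 0)" using t by simp
  next
    fix t :: real assume t: "0 < t" "t < pi"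
    have "isCont (shape (h - 1 / 2)) t" using v t by (intro isCont_shape) auto
    moreover have "shape_mean (h - 1 / 2) \<noteq> 0" using shape_mean_pos[OF v] by simp
    ultimately show "isCont (\<lambda>t. fgn_density (h - 1 / 2) t + d) t"
      unfolding fgn_density_def[abs_def] by (intro continuous_intros)
  next
    show "integrable circ (\<lambda>t. fgn_density (h - 1 / 2) t + d)"
      by (intro Bochner_Integration.integrable_add integrable_fgn_density v) simp
  qed (use h in \<open>auto simp: fgn_density_even\<close>)
  then show ?thesis using that by blast
qed

lemma integral_inverse:
  assumes "0 < e" "e \<le> 1"
  shows "(\<integral>t. indicator {e..1} t * (1 / t) \<partial>circ) = - ln e / (2 * pi)"
proof -
  have "(\<integral>t. (1 / t) * indicator {e..1} t \<partial>lborel) = ln 1 - ln e"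
    using assms by (intro integral_FTC_Icc_real) (auto intro!: derivative_eq_intros continuous_intros)
  moreover have "(\<lambda>t. indicator {-pi..pi} t *\<^sub>R (indicator {e..1} t * (1 / t))) = (\<lambda>t::real. (1 / t) * indicator {e..1} t)"
    using assms pi_gt3 by (auto simp: fun_eq_iff indicator_def)
  ultimately have "(LINT t:{-pi..pi}|lborel. indicator {e..1} t * (1 / t)) = - ln e"
    unfolding set_lebesgue_integral_def by (simp only: ln_one diff_0)
  moreover have "(\<integral>t. indicator {e..1} t * (1 / t) \<partial>circ)
    = of_real (1 / (2 * pi)) * (LINT t:{-pi..pi}|lborel. indicator {e..1} t * (1 / t))"
    by (rule integral_circ) measurable
  ultimately show ?thesis by simp
qed

text \<open>The quotient of the unshifted densities is at least a multiple of 1/t near 0. On {e..1}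
  a small enough shift is dominated by t^(2 - 2h), so the integral is at least a multiple of -ln
  e.\<close>

lemma critical_integral_unbounded:
  assumes h: "1 / 2 < h" "h < 1"
  shows "\<exists>k. r < (\<integral>t. fgn_density h t / (fgn_density (h - 1 / 2) t + 1 / real (Suc k)) \<partial>circ)"
proof -
  have v: "0 < h - 1 / 2" "h - 1 / 2 < 1" and h0: "0 < h" using h by auto
  obtain C where C: "0 < C" "\<And>t. t \<noteq> 0 \<Longrightarrow> \<bar>t\<bar> \<le> pi \<Longrightarrow>
      fgn_density (h - 1 / 2) t \<le> C * \<bar>t\<bar> powr (- (2 * (h - 1 / 2) - 1))"
    using fgn_density_le[OF v] by blast
  have J: "0 < shape_mean h" by (rule shape_mean_pos[OF h0 h(2)])
  \<comment> \<open>From the lower constant 1 / (4 J) of the numerator, J being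
    \<open>shape_mean h\<close>, and the constant C + 1 of the shifted denominator.\<close>
  define c where "c = 1 / (4 * shape_mean h * (C + 1))"
  have c: "0 < c" using J C by (simp add: c_def)
  \<comment> \<open>Solves c * (- ln e) / (2 pi) = |r| + 1.\<close>
  define e where "e = exp (- (2 * pi * (\<bar>r\<bar> + 1) / c))"
  have e: "0 < e" "e \<le> 1" using c by (auto simp: e_def)
  \<comment> \<open>Since 2 - 2h > 0, t^(2 - 2h) is smallest on {e..1} at t = e.\<close>
  obtain k where k: "1 / real (Suc k) < e powr (2 - 2 * h)"
    using nat_approx_posE[of "e powr (2 - 2 * h)"] e by auto
  obtain Cf where "toeplitz_pair (fgn_density h) (\<lambda>t. fgn_density (h - 1 / 2) t + 1 / real (Suc k)) Cf (1 / (1 / real (Suc k))) 0 (2 * h - 1)"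
    using toeplitz_pair_critical[OF h, of "1 / real (Suc k)"] by auto
  then interpret P: toeplitz_pair "fgn_density h" "\<lambda>t. fgn_density (h - 1 / 2) t + 1 / real (Suc k)" Cf "1 / (1 / real (Suc k))" 0 "2 * h - 1" .
  have "c * (- ln e / (2 * pi)) = \<bar>r\<bar> + 1" using c by (simp add: e_def)
  then have "r < c * (- ln e / (2 * pi))" by linarith
  also have "\<dots> = (\<integral>t. c * (indicator {e..1} t * (1 / t)) \<partial>circ)"
    unfolding integral_inverse[OF e, symmetric] by (rule integral_mult_right_zero[symmetric])
  also have "\<dots> \<le> (\<integral>t. fgn_density h t / (fgn_density (h - 1 / 2) t + 1 / real (Suc k)) \<partial>circ)"
  proof (intro integral_mono_AE AE_circI P.f_div_g_int integrable_mult_right)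
    show "integrable circ (\<lambda>t. indicator {e..1} t * (1 / t) :: real)"
      using e by (intro circ.integrable_const_bound[of _ "1 / e"]) (auto simp: indicator_def field_simps)
    fix t assume t: "- pi \<le> t" "t \<le> pi" "t \<noteq> 0"
    have fh: "0 < fgn_density h t" and g: "0 < fgn_density (h - 1 / 2) t"
      using t h h0 v by (auto intro!: fgn_density_pos)
    show "c * (indicator {e..1} t * (1 / t)) \<le> fgn_density h t / (fgn_density (h - 1 / 2) t + 1 / real (Suc k))"
    proof (cases "t \<in> {e..1}")
      case True
      then have t0: "0 < t" "e \<le> t" using e by auto
      have "e powr (2 - 2 * h) \<le> t powr (2 - 2 * h)" using t0 e h by (intro powr_mono2) auto
      then have "1 / real (Suc k) \<le> t powr (2 - 2 * h)" using k by linarith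
      moreover have "fgn_density (h - 1 / 2) t \<le> C * t powr (2 - 2 * h)" using C(2)[of t] t t0 by simp
      ultimately have den: "fgn_density (h - 1 / 2) t + 1 / real (Suc k) \<le> (C + 1) * t powr (2 - 2 * h)"
        by (simp add: algebra_simps)
      have num: "t powr (1 - 2 * h) / (4 * shape_mean h) \<le> fgn_density h t"
        using fgn_density_ge[OF h0 h(2), of t] t t0 by simp
      have "t powr (1 - 2 * h) = t powr (2 - 2 * h) / t"
        using powr_diff[of t "2 - 2 * h" 1] t0 by simp
      then have "c * (1 / t) = (t powr (1 - 2 * h) / (4 * shape_mean h)) / ((C + 1) * t powr (2 - 2 * h))"
        using t0 by (simp add: c_def)
      also have "\<dots> \<le> fgn_density h t / (fgn_density (h - 1 / 2) t + 1 / real (Suc k))"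
        using fh g by (intro frac_le num den) (auto intro: add_pos_nonneg)
      finally show ?thesis using True by simp
    qed (use fh g in simp)
  qed
  finally show ?thesis by blast
qed

theorem theorem102:
  fixes M :: "'a measure" and Hh :: real and \<xi> :: "nat \<Rightarrow> 'a \<Rightarrow> nat \<Rightarrow> real"
  assumes "prob_space M"
    and "0 < Hh" and "Hh < 1"
    and "\<And>n. gaussian_vector M n (\<xi> n)
               (\<lambda>j k. Re (toeplitz n (f_fgn Hh) $$ (j, k)))"
  shows "AE \<omega> in M.
     (\<forall>K. compact K \<and> K \<subseteq> {Hh - 1/2 <..< 1} \<inter> {0 <..< 1} \<longrightarrow>
        uniform_limit K (\<lambda>n u. rho_n n (\<xi> n \<omega>) u) (rho_inf Hh) sequentially) \<and>
     ((\<lambda>n. INF u \<in> {0 <..< 1} - ({Hh - 1/2 <..< 1} \<inter> {0 <..< 1}).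
            ereal (rho_n n (\<xi> n \<omega>) u)) \<longlonglongrightarrow> \<infinity>)"
proof -
  note h = assms(2,3)
  let ?I = "{Hh - 1/2 <..< 1} \<inter> {0 <..< 1}"
  let ?E = "{0 <..< 1} - ?I"
  let ?f = "fgn_density Hh"
  have X: "gaussian_vector M n (\<xi> n) (toep ?f)" for n
    by (rule gaussian_vector_cong[OF _ assms(4)]) (simp add: toeplitz_fgn[OF h])

  have "AE \<omega> in M. (\<lambda>n. rho_n n (\<xi> n \<omega>) u) \<longlonglongrightarrow> rho_inf Hh u" if u: "u \<in> ?I" for u
  proof -
    have u': "0 < u" "u < 1" "Hh - 1 / 2 < u" using u by auto
    obtain Cf Cg where "toeplitz_pair ?f (fgn_density u) Cf Cg (max 0 (1 - 2 * u)) (max 0 (2 * Hh - 1))"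
      using toeplitz_pair_fgn[OF h u'] by blast
    then interpret P: toeplitz_pair ?f "fgn_density u" Cf Cg "max 0 (1 - 2 * u)" "max 0 (2 * Hh - 1)" .
    obtain B where B: "\<And>n. is_inv n (toep (fgn_density u)) (B n)" using fgn_inverse[OF u'(1,2)] by blast
    show ?thesis
      using P.AE_tendsto[OF assms(1) X B]
      by (simp add: rho_n_eq[OF u'(1,2) B] P.lim_def rho_inf_eq[OF h(1) u'(1)])
  qed
  \<comment> \<open>Only countably many null sets are united; monotonicity then supplies all other
    parameters on the same event.\<close>
  then have "AE \<omega> in M. \<forall>u\<in>\<rat> \<inter> ?I. (\<lambda>n. rho_n n (\<xi> n \<omega>) u) \<longlonglongrightarrow> rho_inf Hh u"
    by (subst AE_ball_countable) (auto intro: countable_subset[OF _ countable_rat])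
  then have part1: "AE \<omega> in M. \<forall>K. compact K \<and> K \<subseteq> ?I \<longrightarrow>
      uniform_limit K (\<lambda>n u. rho_n n (\<xi> n \<omega>) u) (rho_inf Hh) sequentially"
  proof eventually_elim
    case (elim \<omega>)
    show ?case
    proof (intro allI impI, elim conjE)
      fix K assume K: "compact K" "K \<subseteq> ?I"
      show "uniform_limit K (\<lambda>n u. rho_n n (\<xi> n \<omega>) u) (rho_inf Hh) sequentially"
        by (rule rho_uniform_limit_compact[OF h K]) (use elim in blast)
    qed
  qed

  have part2: "AE \<omega> in M. (\<lambda>n. INF u \<in> ?E. ereal (rho_n n (\<xi> n \<omega>) u)) \<longlonglongrightarrow> \<infinity>"
  proof (cases "1 / 2 < Hh")
    case False
    \<comment> \<open>For H <= 1/2 the interval I is all of (0,1), and the infimum over the empty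
      set is infinite.\<close>
    then have E: "?E = {}" by auto
    show ?thesis unfolding E by (simp add: top_ereal_def)
  next
    case True
    define v where "v = Hh - 1 / 2"
    have v: "0 < v" "v < 1" using True h by (auto simp: v_def)
    define g where "g k t = fgn_density v t + 1 / real (Suc k)" for k t
    have g_int: "integrable circ (g k)" for k
      unfolding g_def[abs_def] by (intro Bochner_Integration.integrable_add integrable_fgn_density v) simp
    have g_pos: "AE t in circ. 0 < g k t" for k
      unfolding g_def using v by (intro AE_circI add_pos_pos fgn_density_pos) auto
    define B where "B k n = (SOME B. is_inv n (toep (g k)) B)" for k n
    have B: "is_inv n (toep (g k)) (B k n)" for k n
      unfolding B_def by (rule someI_ex[OF ex_is_inv]) (rule bil_toep_eq_0D[OF g_int g_pos])
    define lim where "lim k = (\<integral>t. ?f t / g k t \<partial>circ)" for k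
    have "AE \<omega> in M. (\<lambda>n. bil n (B k n) (\<xi> n \<omega>) (\<xi> n \<omega>) / real n) \<longlonglongrightarrow> lim k" for k
    proof -
      obtain Cf where "toeplitz_pair ?f (g k) Cf (1 / (1 / real (Suc k))) 0 (2 * Hh - 1)"
        using toeplitz_pair_critical[OF True h(2), of "1 / real (Suc k)"] unfolding g_def[abs_def] v_def by auto
      then interpret P: toeplitz_pair ?f "g k" Cf "1 / (1 / real (Suc k))" 0 "2 * Hh - 1" .
      show ?thesis using P.AE_tendsto[OF assms(1) X B] by (simp add: P.lim_def lim_def)
    qed
    then have "AE \<omega> in M. \<forall>k. (\<lambda>n. bil n (B k n) (\<xi> n \<omega>) (\<xi> n \<omega>) / real n) \<longlonglongrightarrow> lim k"
      by (simp add: AE_all_countable)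
    then show ?thesis
    proof eventually_elim
      case (elim \<omega>)
      define C where "C = 27 * (pi ^ 5 + 2 * pi ^ 3) * shape_mean v"
      have C: "0 < C" using shape_mean_pos[OF v] by (simp add: C_def add_pos_pos)
      show ?case
        unfolding tendsto_PInfty
      proof
        fix r :: real
        obtain k where k: "C * (r + 1) < lim k"
          using critical_integral_unbounded[OF True h(2), of "C * (r + 1)"] unfolding lim_def g_def v_def by blast
        from order_tendstoD(1)[OF elim[rule_format, of k] this]
        show "\<forall>\<^sub>F n in sequentially. ereal r < (INF u \<in> ?E. ereal (rho_n n (\<xi> n \<omega>) u))"
        proof eventually_elim
          case (elim n)
          \<comment> \<open>Strict inequalities need not survive an infimum, so the target r is
            raised by 1.\<close>
          have "r + 1 \<le> rho_n n (\<xi> n \<omega>) u" if u: "u \<in> ?E" for u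
          proof -
            have u': "0 < u" "u < 1" "u \<le> v" using u by (auto simp: v_def)
            have "bil n (B k n) (\<xi> n \<omega>) (\<xi> n \<omega>) / real n \<le> C * rho_n n (\<xi> n \<omega>) u"
            proof (rule rho_n_compare[OF u'(1,2) g_int g_pos B _ C])
              fix t :: real assume t: "t \<noteq> 0" "\<bar>t\<bar> \<le> pi"
              have "fgn_density u t \<le> C * fgn_density v t"
                unfolding C_def by (rule fgn_density_le_critical[OF u'(1,3) v(2) t])
              also have "\<dots> \<le> C * g k t" using C by (simp add: g_def)
              finally show "fgn_density u t \<le> C * g k t" .
            qed
            then have "C * (r + 1) < C * rho_n n (\<xi> n \<omega>) u" using elim by linarith
            then show ?thesis using C by simp
          qed
          then have "ereal (r + 1) \<le> (INF u \<in> ?E. ereal (rho_n n (\<xi> n \<omega>) u))"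
            by (intro INF_greatest) simp
          moreover have "ereal r < ereal (r + 1)" by simp
          ultimately show ?case by (rule less_le_trans[rotated])
        qed
      qed
    qed
  qed
  from part1 part2 show ?thesis by eventually_elim blast
qed

end
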